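(* Let $G$ be a compact Lie group and let $M$ be an almost Kähler manifold equipped with a Hamiltonian $(G\times S^1)$-action preserving the almost Kähler structure, with moment map $\mu=(\mu_G,\mu_{S^1})$, and with a holomorphic function $s\colon M\to V$ valued in a complex vector space $V$, such that: (1) $s$ is $G$-invariant and homogeneous of some positive degree $d$ for the $S^1$-action, i.e. $s(tx)=t^d s(x)$ for all $t\in S^1$, $x\in M$; (2) $0$ is a regular value of both $s$ and $\mu_G$, the submanifolds $\mu_G^{-1}(0)$ and $s^{-1}(0)$ intersect transversely, and $G$ acts freely on $\mu_G^{-1}(0)$; (3) $M$ and $M/\!/G$ are circle compact for their respective $S^1$-actions. Then the restriction map $$H^*(M/\!/G;R)\longrightarrow H^*(M/\!/\!/G;R)$$ induced by the inclusion $M/\!/\!/G\hookrightarrow M/\!/G$ is an isomorphism for every coefficient ring $R$.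
   Context: An almost Kähler manifold is a symplectic manifold $(M,\omega)$ with a compatible almost complex structure $I$ (and associated Riemannian metric). A function $s\colon M\to V$ into a finite-dimensional complex vector space is holomorphic if $\mathrm{d}s\circ I=\sqrt{-1}\,\mathrm{d}s$. The moment map of the $(G\times S^1)$-action is equivariant; circle moment maps are normalized so that the standard rotation of $\mathbf{C}$ has moment map $\frac12|z|^2$. $M/\!/G:=\mu_G^{-1}(0)/G$ and $M/\!/\!/G:=\bigl(\mu_G^{-1}(0)\cap s^{-1}(0)\bigr)/G$ (the *hyper-reduction* ). The $S^1$-action and its moment map descend to $M/\!/G$. A symplectic manifold $X$ with a Hamiltonian $S^1$-action is *circle compact* if the fixed point set $X^{S^1}$ is compact and the $S^1$-moment map $X\to\mathbf{R}$ is proper and bounded below. *)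

theory Defs
  imports
    "HOL-Analysis.Analysis"
    "HOL-Homology.Homology"
    "HOL-Algebra.Group_Action"
begin

section \<open>Smooth manifolds\<close>

text \<open>
  The model space of a manifold is an arbitrary finite-dimensional real normed space. The class
  \<open>euclidean_space\<close> is avoided because it excludes dimension \<open>0\<close>, hence finite groups \<open>G\<close>.
\<close>

definition finite_dimensional :: "'a::real_vector itself \<Rightarrow> bool" where
  "finite_dimensional _ \<longleftrightarrow> (\<exists>B::'a set. finite B \<and> span B = UNIV)"

text \<open>Used only for open \<open>S\<close> in a finite-dimensional space, where it is the notion \<open>C\<^sup>k\<close>.\<close>

primrec Ck_on :: "nat \<Rightarrow> 'a::real_normed_vector set \<Rightarrow> ('a \<Rightarrow> 'b::real_normed_vector) \<Rightarrow> bool" where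
  "Ck_on 0 S f \<longleftrightarrow> continuous_on S f"
| "Ck_on (Suc k) S f \<longleftrightarrow>
     (\<forall>x\<in>S. f differentiable (at x)) \<and> (\<forall>v. Ck_on k S (\<lambda>x. frechet_derivative f (at x) v))"

definition smooth_on :: "'a::real_normed_vector set \<Rightarrow> ('a \<Rightarrow> 'b::real_normed_vector) \<Rightarrow> bool" where
  "smooth_on S f \<longleftrightarrow> (\<forall>k. Ck_on k S f)"

type_synonym ('m, 'e) chart = "'m set \<times> ('m \<Rightarrow> 'e)"

abbreviation chart_dom :: "('m, 'e) chart \<Rightarrow> 'm set" where
  "chart_dom c \<equiv> fst c"

abbreviation chart_map :: "('m, 'e) chart \<Rightarrow> 'm \<Rightarrow> 'e" where
  "chart_map c \<equiv> snd c"

abbreviation chart_image :: "('m, 'e) chart \<Rightarrow> 'e set" where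
  "chart_image c \<equiv> chart_map c ` chart_dom c"

definition local_rep :: "('m, 'e) chart \<Rightarrow> ('m \<Rightarrow> 'a) \<Rightarrow> 'e \<Rightarrow> 'a" where
  "local_rep c f = f \<circ> inv_into (chart_dom c) (chart_map c)"

text \<open>
  The differential at \<open>x\<close>, read in the chart \<open>c\<close>. For a chart \<open>d\<close> of the target,
  \<open>differential c (chart_map d \<circ> f) x\<close> is the tangent map of \<open>f\<close>; in particular
  \<open>differential c (chart_map d) x\<close> is the change of coordinates of tangent vectors.
\<close>

definition differential ::
    "('m, 'e::real_normed_vector) chart \<Rightarrow> ('m \<Rightarrow> 'a::real_normed_vector) \<Rightarrow> 'm \<Rightarrow> 'e \<Rightarrow> 'a" where
  "differential c f x = frechet_derivative (local_rep c f) (at (chart_map c x))"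

record ('m, 'e) manifold =
  mtop :: "'m topology"
  atlas :: "('m, 'e) chart set"

abbreviation points :: "('m, 'e) manifold \<Rightarrow> 'm set" where
  "points M \<equiv> topspace (mtop M)"

definition charts_at :: "('m, 'e) manifold \<Rightarrow> 'm \<Rightarrow> ('m, 'e) chart set" where
  "charts_at M x = {c \<in> atlas M. x \<in> chart_dom c}"

definition smooth_manifold :: "('m, 'e::real_normed_vector) manifold \<Rightarrow> bool" where
  "smooth_manifold M \<longleftrightarrow>
     finite_dimensional TYPE('e) \<and>
     Hausdorff_space (mtop M) \<and> second_countable (mtop M) \<and>
     points M = \<Union> (chart_dom ` atlas M) \<and>
     (\<forall>c\<in>atlas M. openin (mtop M) (chart_dom c) \<and> open (chart_image c) \<and>
        homeomorphic_map (subtopology (mtop M) (chart_dom c)) (top_of_set (chart_image c))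
          (chart_map c)) \<and>
     (\<forall>c\<in>atlas M. \<forall>d\<in>atlas M.
        smooth_on (chart_map c ` (chart_dom c \<inter> chart_dom d)) (local_rep c (chart_map d)))"

definition smooth_function ::
    "('m, 'e::real_normed_vector) manifold \<Rightarrow> ('m \<Rightarrow> 'a::real_normed_vector) \<Rightarrow> bool" where
  "smooth_function M f \<longleftrightarrow> (\<forall>c\<in>atlas M. smooth_on (chart_image c) (local_rep c f))"

definition smooth_map ::
    "('m, 'e::real_normed_vector) manifold \<Rightarrow> ('n, 'f::real_normed_vector) manifold \<Rightarrow>
     ('m \<Rightarrow> 'n) \<Rightarrow> bool" where
  "smooth_map M N f \<longleftrightarrow>
     continuous_map (mtop M) (mtop N) f \<and>
     (\<forall>c\<in>atlas M. \<forall>d\<in>atlas N.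
        smooth_on (chart_map c ` {x \<in> chart_dom c. f x \<in> chart_dom d})
          (local_rep c (chart_map d \<circ> f)))"

definition prod_chart :: "('m, 'e) chart \<Rightarrow> ('n, 'f) chart \<Rightarrow> ('m \<times> 'n, 'e \<times> 'f) chart" where
  "prod_chart c d = (chart_dom c \<times> chart_dom d, map_prod (chart_map c) (chart_map d))"

definition prod_manifold ::
    "('m, 'e) manifold \<Rightarrow> ('n, 'f) manifold \<Rightarrow> ('m \<times> 'n, 'e \<times> 'f) manifold" where
  "prod_manifold M N =
     \<lparr>mtop = prod_topology (mtop M) (mtop N),
      atlas = {prod_chart c d | c d. c \<in> atlas M \<and> d \<in> atlas N}\<rparr>"

definition regular_value ::
    "('m, 'e::real_normed_vector) manifold \<Rightarrow> ('m \<Rightarrow> 'a::real_normed_vector) \<Rightarrow> 'a \<Rightarrow> bool" where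
  "regular_value M f a \<longleftrightarrow>
     (\<forall>x\<in>points M. f x = a \<longrightarrow> (\<forall>c\<in>charts_at M x. surj (differential c f x)))"

definition zero_set :: "('m, 'e) manifold \<Rightarrow> ('m \<Rightarrow> 'a::zero) \<Rightarrow> 'm set" where
  "zero_set M f = {x \<in> points M. f x = 0}"

text \<open>Tangent space of a submanifold \<open>N\<close> at \<open>x\<close>: velocities of smooth curves lying in \<open>N\<close>.\<close>

definition tangent_space_of ::
    "('m, 'e::real_normed_vector) chart \<Rightarrow> 'm set \<Rightarrow> 'm \<Rightarrow> 'e set" where
  "tangent_space_of c N x =
     {u. \<exists>(\<gamma>::real \<Rightarrow> 'm) \<epsilon>. \<epsilon> > 0 \<and> \<gamma> 0 = x \<and> \<gamma> ` {-\<epsilon><..<\<epsilon>} \<subseteq> N \<inter> chart_dom c \<and>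
        smooth_on {-\<epsilon><..<\<epsilon>} (chart_map c \<circ> \<gamma>) \<and>
        ((chart_map c \<circ> \<gamma>) has_vector_derivative u) (at 0)}"

definition transverse_in ::
    "('m, 'e::real_normed_vector) manifold \<Rightarrow> 'm set \<Rightarrow> 'm set \<Rightarrow> bool" where
  "transverse_in M N N' \<longleftrightarrow>
     (\<forall>x\<in>N \<inter> N'. \<forall>c\<in>charts_at M x.
        {u + v | u v. u \<in> tangent_space_of c N x \<and> v \<in> tangent_space_of c N' x} = UNIV)"


section \<open>Almost Kaehler manifolds\<close>

text \<open>
  A tensor field is given by its components in every chart of the atlas, subject to the
  transformation law under changes of charts.
\<close>

type_synonym ('m, 'e) bilinear_field = "('m, 'e) chart \<Rightarrow> 'm \<Rightarrow> 'e \<Rightarrow> 'e \<Rightarrow> real"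
type_synonym ('m, 'e) endo_field = "('m, 'e) chart \<Rightarrow> 'm \<Rightarrow> 'e \<Rightarrow> 'e"

definition two_form ::
    "('m, 'e::real_normed_vector) manifold \<Rightarrow> ('m, 'e) bilinear_field \<Rightarrow> bool" where
  "two_form M \<omega> \<longleftrightarrow>
     (\<forall>c\<in>atlas M.
        (\<forall>x\<in>chart_dom c. bilinear (\<omega> c x) \<and> (\<forall>u. \<omega> c x u u = 0)) \<and>
        (\<forall>u v. smooth_on (chart_image c) (local_rep c (\<lambda>x. \<omega> c x u v))) \<and>
        (\<forall>d\<in>atlas M. \<forall>x\<in>chart_dom c \<inter> chart_dom d. \<forall>u v.
           \<omega> d x (differential c (chart_map d) x u) (differential c (chart_map d) x v)
             = \<omega> c x u v))"

text \<open>\<open>d\<omega> = 0\<close>, evaluated on constant coordinate vector fields \<open>u\<close>, \<open>v\<close>, \<open>w\<close>.\<close>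

definition closed_two_form ::
    "('m, 'e::real_normed_vector) manifold \<Rightarrow> ('m, 'e) bilinear_field \<Rightarrow> bool" where
  "closed_two_form M \<omega> \<longleftrightarrow>
     two_form M \<omega> \<and>
     (\<forall>c\<in>atlas M. \<forall>x\<in>chart_dom c. \<forall>u v w.
        differential c (\<lambda>y. \<omega> c y v w) x u
        + differential c (\<lambda>y. \<omega> c y w u) x v
        + differential c (\<lambda>y. \<omega> c y u v) x w = 0)"

definition symplectic_manifold ::
    "('m, 'e::real_normed_vector) manifold \<Rightarrow> ('m, 'e) bilinear_field \<Rightarrow> bool" where
  "symplectic_manifold M \<omega> \<longleftrightarrow>
     smooth_manifold M \<and> closed_two_form M \<omega> \<and>
     (\<forall>c\<in>atlas M. \<forall>x\<in>chart_dom c. \<forall>u. u \<noteq> 0 \<longrightarrow> (\<exists>v. \<omega> c x u v \<noteq> 0))"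

definition almost_complex_structure ::
    "('m, 'e::real_normed_vector) manifold \<Rightarrow> ('m, 'e) endo_field \<Rightarrow> bool" where
  "almost_complex_structure M I \<longleftrightarrow>
     (\<forall>c\<in>atlas M.
        (\<forall>x\<in>chart_dom c. linear (I c x) \<and> (\<forall>u. I c x (I c x u) = - u)) \<and>
        (\<forall>u. smooth_on (chart_image c) (local_rep c (\<lambda>x. I c x u))) \<and>
        (\<forall>d\<in>atlas M. \<forall>x\<in>chart_dom c \<inter> chart_dom d. \<forall>u.
           I d x (differential c (chart_map d) x u) = differential c (chart_map d) x (I c x u)))"

text \<open>
  Compatibility says that \<open>g(u, v) = \<omega>(u, I v)\<close> is a Riemannian metric: the first condition is
  the symmetry of \<open>g\<close>, the second one its positivity.
\<close>

definition almost_kaehler ::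
    "('m, 'e::real_normed_vector) manifold \<Rightarrow> ('m, 'e) bilinear_field \<Rightarrow> ('m, 'e) endo_field \<Rightarrow> bool"
  where
  "almost_kaehler M \<omega> I \<longleftrightarrow>
     symplectic_manifold M \<omega> \<and> almost_complex_structure M I \<and>
     (\<forall>c\<in>atlas M. \<forall>x\<in>chart_dom c.
        (\<forall>u v. \<omega> c x u (I c x v) = \<omega> c x v (I c x u)) \<and>
        (\<forall>u. u \<noteq> 0 \<longrightarrow> \<omega> c x u (I c x u) > 0))"

text \<open>
  A finite-dimensional complex vector space; its norm only serves to provide the topology and
  the notion of derivative, both of which are independent of the norm.
\<close>

definition complex_space :: "(complex \<Rightarrow> 'v::real_normed_vector \<Rightarrow> 'v) \<Rightarrow> bool" where
  "complex_space cscale \<longleftrightarrow>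
     vector_space cscale \<and> (\<forall>r v. cscale (complex_of_real r) v = r *\<^sub>R v) \<and>
     finite_dimensional TYPE('v)"

definition holomorphic_function ::
    "('m, 'e::real_normed_vector) manifold \<Rightarrow> ('m, 'e) endo_field \<Rightarrow>
     (complex \<Rightarrow> 'v::real_normed_vector \<Rightarrow> 'v) \<Rightarrow> ('m \<Rightarrow> 'v) \<Rightarrow> bool" where
  "holomorphic_function M I cscale s \<longleftrightarrow>
     smooth_function M s \<and>
     (\<forall>c\<in>atlas M. \<forall>x\<in>chart_dom c. \<forall>u.
        differential c s x (I c x u) = cscale \<i> (differential c s x u))"


section \<open>Lie groups and Hamiltonian actions\<close>

definition lie_group :: "'g monoid \<Rightarrow> ('g, 'h::real_normed_vector) manifold \<Rightarrow> bool" where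
  "lie_group G N \<longleftrightarrow>
     group G \<and> smooth_manifold N \<and> points N = carrier G \<and>
     smooth_map (prod_manifold N N) N (\<lambda>(g, h). g \<otimes>\<^bsub>G\<^esub> h) \<and>
     smooth_map N N (\<lambda>g. inv\<^bsub>G\<^esub> g)"

definition circle_group :: "complex monoid" where
  "circle_group = \<lparr>carrier = sphere 0 1, monoid.mult = (*), one = 1\<rparr>"

text \<open>The angle coordinate with values in \<open>(a, a + 2\<pi>)\<close>.\<close>

definition angle_chart :: "real \<Rightarrow> (complex, real) chart" where
  "angle_chart a = (cis ` {a<..<a + 2 * pi}, inv_into {a<..<a + 2 * pi} cis)"

definition circle_manifold :: "(complex, real) manifold" where
  "circle_manifold = \<lparr>mtop = top_of_set (sphere 0 1), atlas = range angle_chart\<rparr>"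

text \<open>
  Below, \<open>e\<close> is a chart around the unit of the group \<open>K\<close>, through which the Lie algebra
  \<open>T\<^sub>1K\<close> is identified with the model space \<open>'k\<close>; accordingly the dual of the Lie algebra is
  \<open>'k \<Rightarrow>\<^sub>L real\<close>.
\<close>

definition Ad ::
    "'k monoid \<Rightarrow> ('k, 'l::real_normed_vector) chart \<Rightarrow> 'k \<Rightarrow> 'l \<Rightarrow> 'l" where
  "Ad K e k = differential e (\<lambda>h. chart_map e (k \<otimes>\<^bsub>K\<^esub> h \<otimes>\<^bsub>K\<^esub> inv\<^bsub>K\<^esub> k)) \<one>\<^bsub>K\<^esub>"

text \<open>
  The vector field generated by \<open>\<xi>\<close>, read in the chart \<open>c\<close>: the derivative at the unit of
  \<open>k \<mapsto> k x\<close> in the direction \<open>\<xi>\<close>.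
\<close>

definition generator ::
    "'k monoid \<Rightarrow> ('k, 'l::real_normed_vector) chart \<Rightarrow> ('k \<Rightarrow> 'm \<Rightarrow> 'm) \<Rightarrow> 'l \<Rightarrow>
     ('m, 'e::real_normed_vector) chart \<Rightarrow> 'm \<Rightarrow> 'e" where
  "generator K e act \<xi> c x = differential e (\<lambda>k. chart_map c (act k x)) \<one>\<^bsub>K\<^esub> \<xi>"

definition smooth_action ::
    "'k monoid \<Rightarrow> ('k, 'l::real_normed_vector) manifold \<Rightarrow> ('m, 'e::real_normed_vector) manifold \<Rightarrow>
     ('k \<Rightarrow> 'm \<Rightarrow> 'm) \<Rightarrow> bool" where
  "smooth_action K N M act \<longleftrightarrow>
     group_action K (points M) act \<and> smooth_map (prod_manifold N M) M (\<lambda>(k, x). act k x)"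

definition preserves_form ::
    "'k monoid \<Rightarrow> ('m, 'e::real_normed_vector) manifold \<Rightarrow> ('k \<Rightarrow> 'm \<Rightarrow> 'm) \<Rightarrow>
     ('m, 'e) bilinear_field \<Rightarrow> bool" where
  "preserves_form K M act \<omega> \<longleftrightarrow>
     (\<forall>k\<in>carrier K. \<forall>x\<in>points M. \<forall>c\<in>charts_at M x. \<forall>d\<in>charts_at M (act k x). \<forall>u v.
        \<omega> d (act k x) (differential c (chart_map d \<circ> act k) x u)
                      (differential c (chart_map d \<circ> act k) x v) = \<omega> c x u v)"

definition preserves_endo ::
    "'k monoid \<Rightarrow> ('m, 'e::real_normed_vector) manifold \<Rightarrow> ('k \<Rightarrow> 'm \<Rightarrow> 'm) \<Rightarrow>
     ('m, 'e) endo_field \<Rightarrow> bool" where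
  "preserves_endo K M act I \<longleftrightarrow>
     (\<forall>k\<in>carrier K. \<forall>x\<in>points M. \<forall>c\<in>charts_at M x. \<forall>d\<in>charts_at M (act k x). \<forall>u.
        I d (act k x) (differential c (chart_map d \<circ> act k) x u)
          = differential c (chart_map d \<circ> act k) x (I c x u))"

text \<open>
  The sign is \<open>d\<langle>\<mu>, \<xi>\<rangle> = \<omega>(\<sqdot>, \<xi>\<^sub>M)\<close>. On the complex plane with \<open>\<omega> = dx \<and> dy\<close> (so that
  \<open>\<omega>(u, \<i> u) > 0\<close>) the standard rotation is generated by \<open>z \<mapsto> \<i> z\<close> and has moment map
  \<open>\<bar>z\<bar>\<^sup>2 / 2\<close>, as required. The last condition is equivariance for the coadjoint action.
\<close>

definition moment_map ::
    "'k monoid \<Rightarrow> ('k, 'l::real_normed_vector) chart \<Rightarrow> ('m, 'e::real_normed_vector) manifold \<Rightarrow>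
     ('m, 'e) bilinear_field \<Rightarrow> ('k \<Rightarrow> 'm \<Rightarrow> 'm) \<Rightarrow> ('m \<Rightarrow> 'l \<Rightarrow>\<^sub>L real) \<Rightarrow> bool" where
  "moment_map K e M \<omega> act \<mu> \<longleftrightarrow>
     smooth_function M \<mu> \<and>
     (\<forall>c\<in>atlas M. \<forall>x\<in>chart_dom c. \<forall>\<xi> u.
        differential c (\<lambda>y. blinfun_apply (\<mu> y) \<xi>) x u = \<omega> c x u (generator K e act \<xi> c x)) \<and>
     (\<forall>k\<in>carrier K. \<forall>x\<in>points M. \<forall>\<xi>.
        blinfun_apply (\<mu> (act k x)) (Ad K e k \<xi>) = blinfun_apply (\<mu> x) \<xi>)"

definition hamiltonian_action ::
    "'k monoid \<Rightarrow> ('k, 'l::real_normed_vector) manifold \<Rightarrow> ('k, 'l) chart \<Rightarrow>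
     ('m, 'e::real_normed_vector) manifold \<Rightarrow> ('m, 'e) bilinear_field \<Rightarrow> ('k \<Rightarrow> 'm \<Rightarrow> 'm) \<Rightarrow>
     ('m \<Rightarrow> 'l \<Rightarrow>\<^sub>L real) \<Rightarrow> bool" where
  "hamiltonian_action K N e M \<omega> act \<mu> \<longleftrightarrow>
     smooth_action K N M act \<and> preserves_form K M act \<omega> \<and>
     e \<in> charts_at N \<one>\<^bsub>K\<^esub> \<and> moment_map K e M \<omega> act \<mu>"

text \<open>
  The pair \<open>(\<mu>\<^sub>G, \<mu>\<^sub>S)\<close> as a map to the dual of the product Lie algebra:
  \<open>\<langle>\<mu>(x), (\<xi>, \<tau>)\<rangle> = \<langle>\<mu>\<^sub>G(x), \<xi>\<rangle> + \<tau> \<mu>\<^sub>S(x)\<close>.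
\<close>

definition pair_moment ::
    "('m \<Rightarrow> 'h::real_normed_vector \<Rightarrow>\<^sub>L real) \<Rightarrow> ('m \<Rightarrow> real) \<Rightarrow> 'm \<Rightarrow> ('h \<times> real) \<Rightarrow>\<^sub>L real" where
  "pair_moment \<mu>\<^sub>G \<mu>\<^sub>S x = (\<mu>\<^sub>G x o\<^sub>L fst_blinfun) + (\<mu>\<^sub>S x *\<^sub>R snd_blinfun)"


section \<open>Reduced spaces and circle compactness\<close>

text \<open>The quotient topology on the set of \<open>G\<close>-orbits contained in the invariant subset \<open>Z\<close> of \<open>X\<close>.\<close>

definition orbit_topology ::
    "'g monoid \<Rightarrow> ('g \<Rightarrow> 'm \<Rightarrow> 'm) \<Rightarrow> 'm topology \<Rightarrow> 'm set \<Rightarrow> 'm set topology" where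
  "orbit_topology G act X Z =
     topology (\<lambda>U. U \<subseteq> orbits G Z act \<and>
                   openin (subtopology X Z) {x \<in> topspace X \<inter> Z. orbit G act x \<in> U})"

lemma openin_orbit_topology:
  "openin (orbit_topology G act X Z) U \<longleftrightarrow>
     U \<subseteq> orbits G Z act \<and> openin (subtopology X Z) {x \<in> topspace X \<inter> Z. orbit G act x \<in> U}"
proof -
  let ?P = "\<lambda>U. {x \<in> topspace X \<inter> Z. orbit G act x \<in> U}"
  have Int: "?P (S \<inter> T) = ?P S \<inter> ?P T" for S T by auto
  have Union: "?P (\<Union>\<K>) = \<Union> (?P ` \<K>)" for \<K> by auto
  have "istopology (\<lambda>U. U \<subseteq> orbits G Z act \<and> openin (subtopology X Z) (?P U))"
    unfolding istopology_def Int Union by (auto intro!: openin_Int openin_Union)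
  then show ?thesis
    unfolding orbit_topology_def by (simp add: topology_inverse')
qed

lemma topspace_orbit_topology:
  assumes "Z \<subseteq> topspace X"
  shows "topspace (orbit_topology G act X Z) = orbits G Z act"
proof
  show "topspace (orbit_topology G act X Z) \<subseteq> orbits G Z act"
    unfolding topspace_def openin_orbit_topology by auto
  have "{x \<in> topspace X \<inter> Z. orbit G act x \<in> orbits G Z act} = topspace (subtopology X Z)"
    by (auto simp: orbits_def)
  then have "openin (orbit_topology G act X Z) (orbits G Z act)"
    unfolding openin_orbit_topology by (metis openin_topspace subset_refl)
  then show "orbits G Z act \<subseteq> topspace (orbit_topology G act X Z)"
    by (rule openin_subset)
qed

lemma quotient_map_orbit_topology:
  assumes "Z \<subseteq> topspace X"
  shows "quotient_map (subtopology X Z) (orbit_topology G act X Z) (orbit G act)"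
  unfolding quotient_map_def topspace_orbit_topology[OF assms] openin_orbit_topology
  using assms by (auto simp: orbits_def)

text \<open>\<open>M // G\<close> and \<open>M /// G\<close> for an action of \<open>G \<times> S\<^sup>1\<close>.\<close>

definition reduction ::
    "'g monoid \<Rightarrow> ('m, 'e) manifold \<Rightarrow> ('g \<times> complex \<Rightarrow> 'm \<Rightarrow> 'm) \<Rightarrow> ('m \<Rightarrow> 'a::zero) \<Rightarrow>
     'm set topology" where
  "reduction G M act \<mu>\<^sub>G = orbit_topology G (\<lambda>g. act (g, 1)) (mtop M) (zero_set M \<mu>\<^sub>G)"

definition hyper_reduction ::
    "'g monoid \<Rightarrow> ('m, 'e) manifold \<Rightarrow> ('g \<times> complex \<Rightarrow> 'm \<Rightarrow> 'm) \<Rightarrow> ('m \<Rightarrow> 'a::zero) \<Rightarrow>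
     ('m \<Rightarrow> 'v::zero) \<Rightarrow> 'm set topology" where
  "hyper_reduction G M act \<mu>\<^sub>G s =
     orbit_topology G (\<lambda>g. act (g, 1)) (mtop M) (zero_set M \<mu>\<^sub>G \<inter> zero_set M s)"

text \<open>
  The circle action and its moment map on \<open>M // G\<close>, whose points are orbits \<open>P\<close>. The function
  \<open>\<mu>\<^sub>S\<close> is constant on each orbit by equivariance of \<open>(\<mu>\<^sub>G, \<mu>\<^sub>S)\<close>.
\<close>

definition reduced_circle_action ::
    "'g monoid \<Rightarrow> ('g \<times> complex \<Rightarrow> 'm \<Rightarrow> 'm) \<Rightarrow> complex \<Rightarrow> 'm set \<Rightarrow> 'm set" where
  "reduced_circle_action G act t P = act (\<one>\<^bsub>G\<^esub>, t) ` P"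

definition reduced_moment :: "('m \<Rightarrow> real) \<Rightarrow> 'm set \<Rightarrow> real" where
  "reduced_moment \<mu>\<^sub>S P = the_elem (\<mu>\<^sub>S ` P)"

definition circle_compact ::
    "'a topology \<Rightarrow> (complex \<Rightarrow> 'a \<Rightarrow> 'a) \<Rightarrow> ('a \<Rightarrow> real) \<Rightarrow> bool" where
  "circle_compact X act \<mu> \<longleftrightarrow>
     compactin X {x \<in> topspace X. \<forall>t\<in>carrier circle_group. act t x = x} \<and>
     proper_map X euclideanreal \<mu> \<and>
     (\<exists>B. \<forall>x\<in>topspace X. B \<le> \<mu> x)"


section \<open>Singular cohomology\<close>

text \<open>
  The sort \<open>{ring, monoid_mult}\<close> is the class of unital rings, the zero ring included.
\<close>

definition additive_group :: "'r::ring monoid" where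
  "additive_group = \<lparr>carrier = UNIV, monoid.mult = (+), one = 0\<rparr>"

definition cochain_set :: "nat \<Rightarrow> 'a topology \<Rightarrow> ('a chain \<Rightarrow> 'r::{ring,monoid_mult}) set" where
  "cochain_set p X =
     hom (chain_group p X) additive_group \<inter> extensional (carrier (chain_group p X))"

definition cochain_group :: "nat \<Rightarrow> 'a topology \<Rightarrow> ('a chain \<Rightarrow> 'r::{ring,monoid_mult}) monoid" where
  "cochain_group p X =
     \<lparr>carrier = cochain_set p X,
      monoid.mult = (\<lambda>f g. \<lambda>c\<in>carrier (chain_group p X). f c + g c),
      one = (\<lambda>c\<in>carrier (chain_group p X). 0)\<rparr>"

definition coboundary ::
    "nat \<Rightarrow> 'a topology \<Rightarrow> ('a chain \<Rightarrow> 'r) \<Rightarrow> 'a chain \<Rightarrow> 'r::{ring,monoid_mult}" where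
  "coboundary p X f = (\<lambda>c\<in>carrier (chain_group (Suc p) X). f (chain_boundary (Suc p) c))"

definition cocycle_set :: "nat \<Rightarrow> 'a topology \<Rightarrow> ('a chain \<Rightarrow> 'r::{ring,monoid_mult}) set" where
  "cocycle_set p X = {f \<in> cochain_set p X. coboundary p X f = \<one>\<^bsub>cochain_group (Suc p) X\<^esub>}"

definition coboundary_set :: "nat \<Rightarrow> 'a topology \<Rightarrow> ('a chain \<Rightarrow> 'r::{ring,monoid_mult}) set" where
  "coboundary_set p X =
     (case p of 0 \<Rightarrow> {\<one>\<^bsub>cochain_group 0 X\<^esub>} | Suc q \<Rightarrow> coboundary q X ` cochain_set q X)"

definition cohomology_group ::
    "nat \<Rightarrow> 'a topology \<Rightarrow> ('a chain \<Rightarrow> 'r::{ring,monoid_mult}) set monoid" where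
  "cohomology_group p X =
     subgroup_generated (cochain_group p X) (cocycle_set p X) Mod coboundary_set p X"

definition cohomology_scale ::
    "nat \<Rightarrow> 'a topology \<Rightarrow> 'r \<Rightarrow> ('a chain \<Rightarrow> 'r::{ring,monoid_mult}) set \<Rightarrow> ('a chain \<Rightarrow> 'r) set" where
  "cohomology_scale p X r A =
     coboundary_set p X <#>\<^bsub>cochain_group p X\<^esub>
       (\<lambda>f. \<lambda>c\<in>carrier (chain_group p X). r * f c) ` A"

definition cochain_pullback ::
    "nat \<Rightarrow> 'a topology \<Rightarrow> ('a \<Rightarrow> 'b) \<Rightarrow> ('b chain \<Rightarrow> 'r) \<Rightarrow> 'a chain \<Rightarrow> 'r::{ring,monoid_mult}" where
  "cochain_pullback p Y h f = (\<lambda>c\<in>carrier (chain_group p Y). f (chain_map p h c))"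

text \<open>The map \<open>H\<^sup>p(X; R) \<rightarrow> H\<^sup>p(Y; R)\<close> induced by a continuous map \<open>h : Y \<rightarrow> X\<close>.\<close>

definition cohomology_map ::
    "nat \<Rightarrow> 'a topology \<Rightarrow> ('a \<Rightarrow> 'b) \<Rightarrow> ('b chain \<Rightarrow> 'r::{ring,monoid_mult}) set \<Rightarrow>
     ('a chain \<Rightarrow> 'r) set" where
  "cohomology_map p Y h A =
     coboundary_set p Y <#>\<^bsub>cochain_group p Y\<^esub> cochain_pullback p Y h ` A"

lemma cochain_set_iff:
  "f \<in> cochain_set p X \<longleftrightarrow>
     f \<in> extensional (singular_chain_set p X) \<and>
     (\<forall>a b. singular_chain p X a \<longrightarrow> singular_chain p X b \<longrightarrow> f (a + b) = f a + f b)"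
  by (auto simp: cochain_set_def hom_def additive_group_def)

lemma comm_group_cochain_group:
  "comm_group (cochain_group p X :: ('a chain \<Rightarrow> 'r::{ring,monoid_mult}) monoid)"
proof (rule comm_groupI)
  let ?C = "cochain_group p X :: ('a chain \<Rightarrow> 'r) monoid"
  fix f g h :: "'a chain \<Rightarrow> 'r"
  assume f: "f \<in> carrier ?C"
  show "\<one>\<^bsub>?C\<^esub> \<otimes>\<^bsub>?C\<^esub> f = f"
    using f by (auto simp: cochain_group_def cochain_set_iff fun_eq_iff extensional_def)
  show "\<exists>g\<in>carrier ?C. g \<otimes>\<^bsub>?C\<^esub> f = \<one>\<^bsub>?C\<^esub>"
    by (rule bexI[where x = "\<lambda>c\<in>singular_chain_set p X. - f c"])
       (use f in \<open>auto simp: cochain_group_def cochain_set_iff singular_chain_add fun_eq_iff\<close>)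
  assume g: "g \<in> carrier ?C"
  show "f \<otimes>\<^bsub>?C\<^esub> g \<in> carrier ?C"
    using f g by (auto simp: cochain_group_def cochain_set_iff singular_chain_add ac_simps)
  show "f \<otimes>\<^bsub>?C\<^esub> g = g \<otimes>\<^bsub>?C\<^esub> f"
    by (simp add: cochain_group_def add.commute)
  show "(f \<otimes>\<^bsub>?C\<^esub> g) \<otimes>\<^bsub>?C\<^esub> h = f \<otimes>\<^bsub>?C\<^esub> (g \<otimes>\<^bsub>?C\<^esub> h)"
    by (auto simp: cochain_group_def fun_eq_iff add.assoc)
next
  show "\<one>\<^bsub>cochain_group p X\<^esub> \<in> carrier (cochain_group p X :: ('a chain \<Rightarrow> 'r) monoid)"
    by (auto simp: cochain_group_def cochain_set_iff singular_chain_add)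
qed

lemma coboundary_in_hom:
  "coboundary p X \<in> hom (cochain_group p X) (cochain_group (Suc p) X :: ('a chain \<Rightarrow> 'r::{ring,monoid_mult}) monoid)"
  by (auto simp: hom_def cochain_group_def coboundary_def cochain_set_iff chain_boundary_add singular_chain_add fun_eq_iff
       singular_chain_boundary_alt)

lemma coboundary_coboundary:
  assumes "f \<in> cochain_set p X"
  shows "coboundary (Suc p) X (coboundary p X f) = \<one>\<^bsub>cochain_group (Suc (Suc p)) X\<^esub>"
proof -
  have "f (0 + 0) = f 0 + f 0"
    using assms unfolding cochain_set_iff by (metis singular_chain_0)
  then show ?thesis
    by (auto simp: coboundary_def cochain_group_def fun_eq_iff chain_boundary_boundary_alt
        singular_chain_boundary_alt)
qed

lemma subgroup_cocycle_set:
  "subgroup (cocycle_set p X) (cochain_group p X :: ('a chain \<Rightarrow> 'r::{ring,monoid_mult}) monoid)"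
proof -
  let ?C = "\<lambda>p. cochain_group p X :: ('a chain \<Rightarrow> 'r) monoid"
  interpret C: comm_group "?C p" by (rule comm_group_cochain_group)
  interpret D: comm_group "?C (Suc p)" by (rule comm_group_cochain_group)
  interpret h: group_hom "?C p" "?C (Suc p)" "coboundary p X"
    by unfold_locales (rule coboundary_in_hom)
  have "cocycle_set p X = kernel (?C p) (?C (Suc p)) (coboundary p X)"
    by (auto simp: cocycle_set_def kernel_def cochain_group_def)
  then show ?thesis using h.subgroup_kernel by simp
qed

lemma subgroup_coboundary_set: "subgroup (coboundary_set p X) (cochain_group p X)"
proof (cases p)
  case 0
  interpret C: comm_group "cochain_group p X" by (rule comm_group_cochain_group)
  show ?thesis using C.triv_subgroup by (simp add: coboundary_set_def 0)
next
  case (Suc q)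
  interpret C: comm_group "cochain_group q X" by (rule comm_group_cochain_group)
  interpret D: comm_group "cochain_group (Suc q) X" by (rule comm_group_cochain_group)
  interpret h: group_hom "cochain_group q X" "cochain_group (Suc q) X" "coboundary q X"
    by unfold_locales (rule coboundary_in_hom)
  show ?thesis using h.img_is_subgroup Suc by (simp add: coboundary_set_def cochain_group_def)
qed

lemma coboundary_set_subset: "coboundary_set p X \<subseteq> cocycle_set p X"
proof (cases p)
  case 0
  then show ?thesis using subgroup.one_closed[OF subgroup_cocycle_set[of p X]] by (simp add: coboundary_set_def)
next
  case (Suc q)
  then show ?thesis
    using hom_in_carrier[OF coboundary_in_hom, of _ q X] coboundary_coboundary[of _ q X]
    by (auto simp: coboundary_set_def cocycle_set_def cochain_group_def)
qed

lemma comm_group_cohomology_group: "comm_group (cohomology_group p X)"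
proof -
  interpret C: comm_group "cochain_group p X" by (rule comm_group_cochain_group)
  let ?Z = "subgroup_generated (cochain_group p X) (cocycle_set p X)"
  interpret Z: comm_group ?Z by (rule C.abelian_subgroup_generated) (rule comm_group_cochain_group)
  have "subgroup (coboundary_set p X) ?Z"
    using coboundary_set_subset subgroup_coboundary_set subgroup_cocycle_set
    by (meson C.subgroup_of_subgroup_generated)
  then show ?thesis
    unfolding cohomology_group_def by (rule Z.abelian_FactGroup)
qed

lemma class_of_image:
  assumes "comm_group C" "comm_group D" "\<phi> \<in> hom C D" "subgroup B C" "subgroup B' D"
    and "\<phi> ` B \<subseteq> B'" "f \<in> carrier C"
  shows "B' <#>\<^bsub>D\<^esub> \<phi> ` (B #>\<^bsub>C\<^esub> f) = B' #>\<^bsub>D\<^esub> \<phi> f"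
proof -
  interpret C: comm_group C by fact
  interpret D: comm_group D by fact
  interpret B: subgroup B C by fact
  interpret B': subgroup B' D by fact
  have \<phi>: "\<phi> (b \<otimes>\<^bsub>C\<^esub> f) = \<phi> b \<otimes>\<^bsub>D\<^esub> \<phi> f" "\<phi> b \<in> B'" if "b \<in> B" for b
    using that assms(3,6,7) by (auto simp: hom_mult)
  have \<phi>f: "\<phi> f \<in> carrier D"
    using assms(3,7) by (rule hom_in_carrier)
  show ?thesis
  proof (intro subset_antisym subsetI)
    fix y
    assume "y \<in> B' <#>\<^bsub>D\<^esub> \<phi> ` (B #>\<^bsub>C\<^esub> f)"
    then obtain b' b where "b' \<in> B'" "b \<in> B" "y = b' \<otimes>\<^bsub>D\<^esub> \<phi> (b \<otimes>\<^bsub>C\<^esub> f)"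
      unfolding set_mult_def r_coset_def by blast
    then have "b' \<otimes>\<^bsub>D\<^esub> \<phi> b \<in> B'" "y = (b' \<otimes>\<^bsub>D\<^esub> \<phi> b) \<otimes>\<^bsub>D\<^esub> \<phi> f"
      using \<phi> \<phi>f by (simp_all add: D.m_assoc)
    then show "y \<in> B' #>\<^bsub>D\<^esub> \<phi> f"
      unfolding r_coset_def by blast
  next
    fix y
    assume "y \<in> B' #>\<^bsub>D\<^esub> \<phi> f"
    then obtain b' where "b' \<in> B'" "y = b' \<otimes>\<^bsub>D\<^esub> \<phi> f"
      unfolding r_coset_def by blast
    moreover have "f \<in> B #>\<^bsub>C\<^esub> f"
      using assms(4,7) by (rule C.rcos_self[rotated])
    ultimately show "y \<in> B' <#>\<^bsub>D\<^esub> \<phi> ` (B #>\<^bsub>C\<^esub> f)"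
      unfolding set_mult_def by blast
  qed
qed

lemma cochain_pullback_in_hom:
  assumes "continuous_map Y X h"
  shows "cochain_pullback p Y h \<in> hom (cochain_group p X) (cochain_group p Y :: ('a chain \<Rightarrow> 'r::{ring,monoid_mult}) monoid)"
  using assms
  by (auto simp: hom_def cochain_group_def cochain_pullback_def cochain_set_iff chain_map_add singular_chain_add fun_eq_iff
       singular_chain_chain_map)

lemma cochain_pullback_coboundary:
  assumes "continuous_map Y X h" "f \<in> cochain_set p X"
  shows "cochain_pullback (Suc p) Y h (coboundary p X f) = coboundary p Y (cochain_pullback p Y h f)"
  using assms
  by (auto simp: cochain_pullback_def coboundary_def fun_eq_iff singular_chain_chain_map
      singular_chain_boundary_alt chain_boundary_chain_map)

lemma cochain_pullback_coboundary_set: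
  assumes "continuous_map Y X h"
  shows "cochain_pullback p Y h ` coboundary_set p X \<subseteq> coboundary_set p Y"
proof (cases p)
  case 0
  then show ?thesis using assms 
    by (auto simp: coboundary_set_def cochain_group_def cochain_pullback_def fun_eq_iff singular_chain_chain_map)
next
  case (Suc q)
  then show ?thesis using cochain_pullback_coboundary[OF assms, of _ q] hom_in_carrier[OF cochain_pullback_in_hom[OF assms, of q]]
    by (auto simp: coboundary_set_def cochain_group_def)
qed

lemma cohomology_map_class:
  assumes "continuous_map Y X h" "f \<in> cocycle_set p X"
  shows "cohomology_map p Y h (coboundary_set p X #>\<^bsub>cochain_group p X\<^esub> f)
       = coboundary_set p Y #>\<^bsub>cochain_group p Y\<^esub> cochain_pullback p Y h f"
  unfolding cohomology_map_def using assms(2)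
  by (intro class_of_image comm_group_cochain_group cochain_pullback_in_hom assms(1) subgroup_coboundary_set cochain_pullback_coboundary_set)
     (auto simp: cocycle_set_def cochain_group_def)

text \<open>Isomorphism of graded (left) \<open>R\<close>-modules in cohomology.\<close>

definition cohomology_isomorphism ::
    "'r::{ring,monoid_mult} itself \<Rightarrow> 'b topology \<Rightarrow> 'a topology \<Rightarrow> ('a \<Rightarrow> 'b) \<Rightarrow> bool" where
  "cohomology_isomorphism _ X Y h \<longleftrightarrow>
     (\<forall>p. cohomology_map p Y h \<in>
            iso (cohomology_group p X :: ('b chain \<Rightarrow> 'r) set monoid) (cohomology_group p Y) \<and>
          (\<forall>(r::'r). \<forall>A\<in>carrier (cohomology_group p X).
             cohomology_map p Y h (cohomology_scale p X r A)
               = cohomology_scale p Y r (cohomology_map p Y h A)))"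

end

theory Submission
  imports Defs
begin

text \<open>
  The inclusion is a homotopy equivalence: \<open>M // G\<close> deformation retracts onto the hyper-reduction, and singular
  cohomology with any coefficients is homotopy invariant.

  Write \<open>X\<close> for \<open>M // G\<close> and \<open>Z \<subseteq> X\<close> for the hyper-reduction, the zero locus of the function \<open>\<bar>s\<bar>\<close> on \<open>X\<close>. Let \<open>Xh\<close> be the
  generator of the circle action with its component along the \<open>G\<close>-orbits removed. In the direction \<open>I Xh\<close>, which is
  minus the gradient of the reduced moment map \<open>\<mu>\<^sub>S\<close>, the moment map \<open>\<mu>\<^sub>G\<close> is stationary, \<open>\<mu>\<^sub>S\<close> has derivative
  \<open>-\<bar>Xh\<bar>\<^sup>2\<close>, and, as \<open>s\<close> is holomorphic and homogeneous of degree \<open>d > 0\<close>, \<open>ds (I Xh) = \<i> ds Xh = \<i> (\<i> d s) = -d s\<close>. So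
  a short step in this direction shrinks \<open>s\<close> and lowers \<open>\<mu>\<^sub>S\<close> (\<open>descent_direction\<close>). In particular
  \<open>\<mu>\<^sub>S\<close> has no critical point on \<open>X\<close> off \<open>Z\<close>.

  Such steps need not reach \<open>Z\<close>. But regularity and transversality make \<open>s\<close> a submersion on the zero set of \<open>\<mu>\<^sub>G\<close> at
  the points over \<open>Z\<close> (\<open>joint_surj\<close>), so that an implicit function argument pushes a neighbourhood of each point of
  \<open>Z\<close> into \<open>Z\<close>, with \<open>Z\<close> at rest (\<open>push_in\<close>).

  The retraction is built from such steps instead of a gradient flow, whose existence and limits would have to be
  controlled. Each step is a homotopy of a small slice of the action that rests near the rim and so extends to \<open>X\<close> by
  the identity; \<open>slice_theorem\<close> and \<open>slice_deformation\<close> provide this. Call a step lowering if it decreases \<open>\<bar>s\<bar>\<close> strictly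
  on some open set and never increases \<open>\<bar>s\<bar>\<close> or \<open>\<mu>\<^sub>S\<close> (\<open>push_down\<close> gives one around every point off \<open>Z\<close>).
  Since \<open>\<mu>\<^sub>S\<close> is proper and bounded below on \<open>X\<close>, its sublevel sets are compact. Composing finitely many lowering steps
  shrinks \<open>\<bar>s\<bar>\<close> strictly on a compact part of a sublevel set, without leaving the sublevel set; iterating brings the
  whole sublevel set near \<open>Z\<close>, and finitely many steps of the second kind carry it into \<open>Z\<close>. Performing this for the
  sublevel sets of \<open>0, 1, 2, \<dots>\<close> one after the other, each time with \<open>Z\<close> at rest, gives a homotopy that is locally
  eventually constant, hence a deformation retraction of \<open>X\<close> onto \<open>Z\<close> (\<open>deformation_retract\<close>).

  On the algebraic side, a natural chain homotopy between the two ends of the prism over a simplex exists by acyclic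
  models. Applied to cochains it gives \<open>cohomology_isomorphism_deformation_retract\<close>.
\<close>

section \<open>Homotopy invariance of singular cohomology\<close>

abbreviation simplex_space :: "nat \<Rightarrow> (nat \<Rightarrow> real) topology" where
  "simplex_space q \<equiv> subtopology (powertop_real UNIV) (standard_simplex q)"

abbreviation unit_interval :: "real topology" where
  "unit_interval \<equiv> top_of_set {0..1}"

definition identity_simplex :: "nat \<Rightarrow> (nat \<Rightarrow> real) chain" where
  "identity_simplex q = frag_of (restrict id (standard_simplex q))"

lemma singular_chain_identity_simplex: "singular_chain q (simplex_space q) (identity_simplex q)"
  by (simp add: identity_simplex_def singular_chain_of singular_simplex_def)

lemma chain_map_identity_simplex:
  "singular_simplex q X \<sigma> \<Longrightarrow> chain_map q \<sigma> (identity_simplex q) = frag_of \<sigma>"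
  unfolding identity_simplex_def by (rule singular_simplex_chain_map_id)

text \<open>
  Chain homotopies are built with acyclic models. A chain \<open>e\<close> on \<open>[0, 1] \<times> \<Delta>\<^sup>q\<close> serves as the prism over the
  standard simplex and is pushed forward along each simplex \<open>\<sigma>\<close> of a space. This is natural by
  construction, so a boundary formula for it has to be verified on the identity simplex only.
\<close>

definition prism_operator ::
    "nat \<Rightarrow> (real \<times> (nat \<Rightarrow> real)) chain \<Rightarrow> 'a chain \<Rightarrow> (real \<times> 'a) chain" where
  "prism_operator q e = frag_extend (\<lambda>\<sigma>. chain_map (Suc q) (\<lambda>(t, x). (t, \<sigma> x)) e)"

text \<open>
  The recursion for the prisms: the boundary of \<open>e\<close> is top minus bottom minus the prism over the
  boundary of \<open>\<Delta>\<^sup>q\<close>, which is built from the chain \<open>e'\<close> of one dimension less. For \<open>q = 0\<close> the simplex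
  has zero boundary and the last term vanishes.
\<close>

definition prism_chain ::
    "nat \<Rightarrow> (real \<times> (nat \<Rightarrow> real)) chain \<Rightarrow> (real \<times> (nat \<Rightarrow> real)) chain \<Rightarrow> bool" where
  "prism_chain q e' e \<longleftrightarrow>
     singular_chain (Suc q) (prod_topology unit_interval (simplex_space q)) e \<and>
     chain_boundary (Suc q) e =
       chain_map q (Pair 1) (identity_simplex q) - chain_map q (Pair 0) (identity_simplex q)
       - prism_operator (q - 1) e' (chain_boundary q (identity_simplex q))"

lemma prism_operator_0 [simp]: "prism_operator q e 0 = 0"
  by (simp add: prism_operator_def)

lemma prism_operator_add: "prism_operator q e (a + b) = prism_operator q e a + prism_operator q e b"
  by (simp add: prism_operator_def frag_extend_add)

lemma prism_operator_diff: "prism_operator q e (a - b) = prism_operator q e a - prism_operator q e b"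
  by (simp add: prism_operator_def frag_extend_diff)

lemma prism_operator_of [simp]:
  "prism_operator q e (frag_of \<sigma>) = chain_map (Suc q) (\<lambda>(t, x). (t, \<sigma> x)) e"
  by (simp add: prism_operator_def)

lemma singular_chain_prism_operator:
  assumes e: "singular_chain (Suc q) (prod_topology unit_interval (simplex_space q)) e"
    and c: "singular_chain q X c"
  shows "singular_chain (Suc q) (prod_topology unit_interval X) (prism_operator q e c)"
  using c unfolding singular_chain_def[of q]
proof (induction c rule: frag_induction)
  case (one \<sigma>)
  then have "continuous_map (simplex_space q) X \<sigma>" by (simp add: singular_simplex_def)
  then have "continuous_map (prod_topology unit_interval (simplex_space q)) (prod_topology unit_interval X)
      (\<lambda>(t, x). (t, \<sigma> x))"
    by (simp add: continuous_map_prod_top)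
  then show ?case using e singular_chain_chain_map by fastforce
next
  case (diff a b)
  then show ?case by (simp add: prism_operator_diff singular_chain_diff)
qed auto

lemma prism_operator_natural:
  assumes e: "singular_chain (Suc q) (prod_topology unit_interval (simplex_space q)) e"
  shows "chain_map (Suc q) (\<lambda>(t, x). (t, g x)) (prism_operator q e c) = prism_operator q e (chain_map q g c)"
  using subset_UNIV
proof (induction c rule: frag_induction)
  case (one \<sigma>)
  have "chain_map (Suc q) (\<lambda>(t, x). (t, g x)) (chain_map (Suc q) (\<lambda>(t, x). (t, \<sigma> x)) e)
      = chain_map (Suc q) (\<lambda>(t, x). (t, g (\<sigma> x))) e"
    using chain_map_compose[of "Suc q" "\<lambda>(t, x). (t, g x)" "\<lambda>(t, x). (t, \<sigma> x)", THEN fun_cong, of e]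
    by (simp add: o_def case_prod_unfold)
  also have "\<dots> = chain_map (Suc q) (\<lambda>(t, x). (t, simplex_map q g \<sigma> x)) e"
    by (rule chain_map_eq[OF e]) (auto simp: simplex_map_def)
  finally show ?case by simp
next
  case (diff a b)
  then show ?case by (simp add: prism_operator_diff chain_map_diff)
qed auto

text \<open>
  On a single simplex \<open>\<sigma>\<close> this is the image of the recursion for \<open>e\<close> under \<open>id \<times> \<sigma>\<close>, because all three
  terms on the right-hand side are natural.
\<close>

lemma chain_boundary_prism_operator:
  assumes e: "prism_chain q e' e"
    and e': "q > 0 \<Longrightarrow> singular_chain q (prod_topology unit_interval (simplex_space (q - 1))) e'"
    and c: "singular_chain q X c"
  shows "chain_boundary (Suc q) (prism_operator q e c) =
    chain_map q (Pair 1) c - chain_map q (Pair 0) c - prism_operator (q - 1) e' (chain_boundary q c)"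
  using c unfolding singular_chain_def[of q]
proof (induction c rule: frag_induction)
  case (one \<sigma>)
  then have \<sigma>: "singular_simplex q X \<sigma>" by simp
  let ?s = "\<lambda>(t::real, x). (t, \<sigma> x)"
  have e_chain: "singular_chain (Suc q) (prod_topology unit_interval (simplex_space q)) e"
    and e_bd: "chain_boundary (Suc q) e =
       chain_map q (Pair 1) (identity_simplex q) - chain_map q (Pair 0) (identity_simplex q)
       - prism_operator (q - 1) e' (chain_boundary q (identity_simplex q))"
    using e by (auto simp: prism_chain_def)
  have pair: "chain_map q ?s (chain_map q (Pair t) (identity_simplex q)) = chain_map q (Pair t) (frag_of \<sigma>)" for t
  proof -
    have "?s \<circ> Pair t = Pair t \<circ> \<sigma>" by (simp add: fun_eq_iff)
    then have "chain_map q ?s (chain_map q (Pair t) (identity_simplex q))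
        = chain_map q (Pair t) (chain_map q \<sigma> (identity_simplex q))"
      by (metis chain_map_compose comp_apply)
    also have "chain_map q \<sigma> (identity_simplex q) = frag_of \<sigma>"
      using \<sigma> by (rule chain_map_identity_simplex)
    finally show ?thesis .
  qed
  have lower: "chain_map q ?s (prism_operator (q - 1) e' (chain_boundary q (identity_simplex q)))
      = prism_operator (q - 1) e' (chain_boundary q (frag_of \<sigma>))"
  proof (cases "q = 0")
    case True
    then show ?thesis by (simp add: chain_boundary_def)
  next
    case False
    have "chain_map (Suc (q - 1)) ?s (prism_operator (q - 1) e' (chain_boundary q (identity_simplex q)))
        = prism_operator (q - 1) e' (chain_map (q - 1) \<sigma> (chain_boundary q (identity_simplex q)))"
      using e' False by (intro prism_operator_natural) simp
    also have "chain_map (q - 1) \<sigma> (chain_boundary q (identity_simplex q)) = chain_boundary q (frag_of \<sigma>)"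
      using chain_boundary_chain_map[OF singular_chain_identity_simplex, of q \<sigma>] chain_map_identity_simplex[OF \<sigma>] by simp
    finally show ?thesis using False by simp
  qed
  have "chain_boundary (Suc q) (prism_operator q e (frag_of \<sigma>)) = chain_map q ?s (chain_boundary (Suc q) e)"
    using chain_boundary_chain_map[OF e_chain, of ?s] by simp
  then show ?case
    unfolding e_bd chain_map_diff pair lower .
next
  case (diff a b)
  then show ?case by (simp add: prism_operator_diff chain_boundary_diff chain_map_diff)
qed auto

lemma contractible_simplex_space: "contractible_space (simplex_space q)"
proof -
  let ?v = "\<lambda>i::nat. if i = 0 then 1 else 0 :: real"
  have v: "?v \<in> standard_simplex q"
    by (auto simp: standard_simplex_def)
  let ?h = "\<lambda>(t::real, x::nat \<Rightarrow> real) i. (1 - t) * x i + t * ?v i"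
  have x_cont: "continuous_map (prod_topology unit_interval (simplex_space q)) euclideanreal (\<lambda>p. snd p i)" for i
    using continuous_map_compose[OF continuous_map_snd
        continuous_map_from_subtopology[OF continuous_map_product_projection[of i UNIV "\<lambda>_. euclideanreal"]]]
    by (simp add: o_def)
  have t_cont: "continuous_map (prod_topology unit_interval (simplex_space q)) euclideanreal fst"
    using continuous_map_fst continuous_map_into_fulltopology by blast
  have "continuous_map (prod_topology unit_interval (simplex_space q)) (powertop_real UNIV) ?h"
    unfolding continuous_map_componentwise_UNIV case_prod_unfold
    by (intro allI continuous_intros x_cont t_cont)
  moreover have "?h p \<in> standard_simplex q" if "p \<in> {0..1} \<times> standard_simplex q" for p
    using that convex_standard_simplex[OF _ v] by (auto simp: case_prod_unfold)
  ultimately have "continuous_map (prod_topology unit_interval (simplex_space q)) (simplex_space q) ?h"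
    by (auto simp: continuous_map_in_subtopology)
  then have "homotopic_with (\<lambda>_. True) (simplex_space q) (simplex_space q) id (\<lambda>_. ?v)"
    unfolding homotopic_with_def by (intro exI[of _ ?h]) auto
  then show ?thesis
    unfolding contractible_space_def by blast
qed

lemma contractible_cycle_is_boundary:
  assumes X: "contractible_space X" and q: "q > 0"
    and c: "singular_chain q X c" "chain_boundary q c = 0"
  obtains d where "singular_chain (Suc q) X d" "chain_boundary (Suc q) d = c"
proof -
  have "trivial_group (homology_group (int q) X)"
    using trivial_reduced_homology_group_contractible_space[OF X, of "int q"] q
    by (simp add: un_reduced_homology_group)
  moreover have "homologous_rel_set q X {} c \<in> carrier (homology_group (int q) X)"
    using c by (auto simp: carrier_relative_homology_group singular_cycle)
  ultimately have "homologous_rel_set q X {} c = singular_relboundary_set q X {}"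
    by (simp add: trivial_group_def)
  then have "singular_relboundary q X {} c"
    using homologous_rel_refl by blast
  then show thesis using that by (auto simp: singular_boundary)
qed

text \<open>
  The prescribed boundary of the next prism is a cycle in \<open>[0, 1] \<times> \<Delta>\<^sup>q\<^sup>+\<^sup>1\<close>, a contractible space without
  homology in positive degrees, hence it bounds. In degree \<open>0\<close>, where homology does not vanish, the
  two end points are homologous since the end inclusions of the point \<open>\<Delta>\<^sup>0\<close> are homotopic.
\<close>

lemma prism_chain_exists:
  "\<exists>e. \<forall>q. prism_chain q (e (q - 1)) (e q)"
proof -
  let ?T = "\<lambda>q. prod_topology unit_interval (simplex_space q)"
  have "contractible_space unit_interval"
    by (subst contractible_space_subtopology_euclideanreal) (rule is_interval_cc)
  then have contr: "contractible_space (?T q)" for q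
    unfolding contractible_space_prod_topology using contractible_simplex_space by blast
  note id = singular_chain_identity_simplex
  have pair_cont: "continuous_map (simplex_space q) (?T q) (Pair t)" if "t \<in> {0..1}" for q and t :: real
    using that by (simp add: continuous_map_pairwise o_def)
  have pair_chain: "singular_chain q (?T q) (chain_map q (Pair t) (identity_simplex q))"
    if "t \<in> {0..1}" for q and t :: real
    using id pair_cont[OF that] by (rule singular_chain_chain_map)
  have base: "\<exists>e. prism_chain 0 e e"
  proof -
    have "homotopic_with (\<lambda>h. True) (simplex_space 0) (?T 0) (Pair 0) (Pair 1)"
      unfolding homotopic_with_def
    proof (intro exI conjI)
      show "continuous_map (prod_topology unit_interval (simplex_space 0)) (?T 0) id"
        by simp
    qed auto
    moreover have "singular_relcycle 0 (simplex_space 0) {} (identity_simplex 0)"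
      using id[of 0] by (simp add: singular_cycle chain_boundary_def)
    ultimately have "homologous_rel 0 (?T 0) {} (chain_map 0 (Pair 0) (identity_simplex 0))
        (chain_map 0 (Pair 1) (identity_simplex 0))"
      using homotopic_imp_homologous_rel_chain_maps[of "{}" "{}" "simplex_space 0" "?T 0" "Pair 0" "Pair 1"]
      by simp
    then have "homologous_rel 0 (?T 0) {} (chain_map 0 (Pair 1) (identity_simplex 0))
        (chain_map 0 (Pair 0) (identity_simplex 0))"
      by (rule homologous_rel_sym[THEN iffD1])
    then have "singular_relboundary 0 (?T 0) {} (chain_map 0 (Pair 1) (identity_simplex 0)
        - chain_map 0 (Pair 0) (identity_simplex 0))"
      by (simp add: homologous_rel_def)
    then show ?thesis
      by (auto simp: singular_boundary prism_chain_def chain_boundary_def)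
  qed
  have step: "\<exists>e''. prism_chain (Suc q) e e''" if e: "prism_chain q e' e"
      and e': "q > 0 \<Longrightarrow> singular_chain q (?T (q - 1)) e'" for q e e'
  proof -
    let ?i = "identity_simplex (Suc q)"
    let ?b = "chain_boundary (Suc q) ?i"
    let ?z = "chain_map (Suc q) (Pair 1) ?i - chain_map (Suc q) (Pair 0) ?i - prism_operator q e ?b"
    have e_chain: "singular_chain (Suc q) (?T q) e" using e by (simp add: prism_chain_def)
    have b: "singular_chain q (simplex_space (Suc q)) ?b"
      using singular_chain_boundary[OF id[of "Suc q"]] by simp
    have bb: "chain_boundary q ?b = 0"
      using chain_boundary_boundary_alt[OF id[of "Suc q"]] by simp
    have "singular_chain (Suc q) (?T (Suc q)) ?z"
      using pair_chain singular_chain_prism_operator[OF e_chain b] by (intro singular_chain_diff) auto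
    moreover have "chain_boundary (Suc q) ?z = 0"
    proof -
      have "chain_boundary (Suc q) (chain_map (Suc q) (Pair t) ?i) = chain_map q (Pair t) ?b" for t :: real
        using chain_boundary_chain_map[OF id[of "Suc q"], of "Pair t"] by simp
      moreover have "chain_boundary (Suc q) (prism_operator q e ?b) = chain_map q (Pair 1) ?b - chain_map q (Pair 0) ?b"
        using chain_boundary_prism_operator[OF e e' b] bb by simp
      ultimately show ?thesis by (simp add: chain_boundary_diff)
    qed
    ultimately obtain d where "singular_chain (Suc (Suc q)) (?T (Suc q)) d" "chain_boundary (Suc (Suc q)) d = ?z"
      using contractible_cycle_is_boundary[OF contr] by blast
    then show ?thesis by (auto simp: prism_chain_def)
  qed
  have "\<exists>f. \<forall>n. (prism_chain n (fst (f n)) (snd (f n)) \<and> (n > 0 \<longrightarrow> singular_chain n (?T (n - 1)) (fst (f n))))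
          \<and> fst (f (Suc n)) = snd (f n)"
  proof (rule dependent_nat_choice)
    show "\<exists>p. prism_chain 0 (fst p) (snd p) \<and> (0 < (0::nat) \<longrightarrow> singular_chain 0 (?T (0 - 1)) (fst p))"
      using base by auto
  next
    fix p n
    assume p: "prism_chain n (fst p) (snd p) \<and> (n > 0 \<longrightarrow> singular_chain n (?T (n - 1)) (fst p))"
    then obtain d where "prism_chain (Suc n) (snd p) d" using step[of n "fst p" "snd p"] by blast
    moreover have "singular_chain (Suc n) (?T n) (snd p)" using p by (simp add: prism_chain_def)
    ultimately show "\<exists>p'. (prism_chain (Suc n) (fst p') (snd p') \<and>
        (Suc n > 0 \<longrightarrow> singular_chain (Suc n) (?T (Suc n - 1)) (fst p'))) \<and> fst p' = snd p"
      by (intro exI[of _ "(snd p, d)"]) auto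
  qed
  then obtain f where f: "\<And>n. prism_chain n (fst (f n)) (snd (f n))" "\<And>n. fst (f (Suc n)) = snd (f n)" by blast
  have "prism_chain q (snd (f (q - 1))) (snd (f q))" for q
  proof (cases q)
    case 0
    then show ?thesis using f(1)[of 0] by (simp add: prism_chain_def chain_boundary_def)
  next
    case (Suc n)
    then show ?thesis using f(1)[of "Suc n"] f(2)[of n] by simp
  qed
  then show ?thesis by (intro exI[of _ "\<lambda>q. snd (f q)"]) blast
qed

lemma homotopic_imp_chain_homotopic:
  assumes "homotopic_with (\<lambda>_. True) X Y f g"
  obtains D :: "nat \<Rightarrow> 'a chain \<Rightarrow> 'b chain"
  where "\<And>q. D q 0 = 0" "\<And>q a b. D q (a + b) = D q a + D q b"
    "\<And>q c. singular_chain q X c \<Longrightarrow> singular_chain (Suc q) Y (D q c)"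
    "\<And>q c. singular_chain q X c \<Longrightarrow> chain_boundary (Suc q) (D q c) =
         chain_map q g c - chain_map q f c - D (q - 1) (chain_boundary q c)"
proof -
  obtain h where h: "continuous_map (prod_topology unit_interval X) Y h"
    and h0: "\<And>x. h (0, x) = f x" and h1: "\<And>x. h (1, x) = g x"
    using assms unfolding homotopic_with_def by blast
  obtain e where e: "\<And>q. prism_chain q (e (q - 1)) (e q)" using prism_chain_exists by blast
  then have e_chain: "singular_chain (Suc q) (prod_topology unit_interval (simplex_space q)) (e q)" for q
    by (simp add: prism_chain_def)
  define D where "D q c = chain_map (Suc q) h (prism_operator q (e q) c)" for q c
  show thesis
  proof
    show "D q 0 = 0" "D q (a + b) = D q a + D q b" for q a b
      by (simp_all add: D_def prism_operator_add chain_map_add)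
    fix q and c :: "'a chain"
    assume c: "singular_chain q X c"
    note P = singular_chain_prism_operator[OF e_chain c]
    show "singular_chain (Suc q) Y (D q c)"
      unfolding D_def using P h by (rule singular_chain_chain_map)
    have ends: "chain_map q h (chain_map q (Pair t) c) = chain_map q (\<lambda>x. h (t, x)) c" for t
      using chain_map_compose[of q h "Pair t", THEN fun_cong, of c] by (simp add: o_def)
    have e': "q > 0 \<Longrightarrow> singular_chain q (prod_topology unit_interval (simplex_space (q - 1))) (e (q - 1))"
      using e_chain[of "q - 1"] by simp
    have lower: "chain_map q h (prism_operator (q - 1) (e (q - 1)) (chain_boundary q c)) = D (q - 1) (chain_boundary q c)"
      by (cases q) (simp_all add: D_def chain_boundary_def)
    have "chain_boundary (Suc q) (D q c) = chain_map q h (chain_boundary (Suc q) (prism_operator q (e q) c))"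
      unfolding D_def using chain_boundary_chain_map[OF P, of h] by simp
    also have "chain_boundary (Suc q) (prism_operator q (e q) c) =
        chain_map q (Pair 1) c - chain_map q (Pair 0) c - prism_operator (q - 1) (e (q - 1)) (chain_boundary q c)"
      using e e' c by (rule chain_boundary_prism_operator)
    also have "chain_map q h \<dots> = chain_map q g c - chain_map q f c - D (q - 1) (chain_boundary q c)"
      unfolding chain_map_diff ends lower h0 h1 ..
    finally show "chain_boundary (Suc q) (D q c) = chain_map q g c - chain_map q f c - D (q - 1) (chain_boundary q c)" .
  qed
qed

text \<open>
  If \<open>D\<close> is a chain homotopy from the identity to \<open>h\<close>, then a cocycle \<open>f\<close> vanishes on the boundary term
  of \<open>D\<close>, and what remains of \<open>h\<^sup>* f - f\<close> is the coboundary of \<open>f \<circ> D\<close>. The argument is additive, so the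
  coefficients may be any ring.
\<close>

lemma homotopic_pullback_cohomologous:
  fixes f :: "'a chain \<Rightarrow> 'r::{ring,monoid_mult}"
  assumes hom: "homotopic_with (\<lambda>_. True) X X id h" and f: "f \<in> cocycle_set p X"
  shows "\<exists>b \<in> coboundary_set p X. cochain_pullback p X h f = b \<otimes>\<^bsub>cochain_group p X\<^esub> f"
proof -
  obtain D :: "nat \<Rightarrow> 'a chain \<Rightarrow> 'a chain"
  where D: "\<And>q. D q 0 = 0" "\<And>q a b. D q (a + b) = D q a + D q b"
    "\<And>q c. singular_chain q X c \<Longrightarrow> singular_chain (Suc q) X (D q c)"
    "\<And>q c. singular_chain q X c \<Longrightarrow> chain_boundary (Suc q) (D q c) =
         chain_map q h c - chain_map q id c - D (q - 1) (chain_boundary q c)"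
    using homotopic_imp_chain_homotopic[OF hom] by blast
  have fadd: "f (a + b) = f a + f b" if "singular_chain p X a" "singular_chain p X b" for a b
    using f that by (auto simp: cocycle_set_def cochain_set_iff)
  have fz: "f (chain_boundary (Suc p) c) = 0" if "singular_chain (Suc p) X c" for c
  proof -
    have "coboundary p X f c = (\<one>\<^bsub>cochain_group (Suc p) X\<^esub> :: 'a chain \<Rightarrow> 'r) c"
      using f by (simp add: cocycle_set_def)
    then show ?thesis using that by (simp add: coboundary_def cochain_group_def)
  qed
  have h_cont: "continuous_map X X h" using homotopic_with_imp_continuous_maps[OF hom] by blast
  have key: "f (chain_map p h c) = f (D (p - 1) (chain_boundary p c)) + f c" (is "_ = ?b c + _")
    if c: "singular_chain p X c" for c
  proof -
    have lower: "singular_chain p X (D (p - 1) (chain_boundary p c))"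
    proof (cases p)
      case 0
      then show ?thesis by (simp add: chain_boundary_def D(1))
    next
      case (Suc q)
      then show ?thesis using D(3)[of q "chain_boundary p c"] singular_chain_boundary[OF c] by simp
    qed
    have "chain_map p h c = chain_boundary (Suc p) (D p c) + (D (p - 1) (chain_boundary p c) + c)"
      using D(4)[OF c] chain_map_ident[OF c] by (simp add: algebra_simps)
    then show ?thesis
      using fadd lower c fz[OF D(3)[OF c]] singular_chain_boundary[OF D(3)[OF c]]
      by (simp add: singular_chain_add)
  qed
  show ?thesis
  proof (cases p)
    case 0
    have "f 0 = 0" using fadd[of 0 0] by simp
    then have "cochain_pullback p X h f = \<one>\<^bsub>cochain_group p X\<^esub> \<otimes>\<^bsub>cochain_group p X\<^esub> f"
      using key by (simp add: cochain_pullback_def cochain_group_def fun_eq_iff 0 chain_boundary_def D(1))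
    then show ?thesis by (simp add: coboundary_set_def 0)
  next
    case (Suc q)
    let ?g = "\<lambda>c\<in>singular_chain_set q X. f (D q c)"
    have g: "?g \<in> cochain_set q X"
      using D(2,3) fadd by (auto simp: cochain_set_iff singular_chain_add Suc)
    have "cochain_pullback p X h f = coboundary q X ?g \<otimes>\<^bsub>cochain_group p X\<^esub> f"
      using key by (auto simp: cochain_pullback_def cochain_group_def coboundary_def fun_eq_iff Suc singular_chain_boundary_alt)
    then show ?thesis using g by (auto simp: coboundary_set_def Suc)
  qed
qed


abbreviation cohomology_class ::
    "nat \<Rightarrow> 'a topology \<Rightarrow> ('a chain \<Rightarrow> 'r::{ring,monoid_mult}) \<Rightarrow> ('a chain \<Rightarrow> 'r) set" where
  "cohomology_class p X f \<equiv> coboundary_set p X #>\<^bsub>cochain_group p X\<^esub> f"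

lemma cocycle_set_subset: "cocycle_set p X \<subseteq> carrier (cochain_group p X)"
  by (auto simp: cocycle_set_def cochain_group_def)

lemma r_coset_subgroup_generated: "H #>\<^bsub>subgroup_generated G S\<^esub> a = H #>\<^bsub>G\<^esub> a"
  by (simp add: r_coset_def)

lemma cohomology_group_mod:
  fixes X :: "'a topology" and p :: nat
  defines "Z \<equiv> subgroup_generated (cochain_group p X :: ('a chain \<Rightarrow> 'r::{ring,monoid_mult}) monoid) (cocycle_set p X)"
  shows "carrier Z = cocycle_set p X" and "coboundary_set p X \<lhd> Z"
proof -
  interpret C: comm_group "cochain_group p X :: ('a chain \<Rightarrow> 'r) monoid" by (rule comm_group_cochain_group)
  show "carrier Z = cocycle_set p X"
    unfolding Z_def by (rule subgroup.carrier_subgroup_generated_subgroup[OF subgroup_cocycle_set])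
  interpret Z: comm_group Z
    unfolding Z_def by (rule C.abelian_subgroup_generated) (rule comm_group_cochain_group)
  have "subgroup (coboundary_set p X) Z"
    unfolding Z_def
    using coboundary_set_subset subgroup_coboundary_set subgroup_cocycle_set
    by (meson C.subgroup_of_subgroup_generated)
  then show "coboundary_set p X \<lhd> Z" by (simp add: Z.normal_iff_subgroup)
qed

lemma carrier_cohomology_group:
  "carrier (cohomology_group p X) = cohomology_class p X ` cocycle_set p X"
  unfolding cohomology_group_def FactGroup_def RCOSETS_def
  by (auto simp: cohomology_group_mod(1) r_coset_subgroup_generated)

lemma mult_cohomology_group:
  assumes "f \<in> cocycle_set p X" "g \<in> cocycle_set p X"
  shows "cohomology_class p X f \<otimes>\<^bsub>cohomology_group p X\<^esub> cohomology_class p X g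
       = cohomology_class p X (f \<otimes>\<^bsub>cochain_group p X\<^esub> g)"
  using normal.rcos_sum[OF cohomology_group_mod(2), of f p X g] assms
  by (simp add: cohomology_group_def FactGroup_def cohomology_group_mod(1) r_coset_subgroup_generated)

lemma cohomology_class_eqI:
  assumes "g \<in> cocycle_set p X" "b \<in> coboundary_set p X" "f = b \<otimes>\<^bsub>cochain_group p X\<^esub> g"
  shows "cohomology_class p X f = cohomology_class p X g"
proof -
  interpret C: comm_group "cochain_group p X" by (rule comm_group_cochain_group)
  have "f \<in> cohomology_class p X g" using assms(2,3) by (auto simp: r_coset_def)
  then show ?thesis
    using C.repr_independence[OF _ _ subgroup_coboundary_set] assms(1) cocycle_set_subset by blast
qed

lemma cochain_pullback_cocycle:
  assumes "continuous_map Y X h" "f \<in> cocycle_set p X"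
  shows "cochain_pullback p Y h f \<in> cocycle_set p Y"
proof -
  have f: "f \<in> carrier (cochain_group p X)" using assms(2) cocycle_set_subset by blast
  have "cochain_pullback p Y h f \<in> cochain_set p Y"
    using hom_in_carrier[OF cochain_pullback_in_hom[OF assms(1), of p] f] by (simp add: cochain_group_def)
  moreover have "coboundary p Y (cochain_pullback p Y h f) = \<one>\<^bsub>cochain_group (Suc p) Y\<^esub>"
  proof -
    have "coboundary p Y (cochain_pullback p Y h f) = cochain_pullback (Suc p) Y h (coboundary p X f)"
      using cochain_pullback_coboundary[OF assms(1), of f p] assms(2) by (simp add: cocycle_set_def)
    also have "\<dots> = cochain_pullback (Suc p) Y h \<one>\<^bsub>cochain_group (Suc p) X\<^esub>"
      using assms(2) by (simp add: cocycle_set_def)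
    also have "\<dots> = \<one>\<^bsub>cochain_group (Suc p) Y\<^esub>"
      by (auto simp: cochain_pullback_def cochain_group_def fun_eq_iff singular_chain_chain_map[OF _ assms(1)])
    finally show ?thesis .
  qed
  ultimately show ?thesis by (simp add: cocycle_set_def)
qed

lemma cochain_scale:
  fixes X :: "'a topology" and r :: "'r::{ring,monoid_mult}"
  defines "m \<equiv> \<lambda>p f. \<lambda>c\<in>carrier (chain_group p X). r * f c"
  shows "m p \<in> hom (cochain_group p X) (cochain_group p X)"
    and "f \<in> cocycle_set p X \<Longrightarrow> m p f \<in> cocycle_set p X"
    and "m p ` coboundary_set p X \<subseteq> coboundary_set p X"
    and "f \<in> cocycle_set p X \<Longrightarrow> cohomology_scale p X r (cohomology_class p X f) = cohomology_class p X (m p f)"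
proof -
  have hom: "m p \<in> hom (cochain_group p X) (cochain_group p X)" for p
    by (auto simp: hom_def cochain_group_def cochain_set_iff m_def singular_chain_add fun_eq_iff distrib_left)
  then show "m p \<in> hom (cochain_group p X) (cochain_group p X)" .
  have \<delta>: "coboundary p X (m p f) = m (Suc p) (coboundary p X f)" for p and f :: "'a chain \<Rightarrow> 'r"
    by (auto simp: coboundary_def m_def fun_eq_iff singular_chain_boundary_alt)
  show "m p f \<in> cocycle_set p X" if "f \<in> cocycle_set p X" for f
  proof -
    have "m p f \<in> cochain_set p X"
      using hom_in_carrier[OF hom, of f p] that cocycle_set_subset[of p X] by (auto simp: cochain_group_def)
    then show ?thesis
      using that by (auto simp: cocycle_set_def \<delta>) (auto simp: m_def cochain_group_def fun_eq_iff)
  qed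
  show B: "m p ` coboundary_set p X \<subseteq> coboundary_set p X"
  proof (cases p)
    case 0
    then show ?thesis by (auto simp: coboundary_set_def m_def cochain_group_def fun_eq_iff)
  next
    case (Suc q)
    have "m q f \<in> cochain_set q X" if "f \<in> cochain_set q X" for f
      using hom_in_carrier[OF hom, of f q] that by (simp add: cochain_group_def)
    then show ?thesis by (auto simp: coboundary_set_def Suc \<delta>[symmetric])
  qed
  show "cohomology_scale p X r (cohomology_class p X f) = cohomology_class p X (m p f)"
    if f: "f \<in> cocycle_set p X"
  proof -
    have "cohomology_scale p X r (cohomology_class p X f)
        = coboundary_set p X <#>\<^bsub>cochain_group p X\<^esub> m p ` cohomology_class p X f"
      by (simp add: cohomology_scale_def m_def)
    also have "\<dots> = cohomology_class p X (m p f)"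
      using f cocycle_set_subset
      by (intro class_of_image comm_group_cochain_group hom subgroup_coboundary_set B) blast
    finally show ?thesis .
  qed
qed

text \<open>
  A retraction \<open>r\<close> homotopic to the identity induces the inverse of the restriction: \<open>i\<^sup>* r\<^sup>* = id\<close> holds
  for cochains already, and \<open>r\<^sup>* i\<^sup>*\<close> moves cocycles by coboundaries.
\<close>

theorem cohomology_isomorphism_deformation_retract:
  assumes i: "continuous_map Y X id" and r: "continuous_map X Y r" and ri: "\<And>y. y \<in> topspace Y \<Longrightarrow> r y = y"
    and hom: "homotopic_with (\<lambda>_. True) X X id r"
  shows "cohomology_isomorphism TYPE('r::{ring,monoid_mult}) X Y id"
  unfolding cohomology_isomorphism_def
proof (intro allI conjI ballI)
  fix p
  let ?H = "cohomology_map p Y id :: ('a chain \<Rightarrow> 'r) set \<Rightarrow> _"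
  have i_class: "?H (cohomology_class p X f) = cohomology_class p Y (cochain_pullback p Y id f)"
    if "f \<in> cocycle_set p X" for f :: "'a chain \<Rightarrow> 'r"
    using i that by (rule cohomology_map_class)
  have r_class: "cohomology_map p X r (cohomology_class p Y f) = cohomology_class p X (cochain_pullback p X r f)"
    if "f \<in> cocycle_set p Y" for f :: "'a chain \<Rightarrow> 'r"
    using r that by (rule cohomology_map_class)
  have i_cocycle: "cochain_pullback p Y id f \<in> cocycle_set p Y" if "f \<in> cocycle_set p X" for f :: "'a chain \<Rightarrow> 'r"
    using i that by (rule cochain_pullback_cocycle)
  have r_cocycle: "cochain_pullback p X r f \<in> cocycle_set p X" if "f \<in> cocycle_set p Y" for f :: "'a chain \<Rightarrow> 'r"
    using r that by (rule cochain_pullback_cocycle)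
  have chain_Y: "singular_chain p X c" if "singular_chain p Y c" for c
    using singular_chain_chain_map[OF that i] chain_map_ident[OF that] by simp
  have "cohomology_map p X r (?H A) = A" if A: "A \<in> carrier (cohomology_group p X)" for A
  proof -
    obtain f where f: "f \<in> cocycle_set p X" "A = cohomology_class p X f"
      using A by (auto simp: carrier_cohomology_group)
    have "cochain_pullback p X r (cochain_pullback p Y id f) = cochain_pullback p X r f"
      by (auto simp: cochain_pullback_def fun_eq_iff singular_chain_chain_map[OF _ r]
          chain_map_ident[OF singular_chain_chain_map[OF _ r]])
    then have "cohomology_map p X r (?H A) = cohomology_class p X (cochain_pullback p X r f)"
      unfolding f(2) i_class[OF f(1)] r_class[OF i_cocycle[OF f(1)]] by simp
    also have "\<dots> = A"
      using homotopic_pullback_cohomologous[OF hom f(1)] cohomology_class_eqI[OF f(1)] unfolding f(2) by blast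
    finally show ?thesis .
  qed
  then have inj: "inj_on ?H (carrier (cohomology_group p X))" by (rule inj_on_inverseI)
  have surj: "?H ` carrier (cohomology_group p X) = carrier (cohomology_group p Y)"
  proof (intro subset_antisym subsetI)
    fix A assume "A \<in> ?H ` carrier (cohomology_group p X)"
    then show "A \<in> carrier (cohomology_group p Y)"
      using i_class i_cocycle by (auto simp: carrier_cohomology_group)
  next
    fix A :: "('a chain \<Rightarrow> 'r) set" assume "A \<in> carrier (cohomology_group p Y)"
    then obtain g where g: "g \<in> cocycle_set p Y" "A = cohomology_class p Y g"
      by (auto simp: carrier_cohomology_group)
    have "g \<in> extensional (singular_chain_set p Y)"
      using g(1) by (simp add: cocycle_set_def cochain_set_iff)
    then have "cochain_pullback p Y id (cochain_pullback p X r g) = g"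
      using chain_Y by (auto simp: cochain_pullback_def fun_eq_iff chain_map_ident extensional_def
          chain_map_id_gen[OF _ ri])
    then have "?H (cohomology_class p X (cochain_pullback p X r g)) = A"
      using i_class[OF r_cocycle[OF g(1)]] g(2) by simp
    then show "A \<in> ?H ` carrier (cohomology_group p X)"
      using r_cocycle[OF g(1)] by (force simp: carrier_cohomology_group)
  qed
  have "?H \<in> hom (cohomology_group p X) (cohomology_group p Y)"
  proof (rule homI)
    show "?H A \<in> carrier (cohomology_group p Y)" if "A \<in> carrier (cohomology_group p X)" for A
      using surj that by blast
    fix A B :: "('a chain \<Rightarrow> 'r) set"
    assume "A \<in> carrier (cohomology_group p X)" "B \<in> carrier (cohomology_group p X)"
    then obtain f g where f: "f \<in> cocycle_set p X" "A = cohomology_class p X f"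
      and g: "g \<in> cocycle_set p X" "B = cohomology_class p X g"
      by (auto simp: carrier_cohomology_group)
    have fg: "f \<otimes>\<^bsub>cochain_group p X\<^esub> g \<in> cocycle_set p X"
      using f(1) g(1) subgroup.m_closed[OF subgroup_cocycle_set] by blast
    have "cochain_pullback p Y id (f \<otimes>\<^bsub>cochain_group p X\<^esub> g) =
        cochain_pullback p Y id f \<otimes>\<^bsub>cochain_group p Y\<^esub> cochain_pullback p Y id g"
      using hom_mult[OF cochain_pullback_in_hom[OF i]] f(1) g(1) cocycle_set_subset by blast
    then show "?H (A \<otimes>\<^bsub>cohomology_group p X\<^esub> B) = ?H A \<otimes>\<^bsub>cohomology_group p Y\<^esub> ?H B"
      unfolding f(2) g(2)
      by (simp add: mult_cohomology_group f(1) g(1) i_class fg i_cocycle)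
  qed
  then show "?H \<in> iso (cohomology_group p X) (cohomology_group p Y)"
    using inj surj by (simp add: iso_def bij_betw_def)
  fix r :: 'r and A :: "('a chain \<Rightarrow> 'r) set"
  assume "A \<in> carrier (cohomology_group p X)"
  then obtain f where f: "f \<in> cocycle_set p X" "A = cohomology_class p X f"
    by (auto simp: carrier_cohomology_group)
  have "cochain_pullback p Y id (\<lambda>c\<in>carrier (chain_group p X). r * f c)
      = (\<lambda>c\<in>carrier (chain_group p Y). r * cochain_pullback p Y id f c)"
    by (auto simp: cochain_pullback_def fun_eq_iff chain_map_ident chain_Y)
  then show "?H (cohomology_scale p X r A) = cohomology_scale p Y r (?H A)"
    unfolding f(2)
    by (simp only: cochain_scale(4)[OF f(1)] i_class[OF f(1)] i_class[OF cochain_scale(2)[OF f(1)]]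
        cochain_scale(4)[OF i_cocycle[OF f(1)]])
qed

section \<open>Deformation retracts from local pushes\<close>

lemma compact_image_bounded_above:
  fixes g :: "'a \<Rightarrow> real"
  assumes "compact (g ` A)"
  obtains b where "\<And>x. x \<in> A \<Longrightarrow> g x \<le> b"
  using bounded_imp_bdd_above[OF compact_imp_bounded[OF assms]] by (auto simp: bdd_above_def)

text \<open>
  A homotopy of self-maps of \<open>X\<close> that starts at the identity and rests on \<open>Z\<close>. It need not end in \<open>Z\<close>;
  the retraction onto \<open>Z\<close> is composed of many such homotopies.
\<close>

definition deformation :: "'a topology \<Rightarrow> 'a set \<Rightarrow> (real \<Rightarrow> 'a \<Rightarrow> 'a) \<Rightarrow> bool" where
  "deformation X Z H \<longleftrightarrow>
     continuous_map (prod_topology (top_of_set {0..1}) X) X (\<lambda>(t, x). H t x) \<and>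
     (\<forall>x\<in>topspace X. H 0 x = x) \<and> (\<forall>t\<in>{0..1}. \<forall>z\<in>Z. H t z = z)"

lemma deformation_id: "deformation X Z (\<lambda>t x. x)"
  by (simp add: deformation_def case_prod_unfold continuous_map_snd)

text \<open>
  Both homotopies run simultaneously, so that no concatenation in the time parameter is involved
  and the end maps compose.
\<close>

lemma deformation_comp:
  assumes "deformation X Z H" "deformation X Z K"
  shows "deformation X Z (\<lambda>t x. K t (H t x))"
proof -
  let ?I = "prod_topology (top_of_set {0..1}) X"
  have "continuous_map ?I ?I (\<lambda>p. (fst p, case p of (t, x) \<Rightarrow> H t x))"
    using assms(1) by (auto simp: deformation_def continuous_map_pairwise o_def continuous_map_fst)
  then have "continuous_map ?I X ((\<lambda>(t, x). K t x) \<circ> (\<lambda>p. (fst p, case p of (t, x) \<Rightarrow> H t x)))"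
    using assms(2) by (auto simp: deformation_def intro: continuous_map_compose)
  then show ?thesis
    using assms by (simp add: deformation_def o_def case_prod_unfold)
qed

lemma deformation_continuous_map:
  assumes "deformation X Z H" "t \<in> {0..1}"
  shows "continuous_map X X (H t)"
proof -
  have "continuous_map X (prod_topology (top_of_set {0..1}) X) (Pair t)"
    using assms(2) by (simp add: continuous_map_pairwise o_def)
  then show ?thesis
    using assms(1) continuous_map_compose[of X _ "Pair t" X "\<lambda>(t, x). H t x"]
    by (simp add: deformation_def o_def)
qed

lemma deformation_end_in_topspace:
  assumes "deformation X Z H" "x \<in> topspace X"
  shows "H 1 x \<in> topspace X"
  using deformation_continuous_map[OF assms(1), of 1] assms(2) by (auto simp: continuous_map_def Pi_iff)

text \<open>
  A push that strictly lowers \<open>f\<close> on the open set \<open>U\<close>, never raises \<open>\<mu>\<close>, and moves nothing outside \<open>U\<close>.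
  The last property makes pushes compose: a point of \<open>V\<close> outside \<open>U\<close> reaches the second push unmoved.
\<close>

definition lowering ::
    "'a topology \<Rightarrow> 'a set \<Rightarrow> ('a \<Rightarrow> real) \<Rightarrow> ('a \<Rightarrow> real) \<Rightarrow> 'a set \<Rightarrow> (real \<Rightarrow> 'a \<Rightarrow> 'a) \<Rightarrow> bool" where
  "lowering X Z f \<mu> U H \<longleftrightarrow>
     deformation X Z H \<and> openin X U \<and>
     (\<forall>x\<in>topspace X - U. H 1 x = x) \<and> (\<forall>x\<in>U. f (H 1 x) < f x \<and> \<mu> (H 1 x) \<le> \<mu> x)"

lemma lowering_id: "lowering X Z f \<mu> {} (\<lambda>t x. x)"
  by (simp add: lowering_def deformation_id)

lemma lowering_le:
  assumes "lowering X Z f \<mu> U H" "x \<in> topspace X"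
  shows "f (H 1 x) \<le> f x" "\<mu> (H 1 x) \<le> \<mu> x" "H 1 x \<in> topspace X"
  using assms deformation_end_in_topspace[of X Z H x] by (cases "x \<in> U"; force simp: lowering_def)+

lemma lowering_comp:
  assumes H: "lowering X Z f \<mu> U H" and K: "lowering X Z f \<mu> V K"
  shows "lowering X Z f \<mu> (U \<union> V) (\<lambda>t x. K t (H t x))"
proof -
  have "f (K 1 (H 1 x)) < f x \<and> \<mu> (K 1 (H 1 x)) \<le> \<mu> x" if x: "x \<in> U \<union> V" for x
  proof (cases "x \<in> U")
    case True
    have "x \<in> topspace X" using True H openin_subset[of X U] by (auto simp: lowering_def)
    then have "f (K 1 (H 1 x)) \<le> f (H 1 x)" "\<mu> (K 1 (H 1 x)) \<le> \<mu> (H 1 x)"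
      using lowering_le[OF K] lowering_le(3)[OF H] by blast+
    moreover have "f (H 1 x) < f x" "\<mu> (H 1 x) \<le> \<mu> x" using True H by (auto simp: lowering_def)
    ultimately show ?thesis by linarith
  next
    case False
    then have "x \<in> V" "x \<in> topspace X" using x K openin_subset[of X V] by (auto simp: lowering_def)
    moreover have "H 1 x = x" using calculation False H by (auto simp: lowering_def)
    ultimately show ?thesis using K by (auto simp: lowering_def)
  qed
  moreover have "K 1 (H 1 x) = x" if "x \<in> topspace X - (U \<union> V)" for x
    using that H K by (auto simp: lowering_def)
  ultimately show ?thesis
    using H K deformation_comp[of X Z H K] by (auto simp: lowering_def)
qed

lemma lowering_finite_union:
  assumes "finite \<U>" "\<And>U. U \<in> \<U> \<Longrightarrow> \<exists>H. lowering X Z f \<mu> U H"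
  shows "\<exists>H. lowering X Z f \<mu> (\<Union>\<U>) H"
  using assms
proof (induction \<U>)
  case empty
  show ?case unfolding Union_empty by (rule exI) (rule lowering_id)
next
  case (insert U \<U>)
  then obtain H K where "lowering X Z f \<mu> U K" "lowering X Z f \<mu> (\<Union>\<U>) H" by blast
  then show ?case unfolding Union_insert by (intro exI) (rule lowering_comp)
qed

text \<open>
  The topological criterion. The zero set \<open>Z\<close> of \<open>f\<close> is a deformation retract of \<open>X\<close> if, locally, points
  off \<open>Z\<close> can be pushed to smaller values of \<open>f\<close> and points near \<open>Z\<close> can be pushed into \<open>Z\<close>. The
  function \<open>\<mu>\<close> exhausts \<open>X\<close> by compact sets which the first kind of push respects.
\<close>

locale exhausted_deformation =
  fixes X :: "'a topology" and f \<mu> :: "'a \<Rightarrow> real" and Z :: "'a set"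
  assumes Z_def: "Z = {x \<in> topspace X. f x = 0}"
    and f_cont: "continuous_map X euclideanreal f" and f_nonneg: "\<And>x. x \<in> topspace X \<Longrightarrow> f x \<ge> 0"
    and \<mu>_cont: "continuous_map X euclideanreal \<mu>"
    and sublevel_compact: "\<And>c. compactin X {x \<in> topspace X. \<mu> x \<le> c}"
    and lower: "\<And>x. x \<in> topspace X - Z \<Longrightarrow> \<exists>U H. x \<in> U \<and> lowering X Z f \<mu> U H"
    and absorb: "\<And>z. z \<in> Z \<Longrightarrow> \<exists>U H. z \<in> U \<and> openin X U \<and> deformation X Z H \<and> H 1 ` U \<subseteq> Z"
begin

abbreviation sublevel :: "real \<Rightarrow> 'a set" where
  "sublevel c \<equiv> {x \<in> topspace X. \<mu> x \<le> c}"

lemma closedin_superlevel: "closedin X {x \<in> topspace X. f x \<ge> \<delta>}"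
  using closedin_continuous_map_preimage[OF f_cont, of "{\<delta>..}"] by simp

lemma closedin_Z: "closedin X Z"
  using closedin_continuous_map_preimage[OF f_cont, of "{0}"] unfolding Z_def by simp

lemma lowering_compact:
  assumes "compactin X A" "A \<inter> Z = {}"
  shows "\<exists>U H. A \<subseteq> U \<and> lowering X Z f \<mu> U H"
proof -
  have sub: "A \<subseteq> topspace X" using assms(1) by (rule compactin_subset_topspace)
  define \<U> where "\<U> = {U. \<exists>H. lowering X Z f \<mu> U H}"
  have "A \<subseteq> \<Union>\<U>"
  proof
    fix x assume "x \<in> A"
    then have "x \<in> topspace X - Z" using sub assms(2) by blast
    then show "x \<in> \<Union>\<U>" using lower[of x] unfolding \<U>_def by blast
  qed
  moreover have "openin X U" if "U \<in> \<U>" for U using that by (auto simp: \<U>_def lowering_def)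
  ultimately obtain \<F> where F: "finite \<F>" "\<F> \<subseteq> \<U>" "A \<subseteq> \<Union>\<F>"
    using assms(1) unfolding compactin_def by meson
  then have "\<exists>H. lowering X Z f \<mu> (\<Union>\<F>) H"
    by (intro lowering_finite_union) (auto simp: \<U>_def)
  with F(3) show ?thesis by blast
qed

text \<open>
  Finitely many pushes lower \<open>f\<close> strictly, hence by a fixed amount, on the compact set where \<open>f \<ge> \<delta>\<close>
  and \<open>\<mu> \<le> c\<close>. Since \<open>\<mu>\<close> does not increase, this can be iterated until \<open>f < \<delta>\<close>.
\<close>

lemma lower_below:
  assumes "\<delta> > 0"
  shows "\<exists>H. deformation X Z H \<and> (\<forall>x\<in>topspace X. \<mu> (H 1 x) \<le> \<mu> x) \<and> (\<forall>x\<in>sublevel c. f (H 1 x) < \<delta>)"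
proof -
  let ?A = "{x \<in> topspace X. f x \<ge> \<delta>} \<inter> sublevel c"
  have A: "compactin X ?A" using closed_Int_compactin[OF closedin_superlevel sublevel_compact] .
  have "?A \<inter> Z = {}" using assms by (auto simp: Z_def)
  from lowering_compact[OF A this] obtain U H where U: "?A \<subseteq> U" and H: "lowering X Z f \<mu> U H" by blast
  have def_H: "deformation X Z H" using H by (simp add: lowering_def)
  have H_cont: "continuous_map X X (H 1)" using deformation_continuous_map[OF def_H] by simp
  obtain \<epsilon> where \<epsilon>: "\<epsilon> > 0" "\<And>x. x \<in> ?A \<Longrightarrow> f (H 1 x) \<le> f x - \<epsilon>"
  proof (cases "?A = {}")
    case True
    then show thesis using that[of 1] by auto
  next
    case False
    let ?g = "\<lambda>x. f x - f (H 1 x)"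
    have "continuous_map X euclideanreal ?g"
      using continuous_map_compose[OF H_cont f_cont] by (intro continuous_map_diff f_cont) (simp add: o_def)
    from image_compactin[OF A this] have "compact (?g ` ?A)" by simp
    then obtain m where m: "m \<in> ?g ` ?A" "\<And>y. y \<in> ?g ` ?A \<Longrightarrow> m \<le> y"
      using False compact_attains_inf[of "?g ` ?A"] by blast
    have "?g x > 0" if "x \<in> ?A" for x using that U H by (auto simp: lowering_def)
    with m(1) have "m > 0" by blast
    moreover have "f (H 1 x) \<le> f x - m" if "x \<in> ?A" for x using m(2)[of "?g x"] that by force
    ultimately show thesis using that[of m] by blast
  qed
  have "compact (f ` sublevel c)" using image_compactin[OF sublevel_compact f_cont] by simp
  then obtain b where b: "\<And>x. x \<in> sublevel c \<Longrightarrow> f x \<le> b"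
    by (rule compact_image_bounded_above) (rule that)
  \<comment> \<open>After \<open>n\<close> rounds a loss of \<open>n \<epsilon>\<close> would make \<open>f\<close> negative.\<close>
  obtain n :: nat where n: "b < real n * \<epsilon>" using \<epsilon>(1) ex_less_of_nat_mult by blast
  define K where "K k = (\<lambda>t x. ((H t) ^^ k) x)" for k
  have K_def': "deformation X Z (K k)" for k
  proof (induction k)
    case 0
    then show ?case by (simp add: K_def deformation_id)
  next
    case (Suc k)
    then show ?case using deformation_comp[OF Suc def_H] by (simp add: K_def)
  qed
  have K_Suc: "K (Suc k) 1 x = H 1 (K k 1 x)" for k x by (simp add: K_def)
  have K_top: "K k 1 x \<in> topspace X" if "x \<in> topspace X" for k x
    using deformation_end_in_topspace[OF K_def' that] .
  have K_\<mu>: "\<mu> (K k 1 x) \<le> \<mu> x" if x: "x \<in> topspace X" for k x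
  proof (induction k)
    case 0
    then show ?case by (simp add: K_def)
  next
    case (Suc k)
    then show ?case using lowering_le(2)[OF H K_top[OF x, of k]] unfolding K_Suc by linarith
  qed
  have K_f: "f (K k 1 x) < \<delta> \<or> f (K k 1 x) \<le> f x - real k * \<epsilon>" if x: "x \<in> sublevel c" for k x
  proof (induction k)
    case 0
    then show ?case by (simp add: K_def)
  next
    case (Suc k)
    let ?y = "K k 1 x"
    have y: "?y \<in> topspace X" using x K_top by simp
    show ?case
    proof (cases "f ?y < \<delta>")
      case True
      then show ?thesis using lowering_le(1)[OF H y] unfolding K_Suc by linarith
    next
      case False
      have "\<mu> ?y \<le> c" using K_\<mu>[of x k] x by auto
      with False y have "?y \<in> ?A" by auto
      from \<epsilon>(2)[OF this] Suc False show ?thesis unfolding K_Suc by (auto simp: algebra_simps)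
    qed
  qed
  have "f (K n 1 x) < \<delta>" if x: "x \<in> sublevel c" for x
    using K_f[OF x, of n] b[OF x] n f_nonneg[of "K n 1 x"] K_top[of x n] x by auto
  then show ?thesis using K_def'[of n] K_\<mu>[of _ n] by blast
qed

text \<open>
  The end map of \<open>H\<close> fixes each point of \<open>Z\<close>, so it carries a neighbourhood of such a point into any
  given neighbourhood of it; hence absorbing the first set does not spoil the second one.
\<close>

lemma absorb_finite:
  assumes "finite \<U>" "\<And>U. U \<in> \<U> \<Longrightarrow> \<exists>H. openin X U \<and> deformation X Z H \<and> H 1 ` U \<subseteq> Z"
  shows "\<exists>W H. \<Union>\<U> \<inter> Z \<subseteq> W \<and> openin X W \<and> deformation X Z H \<and> H 1 ` W \<subseteq> Z"
  using assms
proof (induction \<U>)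
  case empty
  have "\<Union>{} \<inter> Z \<subseteq> {} \<and> openin X {} \<and> deformation X Z (\<lambda>t x. x) \<and> (\<lambda>t x. x) 1 ` {} \<subseteq> Z"
    by (simp add: deformation_id)
  then show ?case by (intro exI)
next
  case (insert U \<U>)
  have "\<exists>W H. \<Union>\<U> \<inter> Z \<subseteq> W \<and> openin X W \<and> deformation X Z H \<and> H 1 ` W \<subseteq> Z"
    by (rule insert.IH) (rule insert.prems, rule insertI2)
  then obtain W H where W: "\<Union>\<U> \<inter> Z \<subseteq> W" "openin X W" and H: "deformation X Z H" "H 1 ` W \<subseteq> Z"
    by (elim exE conjE)
  obtain K where K: "openin X U" "deformation X Z K" "K 1 ` U \<subseteq> Z"
    using insert.prems[OF insertI1] by (elim exE conjE)
  let ?V = "{x \<in> topspace X. H 1 x \<in> U}"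
  have fixes_Z: "H 1 z = z" "K 1 z = z" if "z \<in> Z" for z using that H(1) K(2) by (auto simp: deformation_def)
  have "openin X (W \<union> ?V)"
    using openin_continuous_map_preimage[OF deformation_continuous_map[OF H(1)] K(1), of 1] W(2) by auto
  moreover have "(\<Union>(insert U \<U>)) \<inter> Z \<subseteq> W \<union> ?V"
  proof
    fix z assume z: "z \<in> (\<Union>(insert U \<U>)) \<inter> Z"
    then have "z \<in> topspace X" by (simp add: Z_def)
    then show "z \<in> W \<union> ?V" using z W(1) fixes_Z(1)[of z] by auto
  qed
  moreover have "(\<lambda>x. K 1 (H 1 x)) ` (W \<union> ?V) \<subseteq> Z"
    using H(2) K(3) fixes_Z(2) by (auto simp: image_subset_iff)
  ultimately show ?case using deformation_comp[OF H(1) K(2)] by (intro exI conjI)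
qed

text \<open>
  By compactness the absorbed neighbourhood of \<open>Z\<close> contains all points with \<open>\<mu> \<le> c\<close> and \<open>f < \<delta>\<close> for some
  \<open>\<delta> > 0\<close>; the lowering pushes reach this region.
\<close>

lemma absorb_sublevel: "\<exists>H. deformation X Z H \<and> H 1 ` sublevel c \<subseteq> Z"
proof -
  have comp: "compactin X (Z \<inter> sublevel c)" using closed_Int_compactin[OF closedin_Z sublevel_compact] .
  define \<U> where "\<U> = {U. \<exists>H. openin X U \<and> deformation X Z H \<and> H 1 ` U \<subseteq> Z}"
  have "Z \<inter> sublevel c \<subseteq> \<Union>\<U>"
  proof
    fix z assume "z \<in> Z \<inter> sublevel c"
    then obtain U H where "z \<in> U" "openin X U \<and> deformation X Z H \<and> H 1 ` U \<subseteq> Z"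
      using absorb[of z] by auto
    then have "U \<in> \<U>" by (auto simp: \<U>_def)
    with \<open>z \<in> U\<close> show "z \<in> \<Union>\<U>" by blast
  qed
  moreover have "openin X U" if "U \<in> \<U>" for U using that by (auto simp: \<U>_def)
  ultimately obtain \<F> where F: "finite \<F>" "\<F> \<subseteq> \<U>" "Z \<inter> sublevel c \<subseteq> \<Union>\<F>"
    using comp unfolding compactin_def by meson
  have "\<exists>H. openin X U \<and> deformation X Z H \<and> H 1 ` U \<subseteq> Z" if "U \<in> \<F>" for U
    using that F(2) by (auto simp: \<U>_def)
  with F(1) have "\<exists>W H. \<Union>\<F> \<inter> Z \<subseteq> W \<and> openin X W \<and> deformation X Z H \<and> H 1 ` W \<subseteq> Z"
    by (rule absorb_finite)
  then obtain W K
    where W: "\<Union>\<F> \<inter> Z \<subseteq> W" "openin X W" and K: "deformation X Z K" "K 1 ` W \<subseteq> Z"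
    by (elim exE conjE)
  let ?A = "(topspace X - W) \<inter> sublevel c"
  have A: "compactin X ?A"
    using W(2) sublevel_compact by (intro closed_Int_compactin) auto
  obtain \<delta> where \<delta>: "\<delta> > 0" "\<And>x. x \<in> ?A \<Longrightarrow> \<delta> \<le> f x"
  proof (cases "?A = {}")
    case True
    then show thesis using that[of 1] by auto
  next
    case False
    have "compact (f ` ?A)" using image_compactin[OF A f_cont] by simp
    then obtain m where m: "m \<in> f ` ?A" "\<And>y. y \<in> f ` ?A \<Longrightarrow> m \<le> y"
      using False compact_attains_inf[of "f ` ?A"] by blast
    have "f x > 0" if x: "x \<in> ?A" for x
    proof -
      have "x \<notin> Z" using x F(3) W(1) by blast
      then show ?thesis using x f_nonneg[of x] by (auto simp: Z_def)
    qed
    with m show thesis using that[of m] by blast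
  qed
  obtain H where H: "deformation X Z H" "\<And>x. x \<in> topspace X \<Longrightarrow> \<mu> (H 1 x) \<le> \<mu> x"
    "\<And>x. x \<in> sublevel c \<Longrightarrow> f (H 1 x) < \<delta>"
    using lower_below[OF \<delta>(1), of c] by blast
  have "K 1 (H 1 x) \<in> Z" if x: "x \<in> sublevel c" for x
  proof -
    have y: "H 1 x \<in> sublevel c"
      using x H(2)[of x] deformation_end_in_topspace[OF H(1), of x] by auto
    have "H 1 x \<in> W" using y H(3)[OF x] \<delta>(2)[of "H 1 x"] by force
    then show ?thesis using K(2) by blast
  qed
  then have "(\<lambda>x. K 1 (H 1 x)) ` sublevel c \<subseteq> Z" by blast
  then show ?thesis using deformation_comp[OF H(1) K(1)] by blast
qed

text \<open>
  Let \<open>S\<^sub>0, S\<^sub>1, \<dots>\<close> be deformations such that the end map of \<open>S\<^sub>n\<close> takes the image of \<open>{\<mu> \<le> n}\<close> under the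
  earlier end maps into \<open>Z\<close>; that image is compact, although \<open>\<mu>\<close> may have grown on it. At time \<open>\<tau>\<close> let
  \<open>S\<^sub>n\<close> run during \<open>[n, n + 1]\<close>. A point with \<open>\<mu> \<le> n\<close> lies in \<open>Z\<close> from time \<open>n + 1\<close> on, so the infinite
  composition can be stopped at the finite time \<open>T x\<close>, which depends continuously on \<open>x\<close>.
\<close>

theorem deformation_retract:
  "\<exists>r. continuous_map X (subtopology X Z) r \<and> (\<forall>z\<in>Z. r z = z) \<and> homotopic_with (\<lambda>_. True) X X id r"
proof -
  let ?I = "top_of_set {0..1::real}"
  have "\<forall>c. \<exists>H. deformation X Z H \<and> H 1 ` sublevel c \<subseteq> Z"
    using absorb_sublevel by blast
  then obtain Q where Q: "\<And>c. deformation X Z (Q c)" "\<And>c. Q c 1 ` sublevel c \<subseteq> Z" by metis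
  have bound: "\<exists>c. continuous_map X X p \<longrightarrow> p ` sublevel (real n) \<subseteq> sublevel c" for p n
  proof (cases "continuous_map X X p")
    case True
    have "compact ((\<mu> \<circ> p) ` sublevel (real n))"
      using image_compactin[OF sublevel_compact continuous_map_compose[OF True \<mu>_cont]] by simp
    then obtain c where c: "\<And>x. x \<in> sublevel (real n) \<Longrightarrow> (\<mu> \<circ> p) x \<le> c"
      by (rule compact_image_bounded_above) (rule that)
    have "p ` sublevel (real n) \<subseteq> sublevel c"
    proof (rule image_subsetI)
      fix x assume "x \<in> sublevel (real n)"
      then show "p x \<in> sublevel c" using c[of x] True by (auto simp: continuous_map_def)
    qed
    then show ?thesis by blast
  qed blast
  then have "\<forall>p n. \<exists>c. continuous_map X X p \<longrightarrow> p ` sublevel (real n) \<subseteq> sublevel c" by (intro allI)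
  then obtain C where C: "\<And>p n. continuous_map X X p \<Longrightarrow> p ` sublevel (real n) \<subseteq> sublevel (C p n)"
    unfolding choice_iff by (elim exE) blast
  define P where "P = rec_nat id (\<lambda>n p x. Q (C p n) 1 (p x))"
  define S where "S n = Q (C (P n) n)" for n
  have P0: "P 0 = id" and P_Suc: "P (Suc n) = (\<lambda>x. S n 1 (P n x))" for n
    by (simp_all add: P_def S_def)
  have S: "deformation X Z (S n)" for n by (simp add: S_def Q)
  have P_cont: "continuous_map X X (P n)" for n
  proof (induction n)
    case (Suc n)
    then show ?case
      using continuous_map_compose[OF Suc deformation_continuous_map[OF S[of n], of 1]]
      by (simp add: P_Suc o_def)
  qed (simp add: P0)
  have P_Z: "P (Suc n) x \<in> Z" if "x \<in> sublevel (real n)" for n x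
    using C[OF P_cont[of n], of n] Q(2)[of "C (P n) n"] that unfolding P_Suc S_def by blast
  define clip where "clip (t::real) = max 0 (min 1 t)" for t
  have clip: "clip t \<in> {0..1}" for t by (simp add: clip_def)
  \<comment> \<open>\<open>R n \<tau>\<close> composes the first \<open>n\<close> stages, each at its own clipped time.\<close>
  define R where "R n \<tau> = rec_nat id (\<lambda>k p x. S k (clip (\<tau> - real k)) (p x)) n" for n \<tau>
  have R0: "R 0 \<tau> x = x" and R_Suc: "R (Suc n) \<tau> x = S n (clip (\<tau> - real n)) (R n \<tau> x)" for n \<tau> x
    by (simp_all add: R_def)
  have R_cont: "continuous_map (prod_topology euclideanreal X) X (\<lambda>(\<tau>, x). R n \<tau> x)" for n
  proof (induction n)
    case 0
    then show ?case by (simp add: R0 case_prod_unfold continuous_map_snd)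
  next
    case (Suc n)
    have "continuous_map euclideanreal ?I (\<lambda>\<tau>. clip (\<tau> - real n))"
      using clip by (auto simp: continuous_map_in_subtopology clip_def intro!: continuous_intros)
    then have "continuous_map (prod_topology euclideanreal X) (prod_topology ?I X)
        (\<lambda>p. (clip (fst p - real n), case p of (\<tau>, x) \<Rightarrow> R n \<tau> x))"
      using Suc continuous_map_compose[OF continuous_map_fst, of euclideanreal ?I "\<lambda>\<tau>. clip (\<tau> - real n)"]
      by (simp add: continuous_map_pairwise o_def)
    moreover have "continuous_map (prod_topology ?I X) X (\<lambda>(t, x). S n t x)"
      using S[of n] by (simp add: deformation_def)
    ultimately have "continuous_map (prod_topology euclideanreal X) X
       ((\<lambda>(t, x). S n t x) \<circ> (\<lambda>p. (clip (fst p - real n), case p of (\<tau>, x) \<Rightarrow> R n \<tau> x)))"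
      by (rule continuous_map_compose)
    then show ?case by (simp add: o_def case_prod_unfold R_Suc)
  qed
  have R_top: "R n \<tau> x \<in> topspace X" if "x \<in> topspace X" for n \<tau> x
    using R_cont[of n] that by (auto simp: continuous_map_def Pi_iff)
  have R_Z: "R n \<tau> z = z" if "z \<in> Z" for n \<tau> z
    using that S clip by (induction n) (auto simp: R0 R_Suc deformation_def)
  have R_stable: "R (n + k) \<tau> x = R n \<tau> x" if "x \<in> topspace X" "\<tau> \<le> real n" for n k \<tau> x
  proof (induction k)
    case (Suc k)
    have "clip (\<tau> - real (n + k)) = 0" using that(2) by (simp add: clip_def)
    then show ?case using Suc S[of "n + k"] R_top[OF that(1), of n \<tau>] by (simp add: R_Suc deformation_def)
  qed simp
  have R_stable': "R m \<tau> x = R n \<tau> x" if "x \<in> topspace X" "\<tau> \<le> real n" "\<tau> \<le> real m" for m n \<tau> x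
    using R_stable[OF that(1,2), of "m - n"] R_stable[OF that(1,3), of "n - m"] by (cases "n \<le> m") auto
  have R_P: "R n \<tau> x = P n x" if "real n \<le> \<tau>" for n \<tau> x
    using that
  proof (induction n)
    case (Suc n)
    then have "clip (\<tau> - real n) = 1" by (simp add: clip_def)
    then show ?case using Suc by (simp add: R_Suc P_Suc)
  qed (simp add: R0 P0)
  \<comment> \<open>The summand \<open>2\<close> leaves room for rounding \<open>\<mu> x\<close> up to an integer \<open>n\<close> and for the stage \<open>[n, n + 1]\<close>.\<close>
  define T where "T x = max 0 (\<mu> x) + 2" for x
  have T_cont: "continuous_map X euclideanreal T"
    unfolding T_def by (intro continuous_intros \<mu>_cont)
  have T_nonneg: "T x \<ge> 0" for x by (simp add: T_def)
  define H where "H t x = R (nat \<lceil>T x\<rceil>) (t * T x) x" for t x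
  have H_R: "H t x = R n (t * T x) x" if "x \<in> topspace X" "T x \<le> real n" "t \<in> {0..1}" for t x n
  proof -
    have "t * T x \<le> T x" using that(3) T_nonneg[of x] by (simp add: mult_left_le_one_le)
    then show ?thesis unfolding H_def using that by (intro R_stable') linarith+
  qed
  have H_cont: "continuous_map (prod_topology ?I X) X (\<lambda>(t, x). H t x)"
  proof (rule pasting_lemma[where I = UNIV and T = "\<lambda>n::nat. {0..1} \<times> {x \<in> topspace X. T x < real n}"
        and f = "\<lambda>n (t, x). R n (t * T x) x"])
    fix n :: nat
    have "openin X {x \<in> topspace X. T x < real n}"
      using openin_continuous_map_preimage[OF T_cont, of "{..<real n}"] by simp
    then show "openin (prod_topology ?I X) ({0..1} \<times> {x \<in> topspace X. T x < real n})"
      by (simp add: openin_prod_Times_iff)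
    have "continuous_map (prod_topology ?I X) euclideanreal (\<lambda>p. fst p * T (snd p))"
      using continuous_map_compose[OF continuous_map_snd T_cont] continuous_map_into_fulltopology[OF continuous_map_fst]
      by (intro continuous_intros) (auto simp: o_def)
    then have "continuous_map (prod_topology ?I X) (prod_topology euclideanreal X) (\<lambda>p. (fst p * T (snd p), snd p))"
      by (simp add: continuous_map_pairwise o_def continuous_map_snd)
    from continuous_map_compose[OF this R_cont[of n]]
    have "continuous_map (prod_topology ?I X) X (\<lambda>(t, x). R n (t * T x) x)"
      by (simp add: o_def case_prod_unfold)
    then show "continuous_map (subtopology (prod_topology ?I X) ({0..1} \<times> {x \<in> topspace X. T x < real n})) X
        (\<lambda>(t, x). R n (t * T x) x)"
      by (rule continuous_map_from_subtopology)
  next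
    fix m n :: nat and p
    assume "p \<in> topspace (prod_topology ?I X) \<inter> ({0..1} \<times> {x \<in> topspace X. T x < real m})
      \<inter> ({0..1} \<times> {x \<in> topspace X. T x < real n})"
    then show "(case p of (t, x) \<Rightarrow> R m (t * T x) x) = (case p of (t, x) \<Rightarrow> R n (t * T x) x)"
      using H_R[of "snd p" m "fst p"] H_R[of "snd p" n "fst p"] by auto
  next
    fix p assume p: "p \<in> topspace (prod_topology ?I X)"
    obtain n :: nat where n: "T (snd p) < real n" using reals_Archimedean2 by blast
    then show "\<exists>j. j \<in> UNIV \<and> p \<in> {0..1} \<times> {x \<in> topspace X. T x < real j} \<and>
        (case p of (t, x) \<Rightarrow> H t x) = (case p of (t, x) \<Rightarrow> R j (t * T x) x)"
      using H_R[of "snd p" n "fst p"] p by (intro exI[of _ n]) auto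
  qed
  have H0: "H 0 x = x" if "x \<in> topspace X" for x
    unfolding H_def using R_stable'[OF that, of 0 0 "nat \<lceil>T x\<rceil>"] by (simp add: R0)
  have H1: "H 1 x \<in> Z" if x: "x \<in> topspace X" for x
  proof -
    define n where "n = nat \<lceil>max 0 (\<mu> x)\<rceil>"
    have n: "\<mu> x \<le> real n" "real (Suc n) \<le> T x" unfolding n_def T_def by linarith+
    define m where "m = nat \<lceil>T x\<rceil>"
    have "Suc n \<le> m" using n(2) unfolding m_def by linarith
    then obtain k where k: "m = Suc n + k" using le_Suc_ex by blast
    have "R (Suc n + k) (T x) x \<in> Z" for k
    proof (induction k)
      case 0
      then show ?case using R_P[OF n(2)] P_Z[of x n] x n(1) by simp
    next
      case (Suc k)
      then show ?case using S[of "Suc n + k"] clip by (simp add: R_Suc deformation_def)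
    qed
    then show ?thesis unfolding H_def m_def[symmetric] k by simp
  qed
  have HZ: "H t z = z" if "z \<in> Z" for t z unfolding H_def using that by (rule R_Z)
  have hom: "homotopic_with (\<lambda>_. True) X X id (H 1)"
    using H_cont H0 by (subst homotopic_with) (auto intro!: exI[of _ "\<lambda>(t, x). H t x"])
  then have "continuous_map X X (H 1)" using homotopic_with_imp_continuous_maps by blast
  then have "continuous_map X (subtopology X Z) (H 1)" using H1 by (auto simp: continuous_map_in_subtopology)
  with HZ hom show ?thesis by blast
qed

end

text \<open>
  A deformation of a compact piece \<open>k ` S\<close> that moves only the points of \<open>k ` D\<close> extends by the identity.
  Compactness makes \<open>k\<close> a homeomorphism onto a closed set, and the extension is pasted from the closed
  sets \<open>k ` S\<close> and \<open>topspace X - k ` D\<close>.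
\<close>

lemma deformation_glue:
  fixes S :: "'e::metric_space set"
  assumes X: "Hausdorff_space X" and S: "compact S" and k: "continuous_map (top_of_set S) X k" "inj_on k S"
    and D: "D \<subseteq> S" "openin X (k ` D)"
    and h: "continuous_on ({0..1} \<times> S) (\<lambda>(t, y). h t y)"
    and h_S: "\<And>t y. t \<in> {0..1} \<Longrightarrow> y \<in> S \<Longrightarrow> h t y \<in> S"
    and h_0: "\<And>y. y \<in> S \<Longrightarrow> h 0 y = y"
    and h_D: "\<And>t y. t \<in> {0..1} \<Longrightarrow> y \<in> S - D \<Longrightarrow> h t y = y"
    and h_Z: "\<And>t y. t \<in> {0..1} \<Longrightarrow> y \<in> S \<Longrightarrow> k y \<in> Z \<Longrightarrow> h t y = y"
  obtains H where "deformation X Z H" "\<And>t y. t \<in> {0..1} \<Longrightarrow> y \<in> S \<Longrightarrow> H t (k y) = k (h t y)"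
    "\<And>t x. t \<in> {0..1} \<Longrightarrow> x \<in> topspace X - k ` D \<Longrightarrow> H t x = x"
proof -
  let ?I = "top_of_set {0..1::real}"
  have kS: "compactin X (k ` S)" using image_compactin[OF _ k(1), of S] S by (simp add: compactin_subtopology)
  have clS: "closedin X (k ` S)" using compactin_imp_closedin[OF X kS] .
  have subS: "k ` S \<subseteq> topspace X" using kS compactin_subset_topspace by blast
  have top: "topspace (subtopology X (k ` S)) = k ` S" using subS by auto
  have "homeomorphic_map (top_of_set S) (subtopology X (k ` S)) k"
  proof (rule continuous_imp_homeomorphic_map)
    show "continuous_map (top_of_set S) (subtopology X (k ` S)) k"
      using k(1) by (simp add: continuous_map_in_subtopology)
    show "compact_space (top_of_set S)" using S by (simp add: compact_space_subtopology)
    show "Hausdorff_space (subtopology X (k ` S))" using X by (rule Hausdorff_space_subtopology)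
    show "k ` topspace (top_of_set S) = topspace (subtopology X (k ` S))" unfolding top by simp
    show "inj_on k (topspace (top_of_set S))" using k(2) by simp
  qed
  then obtain g where g: "homeomorphic_maps (top_of_set S) (subtopology X (k ` S)) k g"
    using homeomorphic_map_maps by blast
  have g_cont: "continuous_map (subtopology X (k ` S)) (top_of_set S) g" and gk: "\<And>y. y \<in> S \<Longrightarrow> g (k y) = y"
    using g by (auto simp: homeomorphic_maps_def)
  define H where "H t x = (if x \<in> k ` S then k (h t (g x)) else x)" for t x
  have Hk: "H t (k y) = k (h t y)" if "y \<in> S" for t y using that by (simp add: H_def gk)
  have HD: "H t x = x" if t: "t \<in> {0..1}" and x: "x \<in> topspace X - k ` D" for t x
  proof (cases "x \<in> k ` S")
    case True
    then obtain y where y: "y \<in> S" "x = k y" by blast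
    then have "y \<in> S - D" using x by blast
    then show ?thesis using h_D[OF t] Hk y by simp
  qed (simp add: H_def)
  have cont: "continuous_map (prod_topology ?I X) X (\<lambda>(t, x). H t x)"
  proof (rule pasting_lemma_closed[where I = UNIV and T = "\<lambda>b. {0..1} \<times> (if b then k ` S else topspace X - k ` D)"
        and f = "\<lambda>b (t, x). if b then k (h t (g x)) else x"])
    show "finite (UNIV :: bool set)" by simp
    fix b :: bool
    show "closedin (prod_topology ?I X) ({0..1} \<times> (if b then k ` S else topspace X - k ` D))"
      using clS D(2) by (auto simp: closedin_prod_Times_iff)
    show "continuous_map (subtopology (prod_topology ?I X) ({0..1} \<times> (if b then k ` S else topspace X - k ` D))) X
       (\<lambda>(t, x). if b then k (h t (g x)) else x)"
    proof (cases b)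
      case True
      have eq: "subtopology (prod_topology ?I X) ({0..1} \<times> k ` S) = prod_topology ?I (subtopology X (k ` S))"
        by (simp add: subtopology_Times subtopology_subtopology)
      have "continuous_map (prod_topology ?I (subtopology X (k ` S))) (prod_topology ?I (top_of_set S)) (\<lambda>p. (fst p, g (snd p)))"
        using continuous_map_compose[OF continuous_map_snd g_cont]
        by (intro continuous_map_pairedI continuous_map_fst) (simp add: o_def)
      moreover have "continuous_map (prod_topology ?I (top_of_set S)) (top_of_set S) (\<lambda>(t, y). h t y)"
        using h h_S by (auto simp: continuous_map_in_subtopology)
      ultimately have "continuous_map (prod_topology ?I (subtopology X (k ` S))) X (k \<circ> ((\<lambda>(t, y). h t y) \<circ> (\<lambda>p. (fst p, g (snd p)))))"
        using k(1) by (intro continuous_map_compose)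
      then show ?thesis using True eq by (simp add: o_def case_prod_unfold)
    next
      case False
      then show ?thesis by (simp add: case_prod_unfold continuous_map_from_subtopology continuous_map_snd)
    qed
  next
    fix b c :: bool and p
    assume p: "p \<in> topspace (prod_topology ?I X) \<inter> ({0..1} \<times> (if b then k ` S else topspace X - k ` D))
      \<inter> ({0..1} \<times> (if c then k ` S else topspace X - k ` D))"
    have "k (h (fst p) (g (snd p))) = snd p" if "snd p \<in> k ` S" "snd p \<in> topspace X - k ` D"
      using HD[of "fst p" "snd p"] that p by (auto simp: H_def)
    then show "(case p of (t, x) \<Rightarrow> if b then k (h t (g x)) else x) = (case p of (t, x) \<Rightarrow> if c then k (h t (g x)) else x)"
      using p by (cases b; cases c) (auto simp: case_prod_unfold)
  next
    fix p assume p: "p \<in> topspace (prod_topology ?I X)"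
    show "\<exists>b. b \<in> UNIV \<and> p \<in> {0..1} \<times> (if b then k ` S else topspace X - k ` D) \<and>
        (case p of (t, x) \<Rightarrow> H t x) = (case p of (t, x) \<Rightarrow> if b then k (h t (g x)) else x)"
      using p D(1) by (intro exI[of _ "snd p \<in> k ` S"]) (auto simp: H_def)
  qed
  have "H 0 x = x" for x by (auto simp: H_def gk h_0)
  moreover have "H t z = z" if "t \<in> {0..1}" "z \<in> Z" for t z
    using that h_Z by (auto simp: H_def gk)
  ultimately have "deformation X Z H" using cont by (auto simp: deformation_def)
  then show thesis using Hk HD by (rule that)
qed


section \<open>Orbit spaces of compact groups\<close>

text \<open>
  A compact group acting on a Hausdorff space, and a closed invariant subset \<open>P\<close> whose orbit space is
  studied.
\<close>

locale compact_action =
  fixes G :: "'g monoid" and TG :: "'g topology" and T :: "'m topology" and a :: "'g \<Rightarrow> 'm \<Rightarrow> 'm" and P :: "'m set"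
  assumes G: "group G" and carrier: "topspace TG = carrier G" and compact_G: "compact_space TG"
    and Hausdorff_T: "Hausdorff_space T"
    and a_cont: "continuous_map (prod_topology TG T) T (\<lambda>(g, x). a g x)"
    and a_one: "\<And>x. x \<in> topspace T \<Longrightarrow> a \<one>\<^bsub>G\<^esub> x = x"
    and a_mult: "\<And>g h x. g \<in> carrier G \<Longrightarrow> h \<in> carrier G \<Longrightarrow> x \<in> topspace T \<Longrightarrow> a (g \<otimes>\<^bsub>G\<^esub> h) x = a g (a h x)"
    and P_closed: "closedin T P" and P_inv: "\<And>g x. g \<in> carrier G \<Longrightarrow> x \<in> P \<Longrightarrow> a g x \<in> P"
begin

interpretation group G by (rule G)

abbreviation q :: "'m \<Rightarrow> 'm set" where "q \<equiv> orbit G a"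
abbreviation Q :: "'m set topology" where "Q \<equiv> orbit_topology G a T P"

lemma P_sub: "P \<subseteq> topspace T"
  using P_closed by (rule closedin_subset)

lemma a_top: "g \<in> carrier G \<Longrightarrow> x \<in> topspace T \<Longrightarrow> a g x \<in> topspace T"
  using a_cont carrier by (auto simp: continuous_map_def Pi_iff)

lemma a_g_cont: "g \<in> carrier G \<Longrightarrow> continuous_map T T (a g)"
  using continuous_map_compose[of T "prod_topology TG T" "Pair g", OF _ a_cont] carrier
  by (simp add: continuous_map_pairwise o_def)

lemma a_inv: "g \<in> carrier G \<Longrightarrow> x \<in> topspace T \<Longrightarrow> a (inv\<^bsub>G\<^esub> g) (a g x) = x"
  using a_mult[of "inv\<^bsub>G\<^esub> g" g x] a_one by simp

lemma q_eq_iff: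
  assumes "x \<in> topspace T" "y \<in> topspace T"
  shows "q x = q y \<longleftrightarrow> (\<exists>g\<in>carrier G. y = a g x)"
proof
  assume "q x = q y"
  moreover have "y \<in> q y" using a_one[OF assms(2)] by (force simp: orbit_def)
  ultimately show "\<exists>g\<in>carrier G. y = a g x" by (auto simp: orbit_def)
next
  assume "\<exists>g\<in>carrier G. y = a g x"
  then obtain g where g: "g \<in> carrier G" "y = a g x" by blast
  show "q x = q y"
  proof (intro subset_antisym subsetI)
    fix z assume "z \<in> q x"
    then obtain h where h: "h \<in> carrier G" "z = a h x" by (auto simp: orbit_def)
    have "z = a (h \<otimes>\<^bsub>G\<^esub> inv\<^bsub>G\<^esub> g) y"
      using g h assms a_mult[of h "inv\<^bsub>G\<^esub> g" y] a_inv[of g x] by simp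
    then show "z \<in> q y" using g h by (auto simp: orbit_def)
  next
    fix z assume "z \<in> q y"
    then obtain h where h: "h \<in> carrier G" "z = a h y" by (auto simp: orbit_def)
    then have "z = a (h \<otimes>\<^bsub>G\<^esub> g) x" using g assms a_mult[of h g x] by simp
    then show "z \<in> q x" using g h by (auto simp: orbit_def)
  qed
qed

lemma topspace_Q: "topspace Q = q ` P"
  using topspace_orbit_topology[OF P_sub] by (auto simp: orbits_def)

lemma q_quotient: "quotient_map (subtopology T P) Q q"
  using P_sub by (rule quotient_map_orbit_topology)

lemma q_cont: "continuous_map (subtopology T P) Q q"
  using q_quotient by (rule quotient_imp_continuous_map)

lemma closedin_snd_image: "closedin (prod_topology TG Y) U \<Longrightarrow> closedin Y (snd ` U)"
  using Abstract_Topological_Spaces.closed_map_snd[OF compact_G, of Y] unfolding closed_map_def by blast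

text \<open>
  The saturation of \<open>A\<close> is the projection of the closed set of all \<open>(g, x)\<close> with \<open>g x \<in> A\<close> along the compact
  factor \<open>G\<close>.
\<close>

lemma saturation_closed:
  assumes "closedin T A"
  shows "closedin T {x \<in> topspace T. \<exists>g\<in>carrier G. a g x \<in> A}"
proof -
  let ?D = "{p \<in> topspace (prod_topology TG T). (case p of (g, x) \<Rightarrow> a g x) \<in> A}"
  have "closedin (prod_topology TG T) ?D" using a_cont assms by (rule closedin_continuous_map_preimage)
  then have "closedin T (snd ` ?D)" by (rule closedin_snd_image)
  also have "snd ` ?D = {x \<in> topspace T. \<exists>g\<in>carrier G. a g x \<in> A}"
    using carrier by (force simp: image_iff)
  finally show ?thesis .
qed

lemma q_closed: "closed_map (subtopology T P) Q q"
  unfolding closed_map_def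
proof (intro allI impI)
  fix A assume A: "closedin (subtopology T P) A"
  then have AT: "closedin T A" "A \<subseteq> P" 
    using P_closed closedin_closed_subtopology by blast+
  have "{x \<in> topspace (subtopology T P). q x \<in> q ` A} = {x \<in> topspace T. \<exists>g\<in>carrier G. a g x \<in> A} \<inter> P"
    using P_sub AT(2) q_eq_iff by (auto simp: image_iff subset_iff; metis)
  then have "closedin (subtopology T P) {x \<in> topspace (subtopology T P). q x \<in> q ` A}"
    using saturation_closed[OF AT(1)] P_closed
    by (metis (no_types, lifting) closedin_Int closedin_subtopology_Int_closed inf_commute)
  moreover have "q ` A \<subseteq> topspace Q" using AT(2) topspace_Q by blast
  ultimately show "closedin Q (q ` A)"
    using q_quotient unfolding quotient_map_closedin by blast
qed

lemma orbit_compact: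
  assumes "x \<in> topspace T"
  shows "compactin T (q x)"
proof -
  have "continuous_map TG (prod_topology TG T) (\<lambda>g. (g, x))"
    using assms by (simp add: continuous_map_pairwise o_def)
  from continuous_map_compose[OF this a_cont] have "continuous_map TG T (\<lambda>g. a g x)" by (simp add: o_def)
  from image_compactin[OF _ this, of "carrier G"] compact_G carrier
  have "compactin T ((\<lambda>g. a g x) ` carrier G)" by (simp add: compact_space_def)
  moreover have "(\<lambda>g. a g x) ` carrier G = q x" by (auto simp: orbit_def)
  ultimately show ?thesis by simp
qed

text \<open>
  Two orbits are disjoint compact sets; neighbourhoods separating them shrink to saturated ones
  because the quotient map is closed.
\<close>

lemma Q_Hausdorff: "Hausdorff_space Q"
  unfolding Hausdorff_space_def
proof (intro allI impI, elim conjE)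
  fix X Y assume XY: "X \<in> topspace Q" "Y \<in> topspace Q" and "X \<noteq> Y"
  from XY(1) obtain x where x: "x \<in> P" "X = q x" unfolding topspace_Q by (elim imageE) (rule that)
  from XY(2) obtain y where y: "y \<in> P" "Y = q y" unfolding topspace_Q by (elim imageE) (rule that)
  have xy: "x \<in> topspace T" "y \<in> topspace T" using x y P_sub by auto
  have "disjnt (q x) (q y)"
  proof (rule ccontr)
    assume "\<not> disjnt (q x) (q y)"
    then obtain z where z: "z \<in> q x" "z \<in> q y" by (auto simp: disjnt_def)
    then have "z \<in> topspace T" using xy a_top by (auto simp: orbit_def)
    then have "q x = q z" "q y = q z" using z q_eq_iff xy by (auto simp: orbit_def)
    with \<open>X \<noteq> Y\<close> x y show False by simp
  qed
  then obtain U V where U: "openin T U" "q x \<subseteq> U" and V: "openin T V" "q y \<subseteq> V" and UV: "disjnt U V"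
    by (rule Hausdorff_space_compact_separation[OF Hausdorff_T orbit_compact[OF xy(1)] orbit_compact[OF xy(2)]])
      (rule that)
  have op: "openin Q (topspace Q - q ` (P - W))" if "openin T W" for W
  proof -
    have "P - W = P \<inter> (topspace T - W)" using P_sub by blast
    then have "closedin (subtopology T P) (P - W)"
      using that by (metis closedin_diff closedin_subtopology_Int_closed closedin_topspace)
    then show ?thesis using q_closed by (auto simp: closed_map_def)
  qed
  have mem: "q z \<in> topspace Q - q ` (P - W)" if "z \<in> P" "q z \<subseteq> W" for z W
  proof -
    have "q z \<noteq> q w" if "w \<in> P - W" for w
    proof
      assume "q z = q w"
      moreover have "w \<in> q w" using a_one[of w] that P_sub by (force simp: orbit_def)
      ultimately show False using \<open>q z \<subseteq> W\<close> that by blast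
    qed
    then show ?thesis using \<open>z \<in> P\<close> topspace_Q by blast
  qed
  have "disjnt (topspace Q - q ` (P - U)) (topspace Q - q ` (P - V))"
    using UV topspace_Q by (auto simp: disjnt_def)
  then show "\<exists>U V. openin Q U \<and> openin Q V \<and> X \<in> U \<and> Y \<in> V \<and> disjnt U V"
    using op[OF U(1)] op[OF V(1)] mem[OF x(1) U(2)] mem[OF y(1) V(2)] x(2) y(2) by blast
qed

text \<open>
  Openness in the orbit space of the image of a set \<open>W\<close> that need not be open itself, such as a slice:
  it suffices that points close to \<open>W\<close> have orbits meeting \<open>W\<close>.
\<close>

lemma open_orbit_image:
  assumes W: "W \<subseteq> P"
    and loc: "\<And>w. w \<in> W \<Longrightarrow> \<exists>V. openin T V \<and> w \<in> V \<and> (\<forall>x\<in>V \<inter> P. \<exists>g\<in>carrier G. a g x \<in> W)"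
  shows "openin Q (q ` W)"
  unfolding openin_orbit_topology
proof
  show "q ` W \<subseteq> orbits G P a" using W by (auto simp: orbits_def)
  let ?S = "{x \<in> topspace T \<inter> P. q x \<in> q ` W}"
  show "openin (subtopology T P) ?S"
  proof (subst openin_subopen, intro ballI)
    fix x assume "x \<in> ?S"
    then obtain w where x: "x \<in> P" and w: "w \<in> W" "q x = q w" by auto
    then obtain g where g: "g \<in> carrier G" "w = a g x" using q_eq_iff[of x w] W P_sub by blast
    obtain V where V: "openin T V" "w \<in> V" "\<And>x. x \<in> V \<inter> P \<Longrightarrow> \<exists>g\<in>carrier G. a g x \<in> W" using loc[OF w(1)] by blast
    let ?V = "{z \<in> topspace T. a g z \<in> V}"
    have "openin T ?V" using a_g_cont[OF g(1)] V(1) by (rule openin_continuous_map_preimage)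
    then have "openin (subtopology T P) (?V \<inter> P)" by (auto simp: openin_subtopology)
    moreover have "x \<in> ?V \<inter> P" using x P_sub g V(2) by auto
    moreover have "?V \<inter> P \<subseteq> ?S"
    proof
      fix z assume z: "z \<in> ?V \<inter> P"
      then obtain h where h: "h \<in> carrier G" "a h (a g z) \<in> W" using V(3)[of "a g z"] P_inv[OF g(1), of z] by auto
      have zT: "z \<in> topspace T" using z by simp
      have "a (h \<otimes>\<^bsub>G\<^esub> g) z = a h (a g z)" using a_mult[OF h(1) g(1) zT] .
      then have "q z = q (a h (a g z))"
        using q_eq_iff[OF zT, of "a h (a g z)"] h g a_top zT by (metis m_closed)
      then show "z \<in> ?S" using h(2) z by auto
    qed
    ultimately show "\<exists>U. openin (subtopology T P) U \<and> x \<in> U \<and> U \<subseteq> ?S" by blast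
  qed
qed

text \<open>
  By freeness and compactness, group elements away from the unit move a small neighbourhood of \<open>x0\<close> off
  itself: the pairs \<open>(x, g x)\<close> with \<open>g \<notin> N\<close> form a closed set that avoids \<open>(x0, x0)\<close>.
\<close>

lemma small_displacement:
  assumes x0: "x0 \<in> topspace T" and free: "\<And>g. g \<in> carrier G \<Longrightarrow> a g x0 = x0 \<Longrightarrow> g = \<one>\<^bsub>G\<^esub>"
    and N: "openin TG N" "\<one>\<^bsub>G\<^esub> \<in> N"
  obtains V where "openin T V" "x0 \<in> V" "\<And>g x. g \<in> carrier G \<Longrightarrow> x \<in> V \<Longrightarrow> a g x \<in> V \<Longrightarrow> g \<in> N"
proof -
  let ?TT = "prod_topology TG (prod_topology T T)"
  let ?f = "\<lambda>p. (a (fst p) (fst (snd p)), snd (snd p))"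
  have "continuous_map ?TT (prod_topology TG T) (\<lambda>p. (fst p, fst (snd p)))"
    using continuous_map_compose[OF continuous_map_snd continuous_map_fst, of TG T T]
    by (intro continuous_map_pairedI continuous_map_fst) (simp add: o_def)
  from continuous_map_compose[OF this a_cont]
  have "continuous_map ?TT T (\<lambda>p. a (fst p) (fst (snd p)))" by (simp add: o_def)
  moreover have "continuous_map ?TT T (\<lambda>p. snd (snd p))"
    using continuous_map_compose[OF continuous_map_snd continuous_map_snd, of TG T T] by (simp add: o_def)
  ultimately have f: "continuous_map ?TT (prod_topology T T) ?f" by (intro continuous_map_pairedI)
  let ?D = "{p \<in> topspace ?TT. ?f p \<in> (\<lambda>x. (x, x)) ` topspace T}"
  have "closedin (prod_topology T T) ((\<lambda>x. (x, x)) ` topspace T)"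
    using Hausdorff_T by (simp add: Hausdorff_space_closedin_diagonal)
  with f have "closedin ?TT ?D" by (rule closedin_continuous_map_preimage)
  moreover have "closedin ?TT ((topspace TG - N) \<times> topspace (prod_topology T T))"
    using N(1) closedin_topspace[of "prod_topology T T"] closedin_diff[OF closedin_topspace N(1)]
    unfolding closedin_prod_Times_iff[of TG "prod_topology T T"] by blast
  ultimately have "closedin ?TT (?D \<inter> ((topspace TG - N) \<times> topspace (prod_topology T T)))" (is "closedin _ ?E")
    by (rule closedin_Int)
  then have cE: "closedin (prod_topology T T) (snd ` ?E)" by (rule closedin_snd_image)
  have nE: "(x0, x0) \<notin> snd ` ?E"
  proof
    assume "(x0, x0) \<in> snd ` ?E"
    then obtain g where "g \<in> topspace TG - N" "a g x0 = x0" by auto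
    then show False using free N(2) carrier by auto
  qed
  have "openin (prod_topology T T) (topspace (prod_topology T T) - snd ` ?E)"
    using openin_topspace cE by (rule openin_diff)
  moreover have "(x0, x0) \<in> topspace (prod_topology T T) - snd ` ?E"
    using nE x0 by (intro DiffI) simp_all
  ultimately have "\<exists>V1 V2. openin T V1 \<and> openin T V2 \<and> x0 \<in> V1 \<and> x0 \<in> V2
      \<and> V1 \<times> V2 \<subseteq> topspace (prod_topology T T) - snd ` ?E"
    unfolding openin_prod_topology_alt by (elim allE impE)
  then obtain V1 V2 where V: "openin T V1" "openin T V2" "x0 \<in> V1" "x0 \<in> V2"
    "V1 \<times> V2 \<subseteq> topspace (prod_topology T T) - snd ` ?E" by (elim exE conjE) (rule that)
  show thesis
  proof (rule that[of "V1 \<inter> V2"])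
    show "openin T (V1 \<inter> V2)" "x0 \<in> V1 \<inter> V2" using V by auto
    fix g x assume g: "g \<in> carrier G" and x: "x \<in> V1 \<inter> V2" "a g x \<in> V1 \<inter> V2"
    show "g \<in> N"
    proof (rule ccontr)
      assume "g \<notin> N"
      have xT: "x \<in> topspace T" using x(1) V(1) openin_subset by blast
      then have "(g, (x, a g x)) \<in> ?E" using g \<open>g \<notin> N\<close> carrier a_top[OF g xT] by auto
      then have "(x, a g x) \<in> snd ` ?E" by force
      then show False using V(5) x by blast
    qed
  qed
qed

text \<open>
  The orbit space of a closed invariant subset is a subspace, since the restriction of a quotient map
  to a closed saturated set is a quotient map.
\<close>

lemma orbit_subspace:
  assumes Z: "closedin T Z" and inv: "\<And>g x. g \<in> carrier G \<Longrightarrow> x \<in> P \<inter> Z \<Longrightarrow> a g x \<in> Z"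
  shows "orbit_topology G a T (P \<inter> Z) = subtopology Q (q ` (P \<inter> Z))"
proof -
  have sub: "P \<inter> Z \<subseteq> topspace T" using P_sub by blast
  have cl: "closedin (subtopology T P) (P \<inter> Z)" using Z by (simp add: closedin_subtopology_Int_closed)
  have sat: "{x \<in> topspace (subtopology T P). q x \<in> q ` (P \<inter> Z)} = P \<inter> Z"
  proof (intro subset_antisym subsetI)
    fix x assume x: "x \<in> {x \<in> topspace (subtopology T P). q x \<in> q ` (P \<inter> Z)}"
    then obtain z where z: "z \<in> P \<inter> Z" "q z = q x" by auto
    then obtain g where "g \<in> carrier G" "x = a g z" using q_eq_iff[of z x] x P_sub by auto
    then show "x \<in> P \<inter> Z" using inv[of g z] z x by auto
  qed (use P_sub in auto)
  have "closedin Q (q ` (P \<inter> Z))" using q_closed cl by (simp add: closed_map_def)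
  then have "quotient_map (subtopology (subtopology T P) (P \<inter> Z)) (subtopology Q (q ` (P \<inter> Z))) q"
    using quotient_map_restriction[OF q_quotient sat] by blast
  then have 1: "quotient_map (subtopology T (P \<inter> Z)) (subtopology Q (q ` (P \<inter> Z))) q"
    by (simp add: subtopology_subtopology)
  have 2: "quotient_map (subtopology T (P \<inter> Z)) (orbit_topology G a T (P \<inter> Z)) q"
    using sub by (rule quotient_map_orbit_topology)
  show ?thesis
    unfolding topology_eq
  proof
    fix U
    have tops: "topspace (subtopology Q (q ` (P \<inter> Z))) = q ` (P \<inter> Z)" "topspace (orbit_topology G a T (P \<inter> Z)) = q ` (P \<inter> Z)"
      using topspace_Q topspace_orbit_topology[OF sub, of G a] by (auto simp: orbits_def)
    show "openin (orbit_topology G a T (P \<inter> Z)) U = openin (subtopology Q (q ` (P \<inter> Z))) U"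
    proof (cases "U \<subseteq> q ` (P \<inter> Z)")
      case True
      then show ?thesis using 1 2 unfolding quotient_map_def tops by simp
    next
      case False
      then have "\<not> openin (orbit_topology G a T (P \<inter> Z)) U" "\<not> openin (subtopology Q (q ` (P \<inter> Z))) U"
        using openin_subset[of "orbit_topology G a T (P \<inter> Z)" U]
          openin_subset[of "subtopology Q (q ` (P \<inter> Z))" U] unfolding tops by blast+
      then show ?thesis by simp
    qed
  qed
qed

end

section \<open>Calculus on finite-dimensional normed spaces\<close>

lemma finite_span_norm_split:
  fixes B :: "'a::real_normed_vector set"
  assumes closed: "closed (span B)" and b: "b \<notin> span B"
  obtains \<delta> where "\<delta> > 0" "\<And>w c. w \<in> span B \<Longrightarrow> \<bar>c\<bar> * \<delta> \<le> norm (w + c *\<^sub>R b)"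
proof -
  from closed b obtain \<delta> where \<delta>: "\<delta> > 0" "\<And>y. dist y b < \<delta> \<Longrightarrow> y \<notin> span B"
    by (metis (no_types, lifting) ComplI Compl_iff open_Compl open_dist)
  have "\<bar>c\<bar> * \<delta> \<le> norm (w + c *\<^sub>R b)" if w: "w \<in> span B" for w c
  proof (cases "c = 0")
    case False
    have "(- inverse c) *\<^sub>R w \<in> span B" using w by (rule span_scale)
    then have "\<delta> \<le> norm (b + inverse c *\<^sub>R w)"
      using \<delta>(2)[of "(- inverse c) *\<^sub>R w"] by (force simp: dist_norm norm_minus_commute)
    also have "b + inverse c *\<^sub>R w = inverse c *\<^sub>R (w + c *\<^sub>R b)"
      using False by (simp add: algebra_simps)
    finally have "\<delta> \<le> norm (w + c *\<^sub>R b) / \<bar>c\<bar>"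
      by (simp add: divide_inverse abs_inverse mult.commute)
    then show ?thesis using False by (simp add: field_simps)
  qed simp
  with \<delta>(1) show thesis using that by blast
qed

text \<open>
  Induction on the spanning set. A new vector \<open>b\<close> has a positive distance from the old span, which is
  closed, so both summands of \<open>w + c b\<close> are controlled by the norm of the sum.
\<close>

lemma finite_span_bounds:
  fixes B :: "'a::real_normed_vector set"
  assumes "finite B"
  shows "(\<forall>r. compact (cball 0 r \<inter> span B)) \<and> closed (span B) \<and>
    (\<forall>f::'a \<Rightarrow> 'b::real_normed_vector. linear f \<longrightarrow>
       (\<exists>K\<ge>0. \<forall>x\<in>span B. norm (f x) \<le> K * norm x))"
  using assms
proof (induction B)
    case empty
    have "cball 0 r \<inter> {0::'a} = (if r \<ge> 0 then {0} else {})" for r by auto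
    then show ?case by (auto simp: linear_0)
  next
    case (insert b B)
    note IH = insert.IH
    show ?case
    proof (cases "b \<in> span B")
      case True
      then have "span (insert b B) = span B" by (rule span_redundant)
      with IH show ?thesis by simp
    next
      case False
      from finite_span_norm_split[OF conjunct1[OF conjunct2[OF IH]] False] obtain \<delta>
        where \<delta>: "\<delta> > 0" "\<And>w c. w \<in> span B \<Longrightarrow> \<bar>c\<bar> * \<delta> \<le> norm (w + c *\<^sub>R b)" by blast
      have sp: "span (insert b B) = {w + c *\<^sub>R b | w c. w \<in> span B}"
      proof (intro subset_antisym subsetI)
        fix x assume "x \<in> span (insert b B)"
        then obtain c where "x - c *\<^sub>R b \<in> span B" by (auto simp: span_insert)
        then show "x \<in> {w + c *\<^sub>R b | w c. w \<in> span B}" by force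
      next
        fix x assume "x \<in> {w + c *\<^sub>R b | w c. w \<in> span B}"
        then obtain w c where "w \<in> span B" "x = w + c *\<^sub>R b" by blast
        then have "x - c *\<^sub>R b \<in> span B" by simp
        then show "x \<in> span (insert b B)" unfolding span_insert by blast
      qed
      have norm_w: "norm w \<le> (1 + norm b / \<delta>) * norm (w + c *\<^sub>R b)" if "w \<in> span B" for w c
      proof -
        have "norm w \<le> norm (w + c *\<^sub>R b) + \<bar>c\<bar> * norm b"
          by (metis add_diff_cancel_right' norm_scaleR norm_triangle_ineq4)
        also have "\<bar>c\<bar> * norm b \<le> norm (w + c *\<^sub>R b) / \<delta> * norm b"
          using \<delta>(1) \<delta>(2)[OF that, of c] by (intro mult_right_mono) (auto simp: field_simps)
        finally show ?thesis by (simp add: field_simps)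
      qed
      have norm_c: "\<bar>c\<bar> \<le> norm (w + c *\<^sub>R b) / \<delta>" if "w \<in> span B" for w c
        using \<delta>(1) \<delta>(2)[OF that, of c] by (auto simp: field_simps)
      have cpt: "compact (cball 0 r \<inter> span (insert b B))" for r
      proof -
        let ?K = "cball 0 ((1 + norm b / \<delta>) * r) \<inter> span B"
        let ?I = "(\<lambda>(w, c). w + c *\<^sub>R b) ` (?K \<times> cball 0 (r / \<delta>))"
        have "compact ?I"
          using IH by (intro compact_continuous_image compact_Times)
            (auto intro!: continuous_intros simp: case_prod_unfold)
        moreover have "cball 0 r \<inter> span (insert b B) = cball 0 r \<inter> ?I"
        proof (intro subset_antisym subsetI IntI)
          fix x assume x: "x \<in> cball 0 r \<inter> span (insert b B)"
          then obtain w c where w: "w \<in> span B" "x = w + c *\<^sub>R b" using sp by auto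
          have "norm w \<le> (1 + norm b / \<delta>) * r"
            using norm_w[OF w(1), of c] x w(2) \<delta>(1)
            by (smt (verit, best) IntD1 divide_nonneg_pos mem_cball_0 mult_left_mono norm_ge_zero)
          moreover have "\<bar>c\<bar> \<le> r / \<delta>"
            using norm_c[OF w(1), of c] x w(2) \<delta>(1)
            by (smt (verit, best) IntD1 divide_right_mono mem_cball_0)
          ultimately show "x \<in> ?I" using w by (auto intro!: rev_image_eqI[where x = "(w, c)"])
        next
          fix x assume "x \<in> cball 0 r \<inter> ?I"
          then show "x \<in> span (insert b B)" using sp by auto
        qed auto
        ultimately show ?thesis by (simp add: closed_Int_compact)
      qed
      have "closed (span (insert b B))"
        unfolding closed_sequential_limits
      proof (intro allI impI, elim conjE)
        fix x l assume x: "\<forall>n. x n \<in> span (insert b B)" and l: "x \<longlonglongrightarrow> l"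
        from l have "Bseq x" by (meson convergentI convergent_imp_Bseq)
        then obtain r where "\<forall>n. x n \<in> cball 0 r" by (auto simp: Bseq_def)
        with x have "\<forall>n. x n \<in> cball 0 r \<inter> span (insert b B)" by auto
        then have "l \<in> cball 0 r \<inter> span (insert b B)"
          using l compact_imp_closed[OF cpt] closed_sequentially by blast
        then show "l \<in> span (insert b B)" by simp
      qed
      moreover have "\<exists>K\<ge>0. \<forall>x\<in>span (insert b B). norm (f x) \<le> K * norm x"
        if f: "linear f" for f :: "'a \<Rightarrow> 'b"
      proof -
        from IH f obtain K where K: "K \<ge> 0" "\<And>x. x \<in> span B \<Longrightarrow> norm (f x) \<le> K * norm x" by blast
        let ?K = "K * (1 + norm b / \<delta>) + norm (f b) / \<delta>"
        have "norm (f x) \<le> ?K * norm x" if "x \<in> span (insert b B)" for x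
        proof -
          from that obtain w c where w: "w \<in> span B" "x = w + c *\<^sub>R b" using sp by auto
          have "norm (f x) \<le> norm (f w) + \<bar>c\<bar> * norm (f b)"
            using norm_triangle_ineq[of "f w" "c *\<^sub>R f b"] f w(2) by (simp add: linear_add linear_scale)
          also have "norm (f w) \<le> K * ((1 + norm b / \<delta>) * norm x)"
            using K(2)[OF w(1)] mult_left_mono[OF norm_w[OF w(1), of c] K(1)] w(2) by simp
          also have "\<bar>c\<bar> * norm (f b) \<le> norm x / \<delta> * norm (f b)"
            using norm_c[OF w(1), of c] w(2) by (intro mult_right_mono) auto
          finally show ?thesis by (simp add: field_simps)
        qed
        moreover have "?K \<ge> 0" using K(1) \<delta>(1) by simp
        ultimately show ?thesis by blast
      qed
      ultimately show ?thesis using cpt by blast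
    qed
  qed

lemma finite_dimensional_compact_cball:
  assumes "finite_dimensional TYPE('a::real_normed_vector)"
  shows "compact (cball (a::'a) r)"
proof -
  from assms obtain B :: "'a set" where "finite B" "span B = UNIV" by (auto simp: finite_dimensional_def)
  with finite_span_bounds[of B, where 'b = real] have "compact (cball (0::'a) r)" by simp
  then have "compact ((+) a ` cball 0 r)" by (rule compact_translation)
  then show ?thesis by simp
qed

lemma finite_dimensional_bounded_linear:
  assumes "finite_dimensional TYPE('a::real_normed_vector)"
    and "linear (f :: 'a \<Rightarrow> 'b::real_normed_vector)"
  shows "bounded_linear f"
proof -
  from assms obtain B :: "'a set" where "finite B" "span B = UNIV" by (auto simp: finite_dimensional_def)
  with finite_span_bounds[of B, where 'b = 'b] assms(2) obtain K where "\<forall>x. norm (f x) \<le> K * norm x" by auto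
  then show ?thesis
    using assms(2) by (auto simp: bounded_linear_def bounded_linear_axioms_def mult.commute)
qed

lemma finite_dimensional_complete_cball:
  assumes "finite_dimensional TYPE('a::real_normed_vector)"
  shows "complete (cball (a::'a) r)"
  by (rule compact_imp_complete) (rule finite_dimensional_compact_cball[OF assms])

lemma finite_dimensional_surj:
  fixes f :: "'a::real_vector \<Rightarrow> 'b::real_vector"
  assumes "finite_dimensional TYPE('a)" "linear f" "surj f"
  shows "finite_dimensional TYPE('b)"
proof -
  from assms obtain B :: "'a set" where "finite B" "span B = UNIV" by (auto simp: finite_dimensional_def)
  then have "finite (f ` B)" "span (f ` B) = UNIV"
    using linear_span_image[OF assms(2), of B] assms(3) by auto
  then show ?thesis unfolding finite_dimensional_def by blast
qed

lemma finite_dimensional_prod: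
  assumes "finite_dimensional TYPE('a::real_vector)" "finite_dimensional TYPE('b::real_vector)"
  shows "finite_dimensional TYPE('a \<times> 'b)"
proof -
  from assms obtain A :: "'a set" and B :: "'b set"
    where A: "finite A" "span A = UNIV" and B: "finite B" "span B = UNIV" by (auto simp: finite_dimensional_def)
  let ?C = "(\<lambda>a. (a, 0)) ` A \<union> (\<lambda>b. (0, b)) ` B"
  have l: "linear (\<lambda>a::'a. (a, 0::'b))" "linear (\<lambda>b::'b. (0::'a, b))"
    by (auto intro!: linearI)
  have "(a, b) \<in> span ?C" for a b
  proof -
    have "(a, 0) \<in> span ((\<lambda>a. (a, 0::'b)) ` A)" "(0, b) \<in> span ((\<lambda>b. (0::'a, b)) ` B)"
      using linear_span_image[OF l(1), of A] linear_span_image[OF l(2), of B] A B by auto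
    then have "(a, 0) \<in> span ?C" "(0, b) \<in> span ?C" by (meson span_mono subsetD sup_ge1 sup_ge2)+
    then show ?thesis using span_add by fastforce
  qed
  then have "span ?C = UNIV" by auto
  moreover have "finite ?C" using A B by simp
  ultimately show ?thesis unfolding finite_dimensional_def by blast
qed

text \<open>
  Strict differentiability is the form in which continuous differentiability enters: the difference
  quotients near \<open>x\<close> are controlled in both arguments, as Newton iterations require.
\<close>

definition has_strict_derivative ::
    "('a::real_normed_vector \<Rightarrow> 'b::real_normed_vector) \<Rightarrow> ('a \<Rightarrow> 'b) \<Rightarrow> 'a \<Rightarrow> bool" where
  "has_strict_derivative f f' x \<longleftrightarrow> bounded_linear f' \<and>
     (\<forall>\<epsilon>>0. \<exists>\<delta>>0. \<forall>a\<in>ball x \<delta>. \<forall>b\<in>ball x \<delta>. norm (f a - f b - f' (a - b)) \<le> \<epsilon> * norm (a - b))"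

lemma has_strict_derivativeD:
  assumes "has_strict_derivative f f' x" "\<epsilon> > 0"
  obtains \<delta> where "\<delta> > 0" "\<And>a b. a \<in> ball x \<delta> \<Longrightarrow> b \<in> ball x \<delta> \<Longrightarrow>
     norm (f a - f b - f' (a - b)) \<le> \<epsilon> * norm (a - b)"
  using assms unfolding has_strict_derivative_def by meson

lemma finite_dimensional_coordinates:
  assumes "finite_dimensional TYPE('a::real_normed_vector)"
  obtains B :: "'a::real_normed_vector set" and c where "finite B" "\<And>b. bounded_linear (c b)" "\<And>x. x = (\<Sum>b\<in>B. c b x *\<^sub>R b)"
proof -
  from assms obtain B0 :: "'a set" where "finite B0" "span B0 = UNIV" by (auto simp: finite_dimensional_def)
  from maximal_independent_subset[of B0] obtain B
    where B': "B \<subseteq> B0" "independent B" "B0 \<subseteq> span B" by blast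
  have "span B = UNIV" using span_mono[OF B'(3)] \<open>span B0 = UNIV\<close> by (simp add: span_span top.extremum_unique)
  note B = B'(1,2) this
  have fB: "finite B" using B(1) \<open>finite B0\<close> by (rule finite_subset)
  let ?c = "\<lambda>b x. representation B x b"
  have "linear (?c b)" for b
    using B by (intro linearI) (auto simp: representation_add representation_scale)
  then have bl: "bounded_linear (?c b)" for b
    by (rule finite_dimensional_bounded_linear[OF assms])
  have "x = (\<Sum>b\<in>B. ?c b x *\<^sub>R b)" for x
    using sum_representation_eq[OF B(2), of x B] B(3) fB by simp
  with fB bl show thesis by (rule that)
qed

text \<open>
  The partial derivatives along a finite basis are continuous, hence the derivative is close to the one
  at \<open>x\<close> in operator norm on a ball, and the mean value inequality applies to \<open>f - f' x\<close>.
\<close>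

lemma Ck1_has_strict_derivative:
  fixes f :: "'a::real_normed_vector \<Rightarrow> 'b::real_normed_vector"
  assumes fin: "finite_dimensional TYPE('a)" and S: "open S" "x \<in> S" and f: "Ck_on (Suc 0) S f"
  shows "has_strict_derivative f (frechet_derivative f (at x)) x"
proof -
  let ?D = "\<lambda>y. frechet_derivative f (at y)"
  have der: "(f has_derivative ?D y) (at y)" if "y \<in> S" for y
    using f that frechet_derivative_works by auto
  have cont: "continuous_on S (\<lambda>y. ?D y v)" for v using f by auto
  obtain B :: "'a set" and c where B: "finite B" "\<And>b. bounded_linear (c b)" "\<And>x. x = (\<Sum>b\<in>B. c b x *\<^sub>R b)"
    using finite_dimensional_coordinates[OF fin] by metis
  have "\<forall>b. \<exists>K. \<forall>x. norm (c b x) \<le> norm x * K"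
    by (intro allI bounded_linear.bounded[OF B(2)])
  then obtain k where k: "\<And>b x. norm (c b x) \<le> norm x * k b" by metis
  have "\<exists>\<delta>>0. \<forall>a\<in>ball x \<delta>. \<forall>b\<in>ball x \<delta>. norm (f a - f b - ?D x (a - b)) \<le> \<epsilon> * norm (a - b)"
    if \<epsilon>: "\<epsilon> > 0" for \<epsilon>
  proof -
    let ?K = "1 + (\<Sum>b\<in>B. \<bar>k b\<bar>)"
    have K: "?K > 0" by (smt (verit) abs_ge_zero sum_nonneg)
    have "\<forall>\<^sub>F y in at x within S. norm (?D y b - ?D x b) < \<epsilon> / ?K" for b
      using cont[of b] S(2) \<epsilon> K
      by (auto simp: continuous_on_def tendsto_iff dist_norm)
    then have "\<forall>\<^sub>F y in at x within S. \<forall>b\<in>B. norm (?D y b - ?D x b) < \<epsilon> / ?K"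
      using B(1) by (intro eventually_ball_finite) auto
    then have "\<forall>\<^sub>F y in at x. \<forall>b\<in>B. norm (?D y b - ?D x b) < \<epsilon> / ?K"
      unfolding at_within_open[OF S(2,1)] .
    then obtain \<delta>1 where \<delta>1: "\<delta>1 > 0"
      "\<And>y b. y \<noteq> x \<Longrightarrow> dist y x < \<delta>1 \<Longrightarrow> b \<in> B \<Longrightarrow> norm (?D y b - ?D x b) < \<epsilon> / ?K"
      unfolding eventually_at by auto
    obtain \<delta>2 where \<delta>2: "\<delta>2 > 0" "ball x \<delta>2 \<subseteq> S" using S openE by blast
    define \<delta> where "\<delta> = min \<delta>1 \<delta>2"
    have \<delta>: "\<delta> > 0" "ball x \<delta> \<subseteq> S" using \<delta>1 \<delta>2 by (auto simp: \<delta>_def)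
    have close: "norm (?D y b - ?D x b) \<le> \<epsilon> / ?K" if "y \<in> ball x \<delta>" "b \<in> B" for y b
    proof (cases "y = x")
      case False
      then show ?thesis using \<delta>1(2)[of y b] that by (auto simp: \<delta>_def dist_commute)
    qed (use \<epsilon> K in auto)
    have lin: "linear (?D y)" if "y \<in> S" for y
      using der[OF that] by (simp add: has_derivative_linear)
    have ball: "norm (?D y v - ?D x v) \<le> \<epsilon> * norm v" if y: "y \<in> ball x \<delta>" for y v
    proof -
      have yS: "y \<in> S" using y \<delta> by auto
      have exp: "?D z v = (\<Sum>b\<in>B. c b v *\<^sub>R ?D z b)" if "z \<in> S" for z
      proof -
        have "?D z v = ?D z (\<Sum>b\<in>B. c b v *\<^sub>R b)" using B(3)[of v] by simp
        then show ?thesis using lin[OF that] by (simp add: linear_sum linear_scale)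
      qed
      have "?D y v - ?D x v = (\<Sum>b\<in>B. c b v *\<^sub>R (?D y b - ?D x b))"
        using exp[OF yS] exp[OF S(2)] by (simp add: sum_subtractf scaleR_right_diff_distrib)
      also have "norm \<dots> \<le> (\<Sum>b\<in>B. norm (c b v *\<^sub>R (?D y b - ?D x b)))" by (rule norm_sum)
      also have "\<dots> \<le> (\<Sum>b\<in>B. (norm v * \<bar>k b\<bar>) * (\<epsilon> / ?K))"
      proof (rule sum_mono)
        fix b assume b: "b \<in> B"
        have "norm (c b v) \<le> norm v * \<bar>k b\<bar>"
          using k[of b v] by (meson abs_ge_self mult_left_mono norm_ge_zero order_trans)
        then show "norm (c b v *\<^sub>R (?D y b - ?D x b)) \<le> (norm v * \<bar>k b\<bar>) * (\<epsilon> / ?K)"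
          using close[OF y b] \<epsilon> K by (simp only: norm_scaleR) (intro mult_mono, auto)
      qed
      also have "\<dots> = norm v * \<epsilon> * ((\<Sum>b\<in>B. \<bar>k b\<bar>) / ?K)"
        by (simp add: sum_distrib_left sum_distrib_right sum_divide_distrib mult_ac)
      also have "\<dots> \<le> norm v * \<epsilon> * 1"
        using K \<epsilon> by (intro mult_left_mono) (auto simp: divide_le_eq)
      finally show ?thesis by (simp add: mult.commute)
    qed
    have "norm (f a - f b - ?D x (a - b)) \<le> \<epsilon> * norm (a - b)" if ab: "a \<in> ball x \<delta>" "b \<in> ball x \<delta>" for a b
    proof -
      let ?g = "\<lambda>z. f z - ?D x z"
      have bl: "bounded_linear (?D x)" using der[OF S(2)] by (rule has_derivative_bounded_linear)
      have "norm (?g a - ?g b) \<le> \<epsilon> * norm (a - b)"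
      proof (rule differentiable_bound[OF convex_ball _ _ ab])
        fix y assume y: "y \<in> ball x \<delta>"
        with \<delta> have "y \<in> S" by auto
        then show "(?g has_derivative (\<lambda>v. ?D y v - ?D x v)) (at y within ball x \<delta>)"
          using der bl by (intro has_derivative_diff bounded_linear_imp_has_derivative)
            (auto intro: has_derivative_at_withinI)
        show "onorm (\<lambda>v. ?D y v - ?D x v) \<le> \<epsilon>"
          using ball[OF y] \<epsilon> by (intro onorm_bound) auto
      qed
      moreover have "?g a - ?g b = f a - f b - ?D x (a - b)"
        using lin[OF S(2)] by (simp add: linear_diff)
      ultimately show ?thesis by simp
    qed
    with \<delta>(1) show ?thesis by blast
  qed
  then show ?thesis
    unfolding has_strict_derivative_def using der[OF S(2)] has_derivative_bounded_linear by blast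
qed

lemma strict_derivative_imp_derivative:
  assumes "has_strict_derivative f f' x"
  shows "(f has_derivative f') (at x)"
  unfolding has_derivative_at_alt
proof (intro conjI allI impI)
  show "bounded_linear f'" using assms by (simp add: has_strict_derivative_def)
  fix \<epsilon> :: real assume "\<epsilon> > 0"
  then obtain \<delta> where \<delta>: "\<delta> > 0" "\<And>a b. a \<in> ball x \<delta> \<Longrightarrow> b \<in> ball x \<delta> \<Longrightarrow>
     norm (f a - f b - f' (a - b)) \<le> \<epsilon> * norm (a - b)" using has_strict_derivativeD[OF assms] by metis
  then show "\<exists>\<delta>>0. \<forall>y. norm (y - x) < \<delta> \<longrightarrow> norm (f y - f x - f' (y - x)) \<le> \<epsilon> * norm (y - x)"
    by (intro exI[of _ \<delta>]) (auto simp: dist_norm norm_minus_commute)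
qed

text \<open>
  The map \<open>u \<mapsto> u - F u + w\<close> is a contraction of the ball to itself.
\<close>

lemma near_identity_solvable:
  fixes F :: "'w::real_normed_vector \<Rightarrow> 'w"
  assumes fin: "finite_dimensional TYPE('w)"
    and F: "\<And>u v. u \<in> cball u0 \<eta> \<Longrightarrow> v \<in> cball u0 \<eta> \<Longrightarrow> norm (F u - F v - (u - v)) \<le> norm (u - v) / 2"
    and w: "2 * norm (w - F u0) \<le> \<eta>"
  shows "\<exists>u\<in>cball u0 \<eta>. F u = w"
proof -
  have \<eta>: "\<eta> \<ge> 0" using w norm_ge_zero[of "w - F u0"] by linarith
  let ?T = "\<lambda>u. u - F u + w"
  have lip: "dist (?T u) (?T v) \<le> 1/2 * dist u v" if "u \<in> cball u0 \<eta>" "v \<in> cball u0 \<eta>" for u v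
  proof -
    have "?T u - ?T v = - (F u - F v - (u - v))" by simp
    then show ?thesis using F[OF that] by (metis dist_norm mult.commute mult_1 norm_minus_cancel times_divide_eq_left)
  qed
  have "?T u \<in> cball u0 \<eta>" if u: "u \<in> cball u0 \<eta>" for u
  proof -
    have "dist (?T u) u0 \<le> dist (?T u) (?T u0) + dist (?T u0) u0" by (rule dist_triangle)
    also have "dist (?T u) (?T u0) \<le> 1/2 * \<eta>" using lip[OF u, of u0] u \<eta> by (auto simp: dist_commute)
    also have "dist (?T u0) u0 \<le> \<eta> / 2" using w by (simp add: dist_norm norm_minus_commute)
    finally show ?thesis by (simp add: dist_commute)
  qed
  then have "\<exists>!u. u \<in> cball u0 \<eta> \<and> ?T u = u"
    using \<eta> lip by (intro Banach_fix[OF finite_dimensional_complete_cball[OF fin], of _ _ "1/2"]) auto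
  then obtain u where u: "u \<in> cball u0 \<eta>" "?T u = u" by blast
  have "F u = w" using u(2) by (simp add: diff_add_eq diff_eq_eq)
  with u(1) show ?thesis by blast
qed

lemma near_identity_dist:
  fixes F :: "'w::real_normed_vector \<Rightarrow> 'w"
  assumes "norm (F u - F v - (u - v)) \<le> norm (u - v) / 2"
  shows "norm (u - v) \<le> 2 * norm (F u - F v)"
proof -
  have "norm (u - v) \<le> norm (F u - F v) + norm (F u - F v - (u - v))"
    using norm_triangle_ineq4[of "F u - F v" "F u - F v - (u - v)"] by simp
  with assms show ?thesis by simp
qed

lemma has_strict_derivative_Lipschitz:
  assumes "has_strict_derivative f f' x"
  obtains \<delta> B where "\<delta> > 0" "B > 0" "\<And>a b. a \<in> ball x \<delta> \<Longrightarrow> b \<in> ball x \<delta> \<Longrightarrow> norm (f a - f b) \<le> B * norm (a - b)"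
proof -
  obtain \<delta> where \<delta>: "\<delta> > 0" "\<And>a b. a \<in> ball x \<delta> \<Longrightarrow> b \<in> ball x \<delta> \<Longrightarrow> norm (f a - f b - f' (a - b)) \<le> 1 * norm (a - b)"
    using has_strict_derivativeD[OF assms, of 1] by auto
  have "bounded_linear f'" using assms by (simp add: has_strict_derivative_def)
  then obtain K where K: "K > 0" "\<And>z. norm (f' z) \<le> norm z * K"
    using bounded_linear.pos_bounded by blast
  have "norm (f a - f b) \<le> (1 + K) * norm (a - b)" if "a \<in> ball x \<delta>" "b \<in> ball x \<delta>" for a b
    using norm_triangle_ineq[of "f a - f b - f' (a - b)" "f' (a - b)"] \<delta>(2)[OF that] K(2)[of "a - b"]
    by (simp add: algebra_simps)
  with \<delta>(1) K(1) show thesis by (intro that[of \<delta> "1 + K"]) auto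
qed

lemma has_strict_derivative_isCont:
  assumes "has_strict_derivative f f' x"
  shows "isCont f x"
  using strict_derivative_imp_derivative[OF assms] has_derivative_continuous by blast

lemma Lipschitz_pair_continuous_on:
  assumes B: "B > 0" and lip: "\<And>y w y' w'. y \<in> A \<Longrightarrow> w \<in> D \<Longrightarrow> y' \<in> A \<Longrightarrow> w' \<in> D \<Longrightarrow>
       norm (C y w - C y' w') \<le> B * (norm (y - y') + norm (w - w'))"
  shows "continuous_on (A \<times> D) (\<lambda>(y, w). C y w)"
proof (rule lipschitz_on_continuous_on, rule lipschitz_onI)
  fix p q assume "p \<in> A \<times> D" "q \<in> A \<times> D"
  then obtain y w y' w' where p: "p = (y, w)" "y \<in> A" "w \<in> D" and q: "q = (y', w')" "y' \<in> A" "w' \<in> D"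
    by (metis mem_Sigma_iff prod.exhaust)
  have "dist y y' + dist w w' \<le> 2 * dist p q"
    using dist_fst_le[of p q] dist_snd_le[of p q] by (simp add: p q)
  then have "B * (dist y y' + dist w w') \<le> B * (2 * dist p q)" using B by (intro mult_left_mono) auto
  then show "dist (case p of (y, w) \<Rightarrow> C y w) (case q of (y, w) \<Rightarrow> C y w) \<le> (2 * B) * dist p q"
    using lip[OF p(2,3) q(2,3)] by (simp add: p q dist_norm)
qed (use B in simp)

text \<open>
  The implicit function theorem as a correction procedure: \<open>C y w\<close> moves \<open>y\<close> to a solution of \<open>F = w\<close> along
  a right inverse \<open>R\<close> of the derivative, by a distance comparable to the error \<open>w - F y\<close>. In particular a
  point that already solves the equation stays where it is.
\<close>

lemma corrector:
  fixes F :: "'a::real_normed_vector \<Rightarrow> 'w::real_normed_vector"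
  assumes fin: "finite_dimensional TYPE('a)"
    and F: "has_strict_derivative F F' y0" and surj: "surj F'"
  obtains C \<rho> L where "\<rho> > 0" "L > 0" "continuous_on (ball y0 \<rho> \<times> ball (F y0) \<rho>) (\<lambda>(y, w). C y w)"
    "\<And>y w. y \<in> ball y0 \<rho> \<Longrightarrow> w \<in> ball (F y0) \<rho> \<Longrightarrow> F (C y w) = w"
    "\<And>y w. y \<in> ball y0 \<rho> \<Longrightarrow> w \<in> ball (F y0) \<rho> \<Longrightarrow> norm (C y w - y) \<le> L * norm (w - F y)"
proof -
  have blF': "bounded_linear F'" using F by (simp add: has_strict_derivative_def)
  then have linF': "linear F'" by (rule bounded_linear.linear)
  have finW: "finite_dimensional TYPE('w)" using finite_dimensional_surj[OF fin linF' surj] .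
  obtain R where R: "linear R" "F' \<circ> R = id"
    using linear_surjective_right_inverse[OF linF' surj] by auto
  have blR: "bounded_linear R" using finite_dimensional_bounded_linear[OF finW R(1)] .
  then obtain K where K: "K > 0" "\<And>u. norm (R u) \<le> norm u * K" using bounded_linear.pos_bounded by blast
  obtain \<delta>1 where \<delta>1: "\<delta>1 > 0" "\<And>a b. a \<in> ball y0 \<delta>1 \<Longrightarrow> b \<in> ball y0 \<delta>1 \<Longrightarrow>
      norm (F a - F b - F' (a - b)) \<le> 1 / (2 * K) * norm (a - b)"
    using has_strict_derivativeD[OF F, of "1 / (2 * K)"] K(1) by auto
  obtain \<delta>2 Q where \<delta>2: "\<delta>2 > 0" and Q: "Q > 0"
    "\<And>a b. a \<in> ball y0 \<delta>2 \<Longrightarrow> b \<in> ball y0 \<delta>2 \<Longrightarrow> norm (F a - F b) \<le> Q * norm (a - b)"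
    using has_strict_derivative_Lipschitz[OF F] by blast
  define \<delta> where "\<delta> = min \<delta>1 \<delta>2"
  define \<eta> where "\<eta> = \<delta> / (4 * K)"
  define \<rho> where "\<rho> = min (\<delta> / 2) (\<eta> / (2 * (1 + Q)))"
  have \<delta>: "\<delta> > 0" "\<eta> > 0" "\<rho> > 0" using \<delta>1 \<delta>2 K Q by (auto simp: \<delta>_def \<eta>_def \<rho>_def)
  have near: "y + R u \<in> ball y0 \<delta>" if "y \<in> ball y0 \<rho>" "u \<in> cball 0 \<eta>" for y u
  proof -
    have "norm (R u) \<le> \<eta> * K" using K(2)[of u] that(2) K(1) by (meson mem_cball_0 mult_right_mono less_imp_le order_trans)
    also have "\<dots> = \<delta> / 4" using K(1) by (simp add: \<eta>_def)
    finally have "norm (R u) \<le> \<delta> / 4" .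
    moreover have "dist y0 y < \<delta> / 2" using that(1) by (simp add: \<rho>_def)
    moreover have "dist y0 (y + R u) \<le> dist y0 y + norm (R u)"
      using dist_triangle[of y0 "y + R u" y] by (simp add: dist_norm)
    ultimately show ?thesis using \<delta>(1) by simp
  qed
  have newton: "norm (F (y + R u) - F (y + R v) - (u - v)) \<le> norm (u - v) / 2"
    if y: "y \<in> ball y0 \<rho>" and uv: "u \<in> cball 0 \<eta>" "v \<in> cball 0 \<eta>" for y u v
  proof -
    have "F' (R (u - v)) = u - v" using R(2) by (metis comp_apply id_apply)
    then have "u - v = F' (y + R u - (y + R v))" using R(1) by (simp add: linear_diff)
    then have "norm (F (y + R u) - F (y + R v) - (u - v)) \<le> 1 / (2 * K) * norm (y + R u - (y + R v))"
      using \<delta>1(2)[of "y + R u" "y + R v"] near[OF y uv(1)] near[OF y uv(2)] by (simp add: \<delta>_def)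
    also have "\<dots> = 1 / (2 * K) * norm (R (u - v))" using R(1) by (simp add: linear_diff)
    also have "\<dots> \<le> 1 / (2 * K) * (norm (u - v) * K)" using K by (intro mult_left_mono) auto
    also have "\<dots> = norm (u - v) / 2" using K(1) by simp
    finally show ?thesis .
  qed
  have small: "2 * norm (w - F y) \<le> \<eta>" if y: "y \<in> ball y0 \<rho>" and w: "w \<in> ball (F y0) \<rho>" for y w
  proof -
    have "y \<in> ball y0 \<delta>2" "y0 \<in> ball y0 \<delta>2" using y \<delta> by (auto simp: \<rho>_def \<delta>_def)
    then have "norm (F y0 - F y) \<le> Q * norm (y0 - y)" using Q(2) by blast
    also have "\<dots> \<le> Q * \<rho>" using y Q(1) by (intro mult_left_mono) (auto simp: dist_norm)
    finally have "norm (F y0 - F y) \<le> Q * \<rho>" .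
    moreover have "norm (w - F y0) \<le> \<rho>" using w by (simp add: dist_norm norm_minus_commute)
    moreover have "norm (w - F y) \<le> norm (w - F y0) + norm (F y0 - F y)"
      using norm_triangle_ineq[of "w - F y0" "F y0 - F y"] by simp
    ultimately have "norm (w - F y) \<le> (1 + Q) * \<rho>" by (simp add: algebra_simps)
    also have "\<dots> \<le> (1 + Q) * (\<eta> / (2 * (1 + Q)))" using Q(1) by (intro mult_left_mono) (auto simp: \<rho>_def)
    also have "\<dots> = \<eta> / 2" using Q(1) by (simp add: field_simps)
    finally show ?thesis by simp
  qed
  have "\<exists>u\<in>cball 0 \<eta>. F (y + R u) = w" if "y \<in> ball y0 \<rho>" "w \<in> ball (F y0) \<rho>" for y w
    using near_identity_solvable[OF finW, of 0 \<eta> "\<lambda>u. F (y + R u)" w] newton[OF that(1)] small[OF that] R(1)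
    by (simp add: linear_0)
  then obtain U where U: "\<And>y w. y \<in> ball y0 \<rho> \<Longrightarrow> w \<in> ball (F y0) \<rho> \<Longrightarrow> U y w \<in> cball 0 \<eta>"
    "\<And>y w. y \<in> ball y0 \<rho> \<Longrightarrow> w \<in> ball (F y0) \<rho> \<Longrightarrow> F (y + R (U y w)) = w" by metis
  define C where "C y w = y + R (U y w)" for y w
  show thesis
  proof (rule that[of \<rho> "2 * K" C])
    show "\<rho> > 0" "2 * K > 0" using \<delta> K(1) by auto
    fix y w assume y: "y \<in> ball y0 \<rho>" and w: "w \<in> ball (F y0) \<rho>"
    show "F (C y w) = w" unfolding C_def using U(2)[OF y w] .
    have "norm (U y w - 0) \<le> 2 * norm (F (y + R (U y w)) - F (y + R 0))"
      using U(1)[OF y w] \<delta>(2) by (intro near_identity_dist newton[OF y]) auto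
    then have "norm (U y w) \<le> 2 * norm (w - F y)" using U(2)[OF y w] R(1) by (simp add: linear_0)
    then have "norm (U y w) * K \<le> 2 * norm (w - F y) * K" using K(1) by (intro mult_right_mono) auto
    then show "norm (C y w - y) \<le> 2 * K * norm (w - F y)"
      using K(2)[of "U y w"] by (simp add: C_def algebra_simps)
  next
    show "continuous_on (ball y0 \<rho> \<times> ball (F y0) \<rho>) (\<lambda>(y, w). C y w)"
    proof (rule Lipschitz_pair_continuous_on[of "1 + K * (2 * (1 + Q))"])
      show "1 + K * (2 * (1 + Q)) > 0" using K(1) Q(1) by (auto intro!: add_pos_pos mult_pos_pos)
      fix y w y' w'
      assume y: "y \<in> ball y0 \<rho>" and w: "w \<in> ball (F y0) \<rho>" and y': "y' \<in> ball y0 \<rho>" and w': "w' \<in> ball (F y0) \<rho>"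
      have "norm (U y w - U y' w') \<le> 2 * norm (F (y + R (U y w)) - F (y + R (U y' w')))"
        using U(1)[OF y w] U(1)[OF y' w'] by (intro near_identity_dist newton[OF y])
      also have "F (y + R (U y w)) - F (y + R (U y' w')) = (w - w') + (F (y' + R (U y' w')) - F (y + R (U y' w')))"
        using U(2)[OF y w] U(2)[OF y' w'] by simp
      also have "norm \<dots> \<le> norm (w - w') + norm (F (y' + R (U y' w')) - F (y + R (U y' w')))"
        by (rule norm_triangle_ineq)
      also have "norm (F (y' + R (U y' w')) - F (y + R (U y' w'))) \<le> Q * norm (y - y')"
        using Q(2)[of "y' + R (U y' w')" "y + R (U y' w')"] near[OF y U(1)[OF y' w']] near[OF y' U(1)[OF y' w']]
        by (simp add: \<delta>_def norm_minus_commute)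
      finally have u: "norm (U y w - U y' w') \<le> 2 * (norm (w - w') + Q * norm (y - y'))" by simp
      have "C y w - C y' w' = (y - y') + R (U y w - U y' w')" using R(1) by (simp add: C_def linear_diff)
      then have "norm (C y w - C y' w') \<le> norm (y - y') + norm (U y w - U y' w') * K"
        using norm_triangle_ineq[of "y - y'" "R (U y w - U y' w')"] K(2)[of "U y w - U y' w'"] by simp
      also have "norm (U y w - U y' w') * K \<le> 2 * (norm (w - w') + Q * norm (y - y')) * K"
        using u K(1) by (intro mult_right_mono) auto
      also have "\<dots> \<le> 2 * ((1 + Q) * (norm (y - y') + norm (w - w'))) * K"
      proof (intro mult_right_mono mult_left_mono)
        show "norm (w - w') + Q * norm (y - y') \<le> (1 + Q) * (norm (y - y') + norm (w - w'))"
          using Q(1) by (simp add: algebra_simps)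
      qed (use K(1) in auto)
      also have "norm (y - y') + 2 * ((1 + Q) * (norm (y - y') + norm (w - w'))) * K
          \<le> (norm (y - y') + norm (w - w')) + 2 * ((1 + Q) * (norm (y - y') + norm (w - w'))) * K" by simp
      also have "\<dots> = (1 + K * (2 * (1 + Q))) * (norm (y - y') + norm (w - w'))"
        by (simp add: algebra_simps)
      finally show "norm (C y w - C y' w') \<le> (1 + K * (2 * (1 + Q))) * (norm (y - y') + norm (w - w'))" by simp
    qed
  qed
qed

text \<open>
  First-order expansion along a direction \<open>v\<close>, uniform in the base point and insensitive to an error \<open>e\<close>
  that is small compared with the step \<open>\<sigma>\<close>. The errors are those made by the corrector.
\<close>

lemma strict_derivative_along:
  assumes f: "has_strict_derivative f f' x" and \<epsilon>: "\<epsilon> > 0"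
  obtains \<delta> where "\<delta> > 0" "\<And>y \<sigma> e. y \<in> ball x \<delta> \<Longrightarrow> 0 \<le> \<sigma> \<Longrightarrow> y + \<sigma> *\<^sub>R v + e \<in> ball x \<delta> \<Longrightarrow> norm e \<le> \<delta> * \<sigma> \<Longrightarrow>
     norm (f (y + \<sigma> *\<^sub>R v + e) - f y - \<sigma> *\<^sub>R f' v) \<le> \<epsilon> * \<sigma>"
proof -
  have bl: "bounded_linear f'" using f by (simp add: has_strict_derivative_def)
  then obtain K where K: "K > 0" "\<And>z. norm (f' z) \<le> norm z * K" using bounded_linear.pos_bounded by blast
  define \<epsilon>1 where "\<epsilon>1 = \<epsilon> / (2 * (norm v + 1))"
  have \<epsilon>1: "\<epsilon>1 > 0" using \<epsilon> by (auto simp: \<epsilon>1_def intro!: divide_pos_pos mult_pos_pos add_nonneg_pos)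
  obtain \<delta>1 where \<delta>1: "\<delta>1 > 0" "\<And>a b. a \<in> ball x \<delta>1 \<Longrightarrow> b \<in> ball x \<delta>1 \<Longrightarrow>
      norm (f a - f b - f' (a - b)) \<le> \<epsilon>1 * norm (a - b)"
    using has_strict_derivativeD[OF f \<epsilon>1] by blast
  define \<delta> where "\<delta> = Min {\<delta>1, 1, \<epsilon> / (2 * K)}"
  have \<delta>: "\<delta> > 0" "\<delta> \<le> \<delta>1" "\<delta> \<le> 1" "\<delta> * K \<le> \<epsilon> / 2"
  proof -
    show "\<delta> > 0" "\<delta> \<le> \<delta>1" "\<delta> \<le> 1" using \<delta>1 \<epsilon> K by (auto simp: \<delta>_def)
    have "\<delta> \<le> \<epsilon> / (2 * K)" by (simp add: \<delta>_def)
    then show "\<delta> * K \<le> \<epsilon> / 2" using K(1) by (simp add: field_simps)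
  qed
  have "norm (f (y + \<sigma> *\<^sub>R v + e) - f y - \<sigma> *\<^sub>R f' v) \<le> \<epsilon> * \<sigma>"
    if "y \<in> ball x \<delta>" "0 \<le> \<sigma>" "y + \<sigma> *\<^sub>R v + e \<in> ball x \<delta>" "norm e \<le> \<delta> * \<sigma>" for y \<sigma> e
  proof -
    let ?z = "y + \<sigma> *\<^sub>R v + e"
    have lin: "f' (?z - y) = \<sigma> *\<^sub>R f' v + f' e"
      using bounded_linear.linear[OF bl] by (simp add: linear_add linear_scale)
    have "norm e \<le> 1 * \<sigma>" using that(4) \<delta>(3) mult_right_mono[OF \<delta>(3) that(2)] by linarith
    then have "norm (?z - y) \<le> \<sigma> * (norm v + 1)"
      using norm_triangle_ineq[of "\<sigma> *\<^sub>R v" e] that(2) by (simp add: algebra_simps)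
    then have "\<epsilon>1 * norm (?z - y) \<le> \<epsilon>1 * (\<sigma> * (norm v + 1))"
      using \<epsilon>1 by (intro mult_left_mono) auto
    also have "\<dots> = \<epsilon> * \<sigma> / 2" 
      using norm_ge_zero[of v] by (simp add: \<epsilon>1_def field_simps add_nonneg_eq_0_iff)
    finally have 1: "norm (f ?z - f y - f' (?z - y)) \<le> \<epsilon> * \<sigma> / 2"
      using \<delta>1(2)[of ?z y] that(1,3) \<delta>(2) by auto
    have "norm (f' e) \<le> \<delta> * \<sigma> * K" using K that(4) by (meson mult_right_mono less_imp_le order_trans)
    also have "\<dots> \<le> \<epsilon> / 2 * \<sigma>" using mult_right_mono[OF \<delta>(4) that(2)] by (simp add: mult_ac)
    finally have 2: "norm (f' e) \<le> \<epsilon> * \<sigma> / 2" by simp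
    have "f ?z - f y - \<sigma> *\<^sub>R f' v = (f ?z - f y - f' (?z - y)) + f' e" unfolding lin by simp
    then have "norm (f ?z - f y - \<sigma> *\<^sub>R f' v) \<le> norm (f ?z - f y - f' (?z - y)) + norm (f' e)"
      by (metis norm_triangle_ineq)
    with 1 2 show ?thesis by simp
  qed
  with \<delta>(1) show thesis using that by blast
qed

text \<open>
  A deformation of the fibre of \<open>F\<close> through \<open>y0\<close> within a ball of radius \<open>r\<close>, supported in the smaller ball
  of radius \<open>r'\<close>. The formula for \<open>h\<close> is continuous on the whole ball, also off the fibre.
\<close>

definition local_push ::
    "('a::real_normed_vector \<Rightarrow> 'w) \<Rightarrow> 'a \<Rightarrow> real \<Rightarrow> real \<Rightarrow> (real \<Rightarrow> 'a \<Rightarrow> 'a) \<Rightarrow> bool" where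
  "local_push F y0 r r' h \<longleftrightarrow>
     continuous_on ({0..1} \<times> cball y0 r) (\<lambda>(t, y). h t y) \<and>
     (\<forall>y\<in>cball y0 r. F y = F y0 \<longrightarrow> h 0 y = y \<and>
        (\<forall>t\<in>{0..1}. F (h t y) = F y0 \<and> h t y \<in> cball y0 r \<and> (r' \<le> dist y0 y \<longrightarrow> h t y = y)))"

text \<open>
  Away from the zeros of \<open>s\<close>: step from \<open>y\<close> by \<open>\<sigma> v\<close> and correct back to the fibre of \<open>F\<close>. As \<open>v\<close> is tangent to
  the fibre, the correction is of smaller order than \<open>\<sigma>\<close>. To first order \<open>m\<close> decreases and \<open>s\<close> is multiplied
  by \<open>1 - \<sigma> d\<close>, so \<open>m\<close> and the norm of \<open>s\<close> decrease strictly wherever the step is positive.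
\<close>

lemma push_down:
  fixes F :: "'a::real_normed_vector \<Rightarrow> 'w::real_normed_vector" and s :: "'a \<Rightarrow> 'v::real_normed_vector"
    and m :: "'a \<Rightarrow> real"
  assumes fin: "finite_dimensional TYPE('a)"
    and F: "has_strict_derivative F F' y0" "surj F'" and m: "has_strict_derivative m m' y0"
    and s: "has_strict_derivative s s' y0"
    and v: "F' v = 0" "m' v < 0" "s' v = - (d *\<^sub>R s y0)" and d: "d > 0" "s y0 \<noteq> 0"
  obtains r0 where "r0 > 0"
    "\<And>r. 0 < r \<Longrightarrow> r \<le> r0 \<Longrightarrow> \<exists>h. local_push F y0 r (r / 2) h \<and>
       (\<forall>y\<in>ball y0 (r / 2). F y = F y0 \<longrightarrow> m (h 1 y) < m y \<and> norm (s (h 1 y)) < norm (s y))"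
proof -
  obtain C \<rho> L where \<rho>: "\<rho> > 0" and L: "L > 0"
    and C_cont: "continuous_on (ball y0 \<rho> \<times> ball (F y0) \<rho>) (\<lambda>(y, w). C y w)"
    and C: "\<And>y w. y \<in> ball y0 \<rho> \<Longrightarrow> w \<in> ball (F y0) \<rho> \<Longrightarrow> F (C y w) = w"
    "\<And>y w. y \<in> ball y0 \<rho> \<Longrightarrow> w \<in> ball (F y0) \<rho> \<Longrightarrow> norm (C y w - y) \<le> L * norm (w - F y)"
    by (rule corrector[OF fin F]) (rule that; assumption)
  define \<kappa> where "\<kappa> = min (- m' v / 2) (d * norm (s y0) / 4)"
  have \<kappa>: "\<kappa> > 0" using v d by (simp add: \<kappa>_def)
  obtain \<delta>m where \<delta>m: "\<delta>m > 0" "\<And>y \<sigma> e. y \<in> ball y0 \<delta>m \<Longrightarrow> 0 \<le> \<sigma> \<Longrightarrow> y + \<sigma> *\<^sub>R v + e \<in> ball y0 \<delta>m \<Longrightarrow> norm e \<le> \<delta>m * \<sigma> \<Longrightarrow>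
     norm (m (y + \<sigma> *\<^sub>R v + e) - m y - \<sigma> *\<^sub>R m' v) \<le> \<kappa> * \<sigma>"
    by (rule strict_derivative_along[OF m \<kappa>]) (rule that; assumption)
  obtain \<delta>s where \<delta>s: "\<delta>s > 0" "\<And>y \<sigma> e. y \<in> ball y0 \<delta>s \<Longrightarrow> 0 \<le> \<sigma> \<Longrightarrow> y + \<sigma> *\<^sub>R v + e \<in> ball y0 \<delta>s \<Longrightarrow> norm e \<le> \<delta>s * \<sigma> \<Longrightarrow>
     norm (s (y + \<sigma> *\<^sub>R v + e) - s y - \<sigma> *\<^sub>R s' v) \<le> \<kappa> * \<sigma>"
    by (rule strict_derivative_along[OF s \<kappa>]) (rule that; assumption)
  define \<epsilon> where "\<epsilon> = Min {\<delta>m, \<delta>s, 1}"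
  have \<epsilon>: "\<epsilon> > 0" "\<epsilon> \<le> \<delta>m" "\<epsilon> \<le> \<delta>s" "\<epsilon> \<le> 1" using \<delta>m \<delta>s by (auto simp: \<epsilon>_def)
  have \<epsilon>L: "\<epsilon> / L > 0" using \<epsilon> L by simp
  obtain \<delta>F where \<delta>F: "\<delta>F > 0" "\<And>y \<sigma> e. y \<in> ball y0 \<delta>F \<Longrightarrow> 0 \<le> \<sigma> \<Longrightarrow> y + \<sigma> *\<^sub>R v + e \<in> ball y0 \<delta>F \<Longrightarrow> norm e \<le> \<delta>F * \<sigma> \<Longrightarrow>
     norm (F (y + \<sigma> *\<^sub>R v + e) - F y - \<sigma> *\<^sub>R F' v) \<le> \<epsilon> / L * \<sigma>"
    by (rule strict_derivative_along[OF F(1) \<epsilon>L]) (rule that; assumption)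
  have "isCont s y0" using s by (rule has_strict_derivative_isCont)
  then obtain \<delta>c where \<delta>c: "\<delta>c > 0" "\<And>y. dist y y0 < \<delta>c \<Longrightarrow> dist (s y) (s y0) < norm (s y0) / 4"
    unfolding continuous_at_eps_delta using d(2) by (metis divide_pos_pos zero_less_norm_iff zero_less_numeral)
  define r0 where "r0 = Min {\<rho>, \<delta>m, \<delta>s, \<delta>F, \<delta>c, 1 / d} / 3"
  have r0: "r0 > 0" "3 * r0 \<le> \<rho>" "3 * r0 \<le> \<delta>m" "3 * r0 \<le> \<delta>s" "3 * r0 \<le> \<delta>F" "3 * r0 \<le> \<delta>c" "3 * r0 \<le> 1 / d"
    using \<rho> \<delta>m \<delta>s \<delta>F \<delta>c d by (auto simp: r0_def)
  define \<theta> where "\<theta> = 1 / (norm v + 1)"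
  have "norm v + 1 > 0" using norm_ge_zero[of v] by linarith
  then have \<theta>: "\<theta> > 0" "\<theta> * (norm v + 1) = 1" by (auto simp: \<theta>_def)
  show thesis
  proof (rule that[OF r0(1)])
    fix r :: real assume r: "0 < r" "r \<le> r0"
    \<comment> \<open>The step length is cut off so that a point within \<open>r / 2\<close> of \<open>y0\<close> never leaves the ball.\<close>
    define \<sigma> where "\<sigma> t y = t * (\<theta> * max 0 (r / 2 - dist y0 y))" for t y
    define h where "h t y = C (y + \<sigma> t y *\<^sub>R v) (F y0)" for t y
    have \<sigma>: "0 \<le> \<sigma> t y" "\<sigma> t y * (norm v + 1) \<le> max 0 (r / 2 - dist y0 y)" if "t \<in> {0..1}" for t y
    proof -
      show "0 \<le> \<sigma> t y" using that \<theta>(1) by (simp add: \<sigma>_def)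
      have "\<sigma> t y * (norm v + 1) = t * max 0 (r / 2 - dist y0 y) * (\<theta> * (norm v + 1))" by (simp add: \<sigma>_def)
      also have "\<dots> \<le> max 0 (r / 2 - dist y0 y)"
        unfolding \<theta>(2) using that by (auto intro: mult_left_le_one_le)
      finally show "\<sigma> t y * (norm v + 1) \<le> max 0 (r / 2 - dist y0 y)" .
    qed
    have moved: "y + \<sigma> t y *\<^sub>R v \<in> cball y0 r" if "t \<in> {0..1}" "y \<in> cball y0 r" for t y
    proof -
      have "dist y0 (y + \<sigma> t y *\<^sub>R v) \<le> dist y0 y + \<sigma> t y * norm v"
        using dist_triangle[of y0 "y + \<sigma> t y *\<^sub>R v" y] \<sigma>(1)[OF that(1)] by (simp add: dist_norm)
      also have "\<sigma> t y * norm v \<le> max 0 (r / 2 - dist y0 y)"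
        using \<sigma>[OF that(1), of y] by (simp add: algebra_simps)
      finally show ?thesis using that(2) r(1) by (auto simp: max_def split: if_splits)
    qed
    have inball: "z \<in> ball y0 \<rho>" "z \<in> ball y0 \<delta>m" "z \<in> ball y0 \<delta>s" "z \<in> ball y0 \<delta>F" "dist z y0 < \<delta>c" if "z \<in> cball y0 r" for z
      using that r r0 by (auto simp: dist_commute)
    have C0: "F y0 \<in> ball (F y0) \<rho>" using \<rho> by simp
    have cont: "continuous_on ({0..1} \<times> cball y0 r) (\<lambda>(t, y). h t y)"
    proof -
      have "continuous_on ({0..1} \<times> cball y0 r) (\<lambda>p. (snd p + \<sigma> (fst p) (snd p) *\<^sub>R v, F y0))"
        unfolding \<sigma>_def by (intro continuous_intros)
      moreover have "(\<lambda>p. (snd p + \<sigma> (fst p) (snd p) *\<^sub>R v, F y0)) ` ({0..1} \<times> cball y0 r) \<subseteq> ball y0 \<rho> \<times> ball (F y0) \<rho>"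
        using moved inball(1) C0 by auto
      ultimately have "continuous_on ({0..1} \<times> cball y0 r)
          (\<lambda>p. case (snd p + \<sigma> (fst p) (snd p) *\<^sub>R v, F y0) of (y, w) \<Rightarrow> C y w)"
        by (rule continuous_on_compose2[OF C_cont])
      then show ?thesis by (simp add: h_def case_prod_unfold)
    qed
    have main: "(h 0 y = y \<and> (\<forall>t\<in>{0..1}. F (h t y) = F y0 \<and> h t y \<in> cball y0 r \<and> (r / 2 \<le> dist y0 y \<longrightarrow> h t y = y))) \<and>
          (dist y0 y < r / 2 \<longrightarrow> m (h 1 y) < m y \<and> norm (s (h 1 y)) < norm (s y))"
      if y: "y \<in> cball y0 r" and Fy: "F y = F y0" for y
    proof -
      have fixed: "h t y = y" if "\<sigma> t y = 0" for t
        using C(2)[OF inball(1)[OF y] C0] that Fy by (simp add: h_def)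
      have h: "F (h t y) = F y0" "norm (h t y - (y + \<sigma> t y *\<^sub>R v)) \<le> \<epsilon> * \<sigma> t y" "h t y \<in> cball y0 r"
        if t: "t \<in> {0..1}" for t
      proof -
        let ?y = "y + \<sigma> t y *\<^sub>R v"
        note y' = moved[OF t y]
        show "F (h t y) = F y0" unfolding h_def using C(1)[OF inball(1)[OF y'] C0] .
        have "norm (F ?y - F y0) \<le> \<epsilon> / L * \<sigma> t y"
          using \<delta>F(2)[of y "\<sigma> t y" 0] inball(4)[OF y] inball(4)[OF y'] \<sigma>(1)[OF t] \<delta>F(1) v(1) Fy by simp
        then have "L * norm (F y0 - F ?y) \<le> L * (\<epsilon> / L * \<sigma> t y)"
          using L by (intro mult_left_mono) (auto simp: norm_minus_commute)
        then show e: "norm (h t y - ?y) \<le> \<epsilon> * \<sigma> t y"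
          using C(2)[OF inball(1)[OF y'] C0] L by (simp add: h_def)
        have "\<epsilon> * \<sigma> t y \<le> \<sigma> t y" using \<epsilon>(4) \<sigma>(1)[OF t] by (simp add: mult_left_le_one_le \<epsilon>(1) less_imp_le)
        moreover have "dist y0 (h t y) \<le> dist y0 y + (\<sigma> t y * norm v + norm (h t y - ?y))"
        proof -
          have "h t y - y0 = (y - y0) + (\<sigma> t y *\<^sub>R v + (h t y - ?y))" by simp
          then have "norm (h t y - y0) \<le> norm (y - y0) + (norm (\<sigma> t y *\<^sub>R v) + norm (h t y - ?y))"
            by (metis norm_triangle_ineq norm_triangle_le add_left_mono order_trans)
          then show ?thesis using \<sigma>(1)[OF t] by (simp add: dist_norm norm_minus_commute)
        qed
        ultimately have "dist y0 (h t y) \<le> dist y0 y + \<sigma> t y * (norm v + 1)" using e by (simp add: algebra_simps)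
        then show "h t y \<in> cball y0 r" using \<sigma>(2)[OF t, of y] y r(1) by (auto simp: max_def split: if_splits)
      qed
      have "m (h 1 y) < m y \<and> norm (s (h 1 y)) < norm (s y)" if near: "dist y0 y < r / 2"
      proof -
        let ?\<sigma> = "\<sigma> 1 y" and ?e = "h 1 y - (y + \<sigma> 1 y *\<^sub>R v)"
        have one: "(1::real) \<in> {0..1}" by simp
        have pos: "?\<sigma> > 0" using near \<theta>(1) by (simp add: \<sigma>_def)
        have "?\<sigma> \<le> max 0 (r / 2 - dist y0 y)"
        proof -
          have "?\<sigma> * 1 \<le> ?\<sigma> * (norm v + 1)" using pos by (intro mult_left_mono) auto
          then show ?thesis using \<sigma>(2)[OF one, of y] by linarith
        qed
        also have "\<dots> \<le> r" using r(1) zero_le_dist[of y0 y] by linarith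
        also have "r \<le> 1 / d" using r(2) r0(1,7) by linarith
        finally have \<sigma>d: "?\<sigma> * d \<le> 1" using d(1) by (simp add: field_simps)
        have "\<epsilon> * ?\<sigma> \<le> \<delta>m * ?\<sigma>" "\<epsilon> * ?\<sigma> \<le> \<delta>s * ?\<sigma>" using \<epsilon> pos by (auto intro: mult_right_mono)
        then have e: "norm ?e \<le> \<delta>m * ?\<sigma>" "norm ?e \<le> \<delta>s * ?\<sigma>" using h(2)[OF one] by linarith+
        have "norm (m (h 1 y) - m y - ?\<sigma> *\<^sub>R m' v) \<le> \<kappa> * ?\<sigma>"
          using \<delta>m(2)[of y ?\<sigma> ?e] inball(2)[OF y] inball(2)[OF h(3)[OF one]] pos e(1) by simp
        then have "m (h 1 y) \<le> m y + ?\<sigma> * (m' v + \<kappa>)" by (simp add: algebra_simps abs_le_iff)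
        moreover have "?\<sigma> * (m' v + \<kappa>) < 0"
          using pos v(2) by (intro mult_pos_neg) (auto simp: \<kappa>_def min_def)
        ultimately have 1: "m (h 1 y) < m y" by linarith
        have "norm (s (h 1 y) - s y - ?\<sigma> *\<^sub>R s' v) \<le> \<kappa> * ?\<sigma>"
          using \<delta>s(2)[of y ?\<sigma> ?e] inball(3)[OF y] inball(3)[OF h(3)[OF one]] pos e(2) by simp
        then have s1: "norm (s (h 1 y) - s y + (?\<sigma> * d) *\<^sub>R s y0) \<le> \<kappa> * ?\<sigma>"
          by (simp add: v(3))
        have sy: "norm (s y - s y0) \<le> norm (s y0) / 4" using \<delta>c(2)[OF inball(5)[OF y]] by (simp add: dist_norm)
        have "s (h 1 y) = (1 - ?\<sigma> * d) *\<^sub>R s y + ((?\<sigma> * d) *\<^sub>R (s y - s y0) + (s (h 1 y) - s y + (?\<sigma> * d) *\<^sub>R s y0))"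
          by (simp add: algebra_simps)
        then have "norm (s (h 1 y)) \<le> norm ((1 - ?\<sigma> * d) *\<^sub>R s y) + (norm ((?\<sigma> * d) *\<^sub>R (s y - s y0)) + norm (s (h 1 y) - s y + (?\<sigma> * d) *\<^sub>R s y0))"
          by (metis norm_triangle_ineq add_left_mono order_trans)
        also have "norm ((1 - ?\<sigma> * d) *\<^sub>R s y) = (1 - ?\<sigma> * d) * norm (s y)" using \<sigma>d by simp
        also have "norm ((?\<sigma> * d) *\<^sub>R (s y - s y0)) = (?\<sigma> * d) * norm (s y - s y0)" using pos d(1) by simp
        finally have "norm (s (h 1 y)) \<le> (1 - ?\<sigma> * d) * norm (s y) + ((?\<sigma> * d) * norm (s y - s y0) + \<kappa> * ?\<sigma>)"
          using s1 by linarith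
        also have "(?\<sigma> * d) * norm (s y - s y0) \<le> (?\<sigma> * d) * (norm (s y0) / 4)"
          using sy pos d(1) by (intro mult_left_mono) auto
        also have "\<kappa> * ?\<sigma> \<le> (d * norm (s y0) / 4) * ?\<sigma>" using pos by (intro mult_right_mono) (auto simp: \<kappa>_def)
        finally have "norm (s (h 1 y)) \<le> norm (s y) - (?\<sigma> * d) * (norm (s y) - norm (s y0) / 2)"
          by (simp add: algebra_simps)
        moreover have "norm (s y) - norm (s y0) / 2 > 0"
        proof -
          have "norm (s y0) \<le> norm (s y) + norm (s y - s y0)"
            using norm_triangle_sub[of "s y0" "s y"] by (simp add: norm_minus_commute)
          then show ?thesis using sy d(2) zero_less_norm_iff[of "s y0"] by linarith
        qed
        then have "(?\<sigma> * d) * (norm (s y) - norm (s y0) / 2) > 0" using pos d(1) by (intro mult_pos_pos) auto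
        ultimately have 2: "norm (s (h 1 y)) < norm (s y)" by linarith
        from 1 2 show ?thesis by blast
      qed
      moreover have "h 0 y = y" by (rule fixed) (simp add: \<sigma>_def)
      moreover have "h t y = y" if "dist y0 y \<ge> r / 2" for t
        by (rule fixed) (use that in \<open>simp add: \<sigma>_def\<close>)
      ultimately show ?thesis using h by blast
    qed
    have "local_push F y0 r (r / 2) h" unfolding local_push_def using cont main by blast
    moreover have "m (h 1 y) < m y \<and> norm (s (h 1 y)) < norm (s y)" if "y \<in> ball y0 (r / 2)" "F y = F y0" for y
      using main[of y] that r(1) by auto
    ultimately show "\<exists>h. local_push F y0 r (r / 2) h \<and>
       (\<forall>y\<in>ball y0 (r / 2). F y = F y0 \<longrightarrow> m (h 1 y) < m y \<and> norm (s (h 1 y)) < norm (s y))"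
      by blast
  qed
qed

text \<open>
  At a zero of \<open>s\<close> that is regular relative to \<open>F\<close>: correct \<open>y\<close> to the solution of the system \<open>F = F y0\<close>,
  \<open>s = (1 - t p y) s y\<close>, where the cut-off \<open>p\<close> is \<open>1\<close> near \<open>y0\<close>. A zero of \<open>s\<close> solves it already and rests.
\<close>

lemma push_in:
  fixes F :: "'a::real_normed_vector \<Rightarrow> 'w::real_normed_vector" and s :: "'a \<Rightarrow> 'v::real_normed_vector"
  assumes fin: "finite_dimensional TYPE('a)"
    and Fs: "has_strict_derivative (\<lambda>y. (F y, s y)) Fs' y0" "surj Fs'" and s0: "s y0 = 0"
  obtains r0 where "r0 > 0"
    "\<And>r. 0 < r \<Longrightarrow> r \<le> r0 \<Longrightarrow> \<exists>h r'. 0 < r' \<and> r' \<le> r / 2 \<and> local_push F y0 r r' h \<and>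
       (\<forall>t\<in>{0..1}. \<forall>y\<in>cball y0 r. F y = F y0 \<and> s y = 0 \<longrightarrow> h t y = y) \<and>
       (\<forall>y\<in>ball y0 (r' / 2). F y = F y0 \<longrightarrow> s (h 1 y) = 0)"
proof -
  let ?F = "\<lambda>y. (F y, s y)"
  obtain C \<rho> L where \<rho>: "\<rho> > 0" and L: "L > 0"
    and C_cont: "continuous_on (ball y0 \<rho> \<times> ball (?F y0) \<rho>) (\<lambda>(y, w). C y w)"
    and C: "\<And>y w. y \<in> ball y0 \<rho> \<Longrightarrow> w \<in> ball (?F y0) \<rho> \<Longrightarrow> ?F (C y w) = w"
    "\<And>y w. y \<in> ball y0 \<rho> \<Longrightarrow> w \<in> ball (?F y0) \<rho> \<Longrightarrow> norm (C y w - y) \<le> L * norm (w - ?F y)"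
    by (rule corrector[OF fin Fs]) (rule that; assumption)
  obtain \<delta>1 Q where \<delta>1: "\<delta>1 > 0" and Q: "Q > 0"
    and F_lip: "\<And>a b. a \<in> ball y0 \<delta>1 \<Longrightarrow> b \<in> ball y0 \<delta>1 \<Longrightarrow> norm (?F a - ?F b) \<le> Q * norm (a - b)"
    by (rule has_strict_derivative_Lipschitz[OF Fs(1)]) (rule that; assumption)
  have s_lip: "norm (s a - s b) \<le> Q * norm (a - b)" if "a \<in> ball y0 \<delta>1" "b \<in> ball y0 \<delta>1" for a b
    using F_lip[OF that] norm_snd_le[of "s a - s b" "F a - F b"] by simp
  define r0 where "r0 = Min {\<rho>, \<delta>1, \<rho> / Q} / 2"
  have r0: "r0 > 0" "2 * r0 \<le> \<rho>" "2 * r0 \<le> \<delta>1" "2 * r0 \<le> \<rho> / Q" using \<rho> \<delta>1 Q by (auto simp: r0_def)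
  show thesis
  proof (rule that[OF r0(1)])
    fix r :: real assume r: "0 < r" "r \<le> r0"
    \<comment> \<open>Points within \<open>r'\<close> of \<open>y0\<close> have \<open>norm (s y) \<le> Q r'\<close> and move by at most \<open>L Q r' \<le> r / 2\<close>.\<close>
    define r' where "r' = min (r / 2) (r / (2 * L * Q))"
    have r': "0 < r'" "r' \<le> r / 2" "L * (Q * r') \<le> r / 2"
    proof -
      show "0 < r'" "r' \<le> r / 2" using r L Q by (auto simp: r'_def)
      have "r' \<le> r / (2 * L * Q)" by (simp add: r'_def)
      then show "L * (Q * r') \<le> r / 2" using L Q by (simp add: field_simps)
    qed
    define p where "p y = max 0 (min 1 (2 - 2 * dist y0 y / r'))" for y
    have p: "0 \<le> p y" "p y \<le> 1" for y by (auto simp: p_def)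
    define w where "w t y = (F y0, (1 - t * p y) *\<^sub>R s y)" for t y
    define h where "h t y = C y (w t y)" for t y
    have inball: "y \<in> ball y0 \<rho>" "y \<in> ball y0 \<delta>1" if "y \<in> cball y0 r" for y using that r r0 by auto
    have y0: "y0 \<in> ball y0 \<delta>1" using \<delta>1 by simp
    have s_small: "norm (s y) \<le> Q * dist y0 y" if "y \<in> cball y0 r" for y
      using s_lip[OF inball(2)[OF that] y0] s0 by (simp add: dist_norm norm_minus_commute)
    have w_in: "w t y \<in> ball (?F y0) \<rho>" if "t \<in> {0..1}" "y \<in> cball y0 r" for t y
    proof -
      have "\<bar>1 - t * p y\<bar> \<le> 1" using that(1) p[of y] mult_le_one[of t "p y"] by (auto simp: abs_le_iff)
      then have "norm ((1 - t * p y) *\<^sub>R s y) \<le> norm (s y)" by (simp add: mult_left_le_one_le)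
      also have "\<dots> \<le> Q * dist y0 y" using that(2) by (rule s_small)
      also have "\<dots> \<le> Q * r" using that(2) Q by (intro mult_left_mono) auto
      also have "\<dots> < \<rho>" 
      proof -
        have "r < \<rho> / Q" using r r0 by linarith
        then show ?thesis using Q by (simp add: field_simps)
      qed
      finally show ?thesis by (simp add: w_def s0 dist_Pair_Pair)
    qed
    have cont_s: "continuous_on (cball y0 r) s"
      using lipschitz_on_continuous_on[of Q "cball y0 r" s] s_lip inball(2) Q
      by (simp add: lipschitz_on_def dist_norm)
    have cont: "continuous_on ({0..1} \<times> cball y0 r) (\<lambda>(t, y). h t y)"
    proof -
      have cs: "continuous_on ({0..1} \<times> cball y0 r) (\<lambda>q. s (snd q))"
        by (rule continuous_on_compose2[OF cont_s]) (auto intro: continuous_intros)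
      have "continuous_on ({0..1} \<times> cball y0 r) (\<lambda>q. (snd q, w (fst q) (snd q)))"
        unfolding w_def p_def using r'(1) by (intro continuous_intros cs) auto
      moreover have "(\<lambda>q. (snd q, w (fst q) (snd q))) ` ({0..1} \<times> cball y0 r) \<subseteq> ball y0 \<rho> \<times> ball (?F y0) \<rho>"
        using inball(1) w_in by auto
      ultimately have "continuous_on ({0..1} \<times> cball y0 r) (\<lambda>q. case (snd q, w (fst q) (snd q)) of (y, w) \<Rightarrow> C y w)"
        by (rule continuous_on_compose2[OF C_cont])
      then show ?thesis by (simp add: h_def case_prod_unfold)
    qed
    have main: "(h 0 y = y \<and> (\<forall>t\<in>{0..1}. F (h t y) = F y0 \<and> h t y \<in> cball y0 r \<and> (r' \<le> dist y0 y \<longrightarrow> h t y = y))) \<and>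
          (\<forall>t\<in>{0..1}. s y = 0 \<longrightarrow> h t y = y) \<and> (dist y0 y < r' / 2 \<longrightarrow> s (h 1 y) = 0)"
      if y: "y \<in> cball y0 r" and Fy: "F y = F y0" for y
    proof -
      have hC: "?F (h t y) = w t y" "norm (h t y - y) \<le> L * norm (w t y - ?F y)" if "t \<in> {0..1}" for t
        unfolding h_def using C[OF inball(1)[OF y] w_in[OF that y]] by auto
      have diff: "w t y - ?F y = (0, - (t * p y) *\<^sub>R s y)" for t
        using Fy by (simp add: w_def algebra_simps)
      have fixed: "h t y = y" if "t \<in> {0..1}" "t * p y = 0 \<or> s y = 0" for t
        using hC(2)[OF that(1)] that(2) unfolding diff by auto
      have far: "h t y = y" if "t \<in> {0..1}" "dist y0 y \<ge> r'" for t
      proof (rule fixed[OF that(1)])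
        have "2 * dist y0 y / r' \<ge> 2" using that(2) r'(1) by (simp add: field_simps)
        then show "t * p y = 0 \<or> s y = 0" by (simp add: p_def)
      qed
      have stay: "h t y \<in> cball y0 r" if t: "t \<in> {0..1}" for t
      proof (cases "dist y0 y \<ge> r'")
        case True
        then show ?thesis using far[OF t] y by simp
      next
        case False
        have tp: "0 \<le> t * p y" "t * p y \<le> 1" using t p[of y] mult_le_one[of t "p y"] by auto
        have "norm (w t y - ?F y) \<le> norm (s y)"
          unfolding diff using tp by (simp add: norm_Pair mult_left_le_one_le)
        also have "\<dots> \<le> Q * dist y0 y" using s_small[OF y] .
        also have "\<dots> \<le> Q * r'" using False Q by (intro mult_left_mono) auto
        finally have "L * norm (w t y - ?F y) \<le> L * (Q * r')" using L by (intro mult_left_mono) auto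
        with hC(2)[OF t] r'(3) have "norm (h t y - y) \<le> r / 2" by linarith
        moreover have "dist y0 (h t y) \<le> dist y0 y + norm (h t y - y)"
          using dist_triangle[of y0 "h t y" y] by (simp add: dist_norm norm_minus_commute)
        ultimately show ?thesis using False r'(2) by simp
      qed
      have "s (h 1 y) = 0" if "dist y0 y < r' / 2"
      proof -
        have "2 * dist y0 y / r' < 1" using that r'(1) by (simp add: field_simps)
        then have "p y = 1" by (simp add: p_def)
        then show ?thesis using hC(1)[of 1] by (simp add: w_def)
      qed
      moreover have "F (h t y) = F y0" if "t \<in> {0..1}" for t using hC(1)[OF that] by (simp add: w_def)
      moreover have "h 0 y = y" by (rule fixed) auto
      ultimately show ?thesis using far stay fixed by blast
    qed
    have "local_push F y0 r r' h" unfolding local_push_def using cont main by blast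
    moreover have "s (h 1 y) = 0" if "y \<in> ball y0 (r' / 2)" "F y = F y0" for y
      using main[of y] that r(1) r'(2) by auto
    ultimately show "\<exists>h r'. 0 < r' \<and> r' \<le> r / 2 \<and> local_push F y0 r r' h \<and>
       (\<forall>t\<in>{0..1}. \<forall>y\<in>cball y0 r. F y = F y0 \<and> s y = 0 \<longrightarrow> h t y = y) \<and>
       (\<forall>y\<in>ball y0 (r' / 2). F y = F y0 \<longrightarrow> s (h 1 y) = 0)"
      using r'(1,2) main by blast
  qed
qed

lemma has_derivative_eventually_eq:
  assumes "(f has_derivative f') (at x)" "\<forall>\<^sub>F y in nhds x. f y = g y"
  shows "(g has_derivative f') (at x)"
  using has_derivative_transform_eventually[OF assms(1), of g] assms(2) eventually_nhds_x_imp_x[OF assms(2)]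
  by (simp add: eventually_at_filter eventually_mono)

lemma has_strict_derivative_bounded_linear:
  assumes f: "has_strict_derivative f f' x" and L: "bounded_linear L"
  shows "has_strict_derivative (\<lambda>y. L (f y)) (\<lambda>v. L (f' v)) x"
  unfolding has_strict_derivative_def
proof (intro conjI allI impI)
  have "bounded_linear f'" using f by (simp add: has_strict_derivative_def)
  with L show "bounded_linear (\<lambda>v. L (f' v))" by (rule bounded_linear_compose)
  fix \<epsilon> :: real assume \<epsilon>: "\<epsilon> > 0"
  obtain K where K: "K > 0" "\<And>z. norm (L z) \<le> norm z * K" using bounded_linear.pos_bounded[OF L] by blast
  obtain \<delta> where \<delta>: "\<delta> > 0" "\<And>a b. a \<in> ball x \<delta> \<Longrightarrow> b \<in> ball x \<delta> \<Longrightarrow> norm (f a - f b - f' (a - b)) \<le> \<epsilon> / K * norm (a - b)"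
    using has_strict_derivativeD[OF f, of "\<epsilon> / K"] \<epsilon> K(1) by auto
  show "\<exists>\<delta>>0. \<forall>a\<in>ball x \<delta>. \<forall>b\<in>ball x \<delta>. norm (L (f a) - L (f b) - L (f' (a - b))) \<le> \<epsilon> * norm (a - b)"
  proof (intro exI[of _ \<delta>] conjI ballI)
    fix a b assume ab: "a \<in> ball x \<delta>" "b \<in> ball x \<delta>"
    have "L (f a) - L (f b) - L (f' (a - b)) = L (f a - f b - f' (a - b))"
      using bounded_linear.linear[OF L] by (simp add: linear_diff)
    then have "norm (L (f a) - L (f b) - L (f' (a - b))) \<le> norm (f a - f b - f' (a - b)) * K" using K(2) by simp
    also have "\<dots> \<le> \<epsilon> / K * norm (a - b) * K" using \<delta>(2)[OF ab] K(1) by (intro mult_right_mono) auto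
    finally show "norm (L (f a) - L (f b) - L (f' (a - b))) \<le> \<epsilon> * norm (a - b)" using K(1) by simp
  qed (use \<delta>(1) in simp)
qed

lemma has_strict_derivative_Pair:
  assumes f: "has_strict_derivative f f' x" and g: "has_strict_derivative g g' x"
  shows "has_strict_derivative (\<lambda>y. (f y, g y)) (\<lambda>v. (f' v, g' v)) x"
  unfolding has_strict_derivative_def
proof (intro conjI allI impI)
  show "bounded_linear (\<lambda>v. (f' v, g' v))"
    using f g by (intro bounded_linear_Pair) (simp_all add: has_strict_derivative_def)
  fix \<epsilon> :: real assume \<epsilon>: "\<epsilon> > 0"
  obtain \<delta>1 where \<delta>1: "\<delta>1 > 0" "\<And>a b. a \<in> ball x \<delta>1 \<Longrightarrow> b \<in> ball x \<delta>1 \<Longrightarrow> norm (f a - f b - f' (a - b)) \<le> \<epsilon> / 2 * norm (a - b)"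
    using has_strict_derivativeD[OF f, of "\<epsilon> / 2"] \<epsilon> by auto
  obtain \<delta>2 where \<delta>2: "\<delta>2 > 0" "\<And>a b. a \<in> ball x \<delta>2 \<Longrightarrow> b \<in> ball x \<delta>2 \<Longrightarrow> norm (g a - g b - g' (a - b)) \<le> \<epsilon> / 2 * norm (a - b)"
    using has_strict_derivativeD[OF g, of "\<epsilon> / 2"] \<epsilon> by auto
  show "\<exists>\<delta>>0. \<forall>a\<in>ball x \<delta>. \<forall>b\<in>ball x \<delta>. norm ((f a, g a) - (f b, g b) - (f' (a - b), g' (a - b))) \<le> \<epsilon> * norm (a - b)"
  proof (intro exI[of _ "min \<delta>1 \<delta>2"] conjI ballI)
    fix a b assume ab: "a \<in> ball x (min \<delta>1 \<delta>2)" "b \<in> ball x (min \<delta>1 \<delta>2)"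
    have "norm ((f a, g a) - (f b, g b) - (f' (a - b), g' (a - b)))
        \<le> norm (f a - f b - f' (a - b)) + norm (g a - g b - g' (a - b))"
      using norm_Pair_le by simp
    also have "\<dots> \<le> \<epsilon> / 2 * norm (a - b) + \<epsilon> / 2 * norm (a - b)"
      using \<delta>1(2)[of a b] \<delta>2(2)[of a b] ab by (intro add_mono) auto
    finally show "norm ((f a, g a) - (f b, g b) - (f' (a - b), g' (a - b))) \<le> \<epsilon> * norm (a - b)" by simp
  qed (use \<delta>1 \<delta>2 in simp)
qed

lemma has_strict_derivative_affine:
  assumes "bounded_linear L"
  shows "has_strict_derivative (\<lambda>y. L (y - a)) L x"
proof -
  have "L (b - a) - L (b' - a) - L (b - b') = 0" for b b'
    using bounded_linear.linear[OF assms] by (simp add: linear_diff)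
  then show ?thesis using assms by (auto simp: has_strict_derivative_def intro!: exI[of _ 1])
qed

lemma finite_dimensional_real: "finite_dimensional TYPE(real)"
proof -
  have "x \<in> span {1}" for x :: real using span_scale[OF span_base[of 1 "{1::real}"], of x] unfolding real_scaleR_def by simp
  then have "span {1::real} = UNIV" by blast
  then show ?thesis unfolding finite_dimensional_def by blast
qed

text \<open>Gram--Schmidt, adjoining one generator at a time; the generators may be linearly dependent.\<close>

lemma orthogonal_projection_exists:
  fixes g :: "'e::real_vector \<Rightarrow> 'e \<Rightarrow> real"
  assumes bil: "\<And>w. linear (\<lambda>u. g u w)" "\<And>u. linear (g u)"
    and sym: "\<And>u w. g u w = g w u" and pos: "\<And>u. u \<noteq> 0 \<Longrightarrow> g u u > 0" and fin: "finite B"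
  shows "\<exists>w\<in>span B. \<forall>w'\<in>span B. g (x - w) w' = 0"
  using fin
proof (induction B arbitrary: x)
  case empty
  then show ?case by (simp add: linear_0[OF bil(2)])
next
  case (insert b B)
  note diffl = linear_diff[OF bil(1)] and addr = linear_add[OF bil(2)] and scalr = linear_scale[OF bil(2)]
    and scall = linear_scale[OF bil(1)]
  obtain p where p: "p \<in> span B" "\<And>w. w \<in> span B \<Longrightarrow> g (b - p) w = 0" using insert.IH[of b] by blast
  obtain w where w: "w \<in> span B" "\<And>w'. w' \<in> span B \<Longrightarrow> g (x - w) w' = 0" using insert.IH[of x] by blast
  define b' where "b' = b - p"
  define k where "k = g (x - w) b' / g b' b'"
  have span_sub: "span B \<subseteq> span (insert b B)" by (rule span_mono) blast
  have b': "b' \<in> span (insert b B)"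
    unfolding b'_def using p(1) span_sub by (intro span_diff) (auto intro: span_base)
  have "w + k *\<^sub>R b' \<in> span (insert b B)"
    using w(1) span_sub b' by (intro span_add span_scale) auto
  moreover have "g (x - (w + k *\<^sub>R b')) w' = 0" if w': "w' \<in> span (insert b B)" for w'
  proof -
    obtain c where c: "w' - c *\<^sub>R b \<in> span B" using w' unfolding span_insert by blast
    define w0 where "w0 = w' - c *\<^sub>R b + c *\<^sub>R p"
    have w0: "w0 \<in> span B" unfolding w0_def using c p(1) by (intro span_add span_scale)
    have w'_eq: "w' = w0 + c *\<^sub>R b'" by (simp add: w0_def b'_def algebra_simps)
    have split: "x - (w + k *\<^sub>R b') = (x - w) - k *\<^sub>R b'" by simp
    have "g (x - (w + k *\<^sub>R b')) w' = g (x - w) w0 + c * g (x - w) b' - k * (g b' w0 + c * g b' b')"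
      unfolding split w'_eq by (simp add: diffl linear_add[OF bil(1)] addr scalr scall algebra_simps)
    also have "\<dots> = c * (g (x - w) b' - k * g b' b')"
      using w(2)[OF w0] p(2)[OF w0, folded b'_def] by (simp add: right_diff_distrib mult.left_commute)
    also have "\<dots> = 0"
    proof (cases "b' = 0")
      case True
      then show ?thesis by (simp add: linear_0[OF bil(2)])
    next
      case False
      then show ?thesis using pos[OF False] by (simp add: k_def)
    qed
    finally show ?thesis .
  qed
  ultimately show ?case by blast
qed

lemma finite_dimensional_blinfun_separates:
  assumes "finite_dimensional TYPE('h::real_normed_vector)" "\<And>\<beta> :: 'h \<Rightarrow>\<^sub>L real. blinfun_apply \<beta> \<xi> = 0"
  shows "\<xi> = 0"
proof -
  obtain B :: "'h set" and c where B: "finite B" "\<And>b. bounded_linear (c b)" "\<And>x. x = (\<Sum>b\<in>B. c b x *\<^sub>R b)"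
    by (rule finite_dimensional_coordinates[OF assms(1)]) (rule that; assumption)
  have "c b \<xi> = 0" for b
    using assms(2)[of "Blinfun (c b)"] B(2)[of b] by (simp add: bounded_linear_Blinfun_apply)
  then show ?thesis using B(3)[of \<xi>] by simp
qed

section \<open>Charts\<close>

abbreviation chart_inv :: "('m, 'e) chart \<Rightarrow> 'e \<Rightarrow> 'm" where
  "chart_inv c \<equiv> inv_into (chart_dom c) (chart_map c)"

text \<open>
  Only the topology of a manifold at a chart, so that the notion also applies to the product \<open>G \<times> S\<^sup>1\<close> of
  manifolds without proving first that a product of manifolds is one.
\<close>

definition topological_chart :: "'m topology \<Rightarrow> ('m, 'e::real_normed_vector) chart \<Rightarrow> bool" where
  "topological_chart T c \<longleftrightarrow>
     openin T (chart_dom c) \<and> inj_on (chart_map c) (chart_dom c) \<and> open (chart_image c) \<and>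
     continuous_map (subtopology T (chart_dom c)) euclidean (chart_map c) \<and>
     continuous_map (top_of_set (chart_image c)) T (chart_inv c)"

lemma topological_chart_inverse:
  assumes "topological_chart T c"
  shows "x \<in> chart_dom c \<Longrightarrow> chart_inv c (chart_map c x) = x"
    and "y \<in> chart_image c \<Longrightarrow> chart_map c (chart_inv c y) = y"
    and "y \<in> chart_image c \<Longrightarrow> chart_inv c y \<in> chart_dom c"
  using assms by (auto simp: topological_chart_def f_inv_into_f inv_into_into)

lemma smooth_manifold_chart:
  assumes "smooth_manifold M" "c \<in> atlas M"
  shows "topological_chart (mtop M) c"
proof -
  let ?D = "chart_dom c"
  have o: "openin (mtop M) ?D" "open (chart_image c)"
    and hm: "homeomorphic_map (subtopology (mtop M) ?D) (top_of_set (chart_image c)) (chart_map c)"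
    using assms by (auto simp: smooth_manifold_def)
  have sub: "?D \<subseteq> points M" using o(1) by (rule openin_subset)
  have top: "topspace (subtopology (mtop M) ?D) = ?D" using sub by auto
  have inj: "inj_on (chart_map c) ?D" using homeomorphic_imp_injective_map[OF hm] unfolding top .
  obtain g where g: "homeomorphic_maps (subtopology (mtop M) ?D) (top_of_set (chart_image c)) (chart_map c) g"
    using hm homeomorphic_map_maps by blast
  have gc: "continuous_map (top_of_set (chart_image c)) (subtopology (mtop M) ?D) g"
    and g_inv: "\<And>x. x \<in> ?D \<Longrightarrow> g (chart_map c x) = x"
    using g sub by (auto simp: homeomorphic_maps_def)
  have "g y = chart_inv c y" if "y \<in> topspace (top_of_set (chart_image c))" for y
    using that g_inv inj by auto
  with gc have "continuous_map (top_of_set (chart_image c)) (subtopology (mtop M) ?D) (chart_inv c)"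
    by (rule continuous_map_eq)
  then have "continuous_map (top_of_set (chart_image c)) (mtop M) (chart_inv c)"
    by (rule continuous_map_into_fulltopology)
  moreover have "continuous_map (subtopology (mtop M) ?D) euclidean (chart_map c)"
    using homeomorphic_imp_continuous_map[OF hm] by (rule continuous_map_into_fulltopology)
  ultimately show ?thesis using o inj by (simp add: topological_chart_def)
qed

lemma chart_covers:
  assumes "smooth_manifold M" "x \<in> points M"
  obtains c where "c \<in> atlas M" "x \<in> chart_dom c" "topological_chart (mtop M) c"
proof -
  obtain c where "c \<in> atlas M" "x \<in> chart_dom c" using assms by (auto simp: smooth_manifold_def)
  with smooth_manifold_chart[OF assms(1)] that show thesis by blast
qed

lemma open_chart_image:
  assumes c: "topological_chart T c" and W: "openin T W" "W \<subseteq> chart_dom c"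
  shows "open (chart_map c ` W)"
proof -
  have "chart_map c ` W = {y \<in> topspace (top_of_set (chart_image c)). chart_inv c y \<in> W}"
    using W(2) topological_chart_inverse[OF c] by force
  moreover have "openin (top_of_set (chart_image c)) {y \<in> topspace (top_of_set (chart_image c)). chart_inv c y \<in> W}"
    using c W(1) by (intro openin_continuous_map_preimage) (auto simp: topological_chart_def)
  ultimately show ?thesis
    using c by (metis openin_open_trans topological_chart_def)
qed

lemma chart_preimage_open:
  assumes c: "topological_chart T c" and U: "open U"
  shows "openin T {x \<in> chart_dom c. chart_map c x \<in> U}"
proof -
  have D: "openin T (chart_dom c)" using c by (simp add: topological_chart_def)
  have "openin (subtopology T (chart_dom c)) {x \<in> topspace (subtopology T (chart_dom c)). chart_map c x \<in> U}"
    using c U by (intro openin_continuous_map_preimage) (auto simp: topological_chart_def)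
  moreover have "{x \<in> topspace (subtopology T (chart_dom c)). chart_map c x \<in> U} = {x \<in> chart_dom c. chart_map c x \<in> U}"
    using openin_subset[OF D] by auto
  ultimately show ?thesis using D by (metis openin_trans_full)
qed

lemma prod_chart_simps [simp]:
  "chart_dom (prod_chart c d) = chart_dom c \<times> chart_dom d"
  "chart_map (prod_chart c d) = map_prod (chart_map c) (chart_map d)"
  by (simp_all add: prod_chart_def)

lemma chart_image_prod: "chart_image (prod_chart c d) = chart_image c \<times> chart_image d"
  by (auto simp: image_iff)

lemma prod_chart_inverse:
  assumes c: "topological_chart T c" and d: "topological_chart T' d"
    and "a \<in> chart_image c" "b \<in> chart_image d"
  shows "chart_inv (prod_chart c d) (a, b) = (chart_inv c a, chart_inv d b)"
proof (rule inv_into_f_eq)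
  show "inj_on (chart_map (prod_chart c d)) (chart_dom (prod_chart c d))"
    using c d by (auto simp: topological_chart_def inj_on_def)
qed (use assms topological_chart_inverse[OF c] topological_chart_inverse[OF d] in auto)

lemma topological_chart_prod:
  assumes c: "topological_chart T c" and d: "topological_chart T' d"
  shows "topological_chart (prod_topology T T') (prod_chart c d)"
proof -
  have "openin (prod_topology T T') (chart_dom (prod_chart c d))"
    using c d by (auto simp: topological_chart_def openin_prod_Times_iff)
  moreover have "inj_on (chart_map (prod_chart c d)) (chart_dom (prod_chart c d))"
    using c d by (auto simp: topological_chart_def inj_on_def)
  moreover have "open (chart_image (prod_chart c d))"
    using c d unfolding chart_image_prod by (auto simp: topological_chart_def open_Times)
  moreover have "continuous_map (subtopology (prod_topology T T') (chart_dom (prod_chart c d))) euclidean (chart_map (prod_chart c d))"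
  proof -
    have "continuous_map (prod_topology (subtopology T (chart_dom c)) (subtopology T' (chart_dom d))) (prod_topology euclidean euclidean)
        (\<lambda>(x, y). (chart_map c x, chart_map d y))"
      using c d unfolding continuous_map_prod_top by (simp add: topological_chart_def)
    then show ?thesis by (simp add: subtopology_Times map_prod_def)
  qed
  moreover have "continuous_map (top_of_set (chart_image (prod_chart c d))) (prod_topology T T') (chart_inv (prod_chart c d))"
  proof (rule continuous_map_eq)
    show "continuous_map (top_of_set (chart_image (prod_chart c d))) (prod_topology T T')
        (\<lambda>(a, b). (chart_inv c a, chart_inv d b))"
    proof -
      have "continuous_map (prod_topology (top_of_set (chart_image c)) (top_of_set (chart_image d))) (prod_topology T T')
          (\<lambda>(a, b). (chart_inv c a, chart_inv d b))"
        using c d unfolding continuous_map_prod_top by (simp add: topological_chart_def)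
      then show ?thesis unfolding chart_image_prod by simp
    qed
    show "(case p of (a, b) \<Rightarrow> (chart_inv c a, chart_inv d b)) = chart_inv (prod_chart c d) p"
      if "p \<in> topspace (top_of_set (chart_image (prod_chart c d)))" for p
      using that prod_chart_inverse[OF c d, of "fst p" "snd p"] unfolding chart_image_prod
      by (auto simp: case_prod_unfold)
  qed
  ultimately show ?thesis by (simp only: topological_chart_def)
qed

lemma angle_chart_map:
  assumes "z \<in> chart_dom (angle_chart (- pi))"
  shows "chart_map (angle_chart (- pi)) z = Arg z"
proof -
  obtain \<tau> where \<tau>: "\<tau> \<in> {-pi<..<pi}" "z = cis \<tau>" using assms by (auto simp: angle_chart_def)
  have "inj_on cis {-pi<..<pi}"
    by (rule inj_on_inverseI[of _ Arg]) (auto simp: Arg_cis)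
  then show ?thesis using \<tau> by (auto simp: angle_chart_def Arg_cis)
qed

lemma topological_chart_angle: "topological_chart (top_of_set (sphere 0 1)) (angle_chart (- pi))"
proof -
  let ?c = "angle_chart (- pi)"
  have dom: "chart_dom ?c = cis ` {-pi<..<pi}" by (simp add: angle_chart_def)
  have dom': "chart_dom ?c = sphere 0 1 \<inter> - \<real>\<^sub>\<le>\<^sub>0"
  proof (intro subset_antisym subsetI)
    fix z assume "z \<in> chart_dom ?c"
    then obtain \<tau> where \<tau>: "\<tau> \<in> {-pi<..<pi}" "z = cis \<tau>" using dom by auto
    have "Arg z = \<tau>" using \<tau> by (simp add: Arg_cis)
    then have "\<not> (Re z < 0 \<and> Im z = 0)" using \<tau>(1) by (simp flip: Arg_eq_pi)
    moreover have "z \<noteq> 0" using \<tau>(2) by simp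
    ultimately have "z \<notin> \<real>\<^sub>\<le>\<^sub>0" by (auto simp: complex_nonpos_Reals_iff complex_eq_iff)
    then show "z \<in> sphere 0 1 \<inter> - \<real>\<^sub>\<le>\<^sub>0" using \<tau> by auto
  next
    fix z :: complex assume z: "z \<in> sphere 0 1 \<inter> - \<real>\<^sub>\<le>\<^sub>0"
    have "z \<noteq> 0" using z by auto
    then have "z = cis (Arg z)" using z cis_Arg[of z] by (simp add: sgn_div_norm)
    moreover have "Arg z \<noteq> pi" using z by (auto simp: Arg_eq_pi complex_nonpos_Reals_iff)
    moreover have "-pi < Arg z" "Arg z \<le> pi" using Arg_bounded[of z] by auto
    ultimately show "z \<in> chart_dom ?c" unfolding dom by (intro image_eqI[of _ _ "Arg z"]) auto
  qed
  have inj: "inj_on cis {-pi<..<pi}"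
    by (rule inj_on_inverseI[of _ Arg]) (auto simp: Arg_cis)
  have map: "chart_map ?c (cis \<tau>) = \<tau>" if "\<tau> \<in> {-pi<..<pi}" for \<tau>
    using that inj by (simp add: angle_chart_def)
  have image: "chart_image ?c = {-pi<..<pi}" unfolding dom using map by (force simp: image_iff)
  have inv: "chart_inv ?c \<tau> = cis \<tau>" if "\<tau> \<in> {-pi<..<pi}" for \<tau>
  proof (rule inv_into_f_eq)
    show "inj_on (chart_map ?c) (chart_dom ?c)" unfolding dom by (rule inj_onI) (use map in auto)
  qed (use that map dom in auto)
  have "openin (top_of_set (sphere 0 1)) (chart_dom ?c)"
    unfolding dom' by (metis closed_nonpos_Reals_complex openin_open_Int open_Compl)
  moreover have "continuous_map (subtopology (top_of_set (sphere 0 1)) (chart_dom ?c)) euclidean (chart_map ?c)"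
  proof -
    have "continuous_on (chart_dom ?c) Arg" 
      unfolding dom' by (intro continuous_at_imp_continuous_on ballI continuous_at_Arg) auto
    then have "continuous_on (chart_dom ?c) (chart_map ?c)"
      by (rule continuous_on_eq) (simp add: angle_chart_map)
    moreover have "sphere 0 1 \<inter> chart_dom ?c = chart_dom ?c" unfolding dom' by blast
    ultimately show ?thesis by (simp add: subtopology_subtopology)
  qed
  moreover have "continuous_map (top_of_set (chart_image ?c)) (top_of_set (sphere 0 1)) (chart_inv ?c)"
  proof -
    have "continuous_on {-pi<..<pi} (chart_inv ?c)"
      by (rule continuous_on_eq[of _ cis]) (auto simp: inv intro: continuous_intros)
    then show ?thesis unfolding image by (auto simp: continuous_map_in_subtopology inv)
  qed
  moreover have "inj_on (chart_map ?c) (chart_dom ?c)" unfolding dom by (rule inj_onI) (use map in auto)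
  ultimately show ?thesis unfolding topological_chart_def image by simp
qed

lemma angle_chart_one: "1 \<in> chart_dom (angle_chart (- pi))" "chart_map (angle_chart (- pi)) 1 = 0"
proof -
  show *: "1 \<in> chart_dom (angle_chart (- pi))"
    by (auto simp: angle_chart_def intro!: image_eqI[of _ _ 0])
  show "chart_map (angle_chart (- pi)) 1 = 0" using angle_chart_map[OF *] by simp
qed

lemma angle_chart_inverse:
  assumes "\<tau> \<in> {-pi<..<pi}"
  shows "\<tau> \<in> chart_image (angle_chart (- pi))" "chart_inv (angle_chart (- pi)) \<tau> = cis \<tau>"
proof -
  have z: "cis \<tau> \<in> chart_dom (angle_chart (- pi))" using assms by (auto simp: angle_chart_def)
  have m: "chart_map (angle_chart (- pi)) (cis \<tau>) = \<tau>" using angle_chart_map[OF z] assms by (simp add: Arg_cis)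
  show "\<tau> \<in> chart_image (angle_chart (- pi))" using z m by (metis imageI)
  show "chart_inv (angle_chart (- pi)) \<tau> = cis \<tau>"
    using topological_chart_inverse(1)[OF topological_chart_angle z] m by simp
qed

lemma smooth_on_has_strict_derivative:
  assumes "finite_dimensional TYPE('a::real_normed_vector)" "open S" "x \<in> S" "smooth_on S (f :: 'a \<Rightarrow> 'b::real_normed_vector)"
  shows "has_strict_derivative f (frechet_derivative f (at x)) x"
  using assms Ck1_has_strict_derivative[OF assms(1-3), of f] unfolding smooth_on_def by blast

text \<open>
  Smoothness enters all later arguments through strict derivatives of the local representatives.
\<close>

lemma smooth_function_has_strict_derivative:
  fixes M :: "('m, 'e::real_normed_vector) manifold"
  assumes M: "smooth_manifold M" and f: "smooth_function M f" and c: "c \<in> atlas M" and x: "x \<in> chart_dom c"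
  shows "has_strict_derivative (local_rep c f) (differential c f x) (chart_map c x)"
  unfolding differential_def
proof (rule smooth_on_has_strict_derivative)
  show "finite_dimensional TYPE('e)" using M by (simp add: smooth_manifold_def)
  show "open (chart_image c)" using smooth_manifold_chart[OF M c] by (simp add: topological_chart_def)
  show "smooth_on (chart_image c) (local_rep c f)" using f c by (simp add: smooth_function_def)
qed (use x in simp)

lemma smooth_map_has_strict_derivative:
  fixes M :: "('m, 'e::real_normed_vector) manifold" and N :: "('n, 'f::real_normed_vector) manifold"
  assumes fin: "finite_dimensional TYPE('e)" and f: "smooth_map M N f"
    and c: "c \<in> atlas M" "topological_chart (mtop M) c" and d: "d \<in> atlas N" "topological_chart (mtop N) d"
    and x: "x \<in> chart_dom c" "f x \<in> chart_dom d"
  shows "has_strict_derivative (local_rep c (chart_map d \<circ> f)) (differential c (chart_map d \<circ> f) x) (chart_map c x)"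
    and "\<forall>\<^sub>F y in nhds (chart_map c x). y \<in> chart_image c \<and> f (chart_inv c y) \<in> chart_dom d"
proof -
  let ?W = "{x \<in> chart_dom c. f x \<in> chart_dom d}"
  have cont: "continuous_map (mtop M) (mtop N) f" using f by (simp add: smooth_map_def)
  have dom: "openin (mtop M) (chart_dom c)" "openin (mtop N) (chart_dom d)"
    using c d by (auto simp: topological_chart_def)
  have "?W = chart_dom c \<inter> {x \<in> points M. f x \<in> chart_dom d}" using openin_subset[OF dom(1)] by auto
  then have "openin (mtop M) ?W"
    using dom(1) openin_continuous_map_preimage[OF cont dom(2)] by auto
  then have op: "open (chart_map c ` ?W)" using c(2) by (intro open_chart_image) auto
  show "has_strict_derivative (local_rep c (chart_map d \<circ> f)) (differential c (chart_map d \<circ> f) x) (chart_map c x)"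
    unfolding differential_def
    using f c(1) d(1) x op fin by (intro smooth_on_has_strict_derivative[where S = "chart_map c ` ?W"]) (auto simp: smooth_map_def)
  have "\<forall>\<^sub>F y in nhds (chart_map c x). y \<in> chart_map c ` ?W"
    using op x by (intro eventually_nhds_in_open) auto
  then show "\<forall>\<^sub>F y in nhds (chart_map c x). y \<in> chart_image c \<and> f (chart_inv c y) \<in> chart_dom d"
    by eventually_elim (use topological_chart_inverse[OF c(2)] in auto)
qed

section \<open>Hamiltonian actions in charts\<close>

lemma circle_group_simps [simp]:
  "carrier circle_group = sphere 0 1" "\<one>\<^bsub>circle_group\<^esub> = 1" "x \<otimes>\<^bsub>circle_group\<^esub> y = x * y"
  by (simp_all add: circle_group_def)

lemma comm_group_circle_group: "comm_group circle_group"
proof (rule comm_groupI)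
  fix x assume "x \<in> carrier circle_group"
  then have "cnj x \<in> carrier circle_group" "cnj x * x = 1"
    using complex_norm_square[of x] by (simp_all add: mult.commute)
  then show "\<exists>y\<in>carrier circle_group. y \<otimes>\<^bsub>circle_group\<^esub> x = \<one>\<^bsub>circle_group\<^esub>" by auto
qed (auto simp: norm_mult)

lemma prod_chart_in_atlas:
  "c \<in> atlas M \<Longrightarrow> d \<in> atlas N \<Longrightarrow> prod_chart c d \<in> atlas (prod_manifold M N)"
  unfolding prod_manifold_def manifold.simps by blast

text \<open>
  A compact Lie group \<open>G\<close> and a Hamiltonian action of \<open>K = G \<times> S\<^sup>1\<close>. The coordinates \<open>eK\<close> around the unit
  of \<open>K\<close> are those of \<open>G\<close> together with the angle of the circle, so that \<open>(\<xi>, 0)\<close> and \<open>(0, 1)\<close> generate the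
  actions of \<open>G\<close> and of the circle.
\<close>

locale hamiltonian_setup =
  fixes G :: "'g monoid"
    and N :: "('g, 'h::real_normed_vector) manifold"
    and e :: "('g, 'h) chart"
    and M :: "('m, 'e::real_normed_vector) manifold"
    and \<omega> :: "('m, 'e) bilinear_field"
    and I :: "('m, 'e) endo_field"
    and act :: "'g \<times> complex \<Rightarrow> 'm \<Rightarrow> 'm"
    and \<mu>\<^sub>G :: "'m \<Rightarrow> 'h \<Rightarrow>\<^sub>L real"
    and \<mu>\<^sub>S :: "'m \<Rightarrow> real"
  assumes lie: "lie_group G N" and compact: "compact_space (mtop N)"
    and e: "e \<in> charts_at N \<one>\<^bsub>G\<^esub>"
    and kaehler: "almost_kaehler M \<omega> I"
    and hamiltonian: "hamiltonian_action (G \<times>\<times> circle_group) (prod_manifold N circle_manifold)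
           (prod_chart e (angle_chart (- pi))) M \<omega> act (pair_moment \<mu>\<^sub>G \<mu>\<^sub>S)"
begin

abbreviation "K \<equiv> G \<times>\<times> circle_group"
abbreviation "angle \<equiv> angle_chart (- pi)"
abbreviation "eK \<equiv> prod_chart e angle"
abbreviation "T \<equiv> mtop M"
abbreviation "unit_coord \<equiv> (chart_map e \<one>\<^bsub>G\<^esub>, 0::real)"

lemma group_G: "group G" and N_manifold: "smooth_manifold N" and points_N: "points N = carrier G"
  and mult_smooth: "smooth_map (prod_manifold N N) N (\<lambda>(g, h). g \<otimes>\<^bsub>G\<^esub> h)"
  using lie by (auto simp: lie_group_def)

interpretation G: group G by (rule group_G)
interpretation S: comm_group circle_group by (rule comm_group_circle_group)

lemma M_manifold: "smooth_manifold M"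
  using kaehler by (simp add: almost_kaehler_def symplectic_manifold_def)

lemma fin_h: "finite_dimensional TYPE('h)" and fin_e: "finite_dimensional TYPE('e)"
  using N_manifold M_manifold by (auto simp: smooth_manifold_def)

lemma e_chart: "e \<in> atlas N" "\<one>\<^bsub>G\<^esub> \<in> chart_dom e" "topological_chart (mtop N) e"
  using e smooth_manifold_chart[OF N_manifold] by (auto simp: charts_at_def)

lemma M_chart: "c \<in> atlas M \<Longrightarrow> topological_chart T c"
  by (rule smooth_manifold_chart[OF M_manifold])

lemma chart_dom_points: "c \<in> atlas M \<Longrightarrow> chart_dom c \<subseteq> points M"
  using M_chart[of c] openin_subset[of T "chart_dom c"] by (simp add: topological_chart_def)

lemma chart_exists:
  assumes "x \<in> points M"
  obtains c where "c \<in> atlas M" "x \<in> chart_dom c"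
  using assms M_manifold by (auto simp: smooth_manifold_def)

abbreviation "TK \<equiv> prod_topology (mtop N) (top_of_set (sphere (0::complex) 1))"

lemma eK_chart: "topological_chart TK eK"
  by (intro topological_chart_prod e_chart topological_chart_angle)

lemma eK_one: "(\<one>\<^bsub>G\<^esub>, 1) \<in> chart_dom eK" "chart_map eK (\<one>\<^bsub>G\<^esub>, 1) = unit_coord"
  using e_chart angle_chart_one by auto

lemma eK_inv:
  assumes "u \<in> chart_image e" "\<tau> \<in> {-pi<..<pi}"
  shows "(u, \<tau>) \<in> chart_image eK" "chart_inv eK (u, \<tau>) = (chart_inv e u, cis \<tau>)"
  using angle_chart_inverse[OF assms(2)] assms(1)
    prod_chart_inverse[OF e_chart(3) topological_chart_angle assms(1), of \<tau>]
  by (auto simp: chart_image_prod simp del: prod_chart_simps)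

subsection \<open>The action\<close>

lemma action: "group_action K (points M) act"
  and action_smooth: "smooth_map (prod_manifold (prod_manifold N circle_manifold) M) M (\<lambda>(k, x). act k x)"
  using hamiltonian by (auto simp: hamiltonian_action_def smooth_action_def)

lemma act_cont: "continuous_map (prod_topology TK T) T (\<lambda>(k, x). act k x)"
  using action_smooth by (simp add: smooth_map_def prod_manifold_def circle_manifold_def)

lemma act_one: "x \<in> points M \<Longrightarrow> act (\<one>\<^bsub>G\<^esub>, 1) x = x"
proof -
  interpret group_action K "points M" act by (rule action)
  assume "x \<in> points M"
  then show "act (\<one>\<^bsub>G\<^esub>, 1) x = x" using id_eq_one by (metis one_DirProd circle_group_simps(2) restrict_apply')
qed

lemma act_mult:
  assumes "g \<in> carrier G" "h \<in> carrier G" "t \<in> sphere 0 1" "t' \<in> sphere 0 1" "x \<in> points M"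
  shows "act (g \<otimes>\<^bsub>G\<^esub> h, t * t') x = act (g, t) (act (h, t') x)"
proof -
  interpret group_action K "points M" act by (rule action)
  show ?thesis using composition_rule[of x "(g, t)" "(h, t')"] assms by simp
qed

lemma act_closed: "g \<in> carrier G \<Longrightarrow> t \<in> sphere 0 1 \<Longrightarrow> x \<in> points M \<Longrightarrow> act (g, t) x \<in> points M"
proof -
  interpret group_action K "points M" act by (rule action)
  assume "g \<in> carrier G" "t \<in> sphere 0 1" "x \<in> points M"
  then show "act (g, t) x \<in> points M" using element_image[of "(g, t)" x] by simp
qed

text \<open>
  The map \<open>(k, x) \<mapsto> k x\<close> in coordinates around \<open>(1, x)\<close>, and its derivative there.
\<close>

definition action_rep :: "('m, 'e) chart \<Rightarrow> ('h \<times> real) \<times> 'e \<Rightarrow> 'e" where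
  "action_rep c = local_rep (prod_chart eK c) (chart_map c \<circ> (\<lambda>(k, x). act k x))"

definition action_deriv :: "('m, 'e) chart \<Rightarrow> 'm \<Rightarrow> ('h \<times> real) \<times> 'e \<Rightarrow> 'e" where
  "action_deriv c x = differential (prod_chart eK c) (chart_map c \<circ> (\<lambda>(k, x). act k x)) ((\<one>\<^bsub>G\<^esub>, 1), x)"

lemma action_rep_eq:
  assumes "c \<in> atlas M" "\<zeta> \<in> chart_image eK" "y \<in> chart_image c"
  shows "action_rep c (\<zeta>, y) = chart_map c (act (chart_inv eK \<zeta>) (chart_inv c y))"
  using prod_chart_inverse[OF eK_chart M_chart[OF assms(1)] assms(2,3)]
  by (simp add: action_rep_def local_rep_def del: prod_chart_simps)

lemma action_rep_strict:
  assumes c: "c \<in> atlas M" "x \<in> chart_dom c"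
  shows "has_strict_derivative (action_rep c) (action_deriv c x) (unit_coord, chart_map c x)"
    and "\<forall>\<^sub>F (\<zeta>, y) in nhds (unit_coord, chart_map c x).
           \<zeta> \<in> chart_image eK \<and> y \<in> chart_image c \<and> act (chart_inv eK \<zeta>) (chart_inv c y) \<in> chart_dom c"
proof -
  let ?pc = "prod_chart eK c"
  have x: "x \<in> points M" using c chart_dom_points by blast
  have fin: "finite_dimensional TYPE(('h \<times> real) \<times> 'e)"
    by (intro finite_dimensional_prod fin_h fin_e finite_dimensional_real)
  have atl: "?pc \<in> atlas (prod_manifold (prod_manifold N circle_manifold) M)"
    using e_chart(1) c(1) by (intro prod_chart_in_atlas) (simp_all add: circle_manifold_def)
  have top: "topological_chart (mtop (prod_manifold (prod_manifold N circle_manifold) M)) ?pc"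
    using topological_chart_prod[OF eK_chart M_chart[OF c(1)]] by (simp add: prod_manifold_def circle_manifold_def)
  have dom: "((\<one>\<^bsub>G\<^esub>, 1), x) \<in> chart_dom ?pc" using eK_one c by simp
  have im: "(\<lambda>(k, x). act k x) ((\<one>\<^bsub>G\<^esub>, 1), x) \<in> chart_dom c" using act_one[OF x] c by simp
  have pt: "chart_map ?pc ((\<one>\<^bsub>G\<^esub>, 1), x) = (unit_coord, chart_map c x)"
    using eK_one(2) by (simp add: map_prod_def)
  note * = smooth_map_has_strict_derivative[OF fin action_smooth atl top c(1) M_chart[OF c(1)] dom im]
  show "has_strict_derivative (action_rep c) (action_deriv c x) (unit_coord, chart_map c x)"
    using *(1) unfolding action_rep_def action_deriv_def pt .
  show "\<forall>\<^sub>F (\<zeta>, y) in nhds (unit_coord, chart_map c x).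
           \<zeta> \<in> chart_image eK \<and> y \<in> chart_image c \<and> act (chart_inv eK \<zeta>) (chart_inv c y) \<in> chart_dom c"
    using *(2) unfolding pt
  proof (rule eventually_mono)
    fix p
    assume p: "p \<in> chart_image ?pc \<and> (case chart_inv ?pc p of (k, x) \<Rightarrow> act k x) \<in> chart_dom c"
    obtain \<zeta> y where \<zeta>: "p = (\<zeta>, y)" by (cases p)
    then have in_im: "\<zeta> \<in> chart_image eK" "y \<in> chart_image c"
      using p unfolding chart_image_prod[of eK c] by auto
    then show "case p of (\<zeta>, y) \<Rightarrow> \<zeta> \<in> chart_image eK \<and> y \<in> chart_image c \<and> act (chart_inv eK \<zeta>) (chart_inv c y) \<in> chart_dom c"
      using p prod_chart_inverse[OF eK_chart M_chart[OF c(1)] in_im] unfolding \<zeta>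
      by (simp del: prod_chart_simps)
  qed
qed

abbreviation gen :: "('m, 'e) chart \<Rightarrow> 'm \<Rightarrow> 'h \<times> real \<Rightarrow> 'e" where
  "gen c x \<zeta> \<equiv> generator K eK act \<zeta> c x"

lemma orbit_near:
  assumes c: "c \<in> atlas M" "x \<in> chart_dom c"
  shows "\<forall>\<^sub>F \<zeta> in nhds unit_coord. \<zeta> \<in> chart_image eK \<and> act (chart_inv eK \<zeta>) x \<in> chart_dom c \<and>
     action_rep c (\<zeta>, chart_map c x) = chart_map c (act (chart_inv eK \<zeta>) x)"
proof -
  have "filterlim (\<lambda>\<zeta>. (\<zeta>, chart_map c x)) (nhds (unit_coord, chart_map c x)) (nhds unit_coord)"
    by (intro tendsto_intros filterlim_ident)
  from eventually_compose_filterlim[OF action_rep_strict(2)[OF c] this]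
  show ?thesis
    by eventually_elim (use c topological_chart_inverse[OF M_chart[OF c(1)]] action_rep_eq[OF c(1)] in auto)
qed

lemma action_rep_at_unit:
  assumes c: "c \<in> atlas M" "y \<in> chart_image c"
  shows "action_rep c (unit_coord, y) = y"
proof -
  have "chart_inv c y \<in> points M" using topological_chart_inverse(3)[OF M_chart[OF c(1)] c(2)] chart_dom_points[OF c(1)] by blast
  moreover have "unit_coord \<in> chart_image eK" "chart_inv eK unit_coord = (\<one>\<^bsub>G\<^esub>, 1)"
    using eK_one topological_chart_inverse(1)[OF eK_chart eK_one(1)] by (metis imageI, metis)
  ultimately show ?thesis
    using action_rep_eq[OF c(1) _ c(2), of unit_coord] act_one topological_chart_inverse(2)[OF M_chart[OF c(1)] c(2)] by simp
qed

text \<open>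
  The vector fields of the action are partial derivatives of the action map: this makes them linear in \<open>\<zeta>\<close> and
  lets the chain rule differentiate functions along orbits.
\<close>

lemma gen_eq:
  assumes c: "c \<in> atlas M" "x \<in> chart_dom c"
  shows "gen c x \<zeta> = action_deriv c x (\<zeta>, 0)"
proof -
  have D: "(action_rep c has_derivative action_deriv c x) (at (unit_coord, chart_map c x))"
    using action_rep_strict(1)[OF c] by (rule strict_derivative_imp_derivative)
  have pair: "((\<lambda>\<zeta>. (\<zeta>, chart_map c x)) has_derivative (\<lambda>\<zeta>. (\<zeta>, 0))) (at unit_coord)"
    by (intro derivative_eq_intros) auto
  have "((\<lambda>\<zeta>. action_rep c (\<zeta>, chart_map c x)) has_derivative (\<lambda>\<zeta>. action_deriv c x (\<zeta>, 0))) (at unit_coord)"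
    using has_derivative_compose[OF pair D] .
  moreover have "\<forall>\<^sub>F \<zeta> in at unit_coord. action_rep c (\<zeta>, chart_map c x) = local_rep eK (\<lambda>k. chart_map c (act k x)) \<zeta>"
    using orbit_near[OF c] unfolding eventually_at_filter
    by (rule eventually_mono) (simp add: local_rep_def del: prod_chart_simps)
  moreover have "action_rep c (unit_coord, chart_map c x) = local_rep eK (\<lambda>k. chart_map c (act k x)) unit_coord"
    using eventually_nhds_x_imp_x[OF orbit_near[OF c]] by (simp add: local_rep_def del: prod_chart_simps)
  ultimately have "(local_rep eK (\<lambda>k. chart_map c (act k x)) has_derivative (\<lambda>\<zeta>. action_deriv c x (\<zeta>, 0))) (at unit_coord)"
    using has_derivative_transform_eventually[of _ _ unit_coord UNIV "local_rep eK (\<lambda>k. chart_map c (act k x))"] by simp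
  then have "frechet_derivative (local_rep eK (\<lambda>k. chart_map c (act k x))) (at unit_coord) = (\<lambda>\<zeta>. action_deriv c x (\<zeta>, 0))"
    by (rule frechet_derivative_at[symmetric])
  moreover have "\<one>\<^bsub>K\<^esub> = (\<one>\<^bsub>G\<^esub>, 1)" by (simp add: one_DirProd)
  ultimately show ?thesis
    unfolding generator_def differential_def using eK_one(2) by (simp del: prod_chart_simps)
qed

lemma gen_bounded_linear:
  assumes c: "c \<in> atlas M" "x \<in> chart_dom c"
  shows "bounded_linear (gen c x)"
proof -
  have "bounded_linear (action_deriv c x)"
    using action_rep_strict(1)[OF c] by (simp add: has_strict_derivative_def)
  moreover have "bounded_linear (\<lambda>\<zeta>::'h \<times> real. (\<zeta>, 0::'e))"
    by (intro bounded_linear_Pair bounded_linear_ident bounded_linear_zero)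
  ultimately show ?thesis unfolding gen_eq[OF c] by (rule bounded_linear_compose)
qed

lemma orbit_derivative:
  assumes c: "c \<in> atlas M" "x \<in> chart_dom c" and f: "(local_rep c f has_derivative f') (at (chart_map c x))"
  shows "((\<lambda>\<zeta>. f (act (chart_inv eK \<zeta>) x)) has_derivative (\<lambda>\<zeta>. f' (gen c x \<zeta>))) (at unit_coord)"
proof -
  have D: "(action_rep c has_derivative action_deriv c x) (at (unit_coord, chart_map c x))"
    using action_rep_strict(1)[OF c] by (rule strict_derivative_imp_derivative)
  have pair: "((\<lambda>\<zeta>. (\<zeta>, chart_map c x)) has_derivative (\<lambda>\<zeta>. (\<zeta>, 0))) (at unit_coord)"
    by (intro derivative_eq_intros) auto
  have 1: "((\<lambda>\<zeta>. action_rep c (\<zeta>, chart_map c x)) has_derivative (\<lambda>\<zeta>. action_deriv c x (\<zeta>, 0))) (at unit_coord)"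
    using has_derivative_compose[OF pair D] .
  have "action_rep c (unit_coord, chart_map c x) = chart_map c x"
    using action_rep_at_unit[OF c(1)] c(2) by simp
  with f have "(local_rep c f has_derivative f') (at (action_rep c (unit_coord, chart_map c x)))" by simp
  from has_derivative_compose[OF 1 this]
  have "((\<lambda>\<zeta>. local_rep c f (action_rep c (\<zeta>, chart_map c x))) has_derivative (\<lambda>\<zeta>. f' (gen c x \<zeta>))) (at unit_coord)"
    by (simp add: gen_eq[OF c])
  moreover have ev: "\<forall>\<^sub>F \<zeta> in nhds unit_coord. local_rep c f (action_rep c (\<zeta>, chart_map c x)) = f (act (chart_inv eK \<zeta>) x)"
    using orbit_near[OF c]
    by eventually_elim (simp add: local_rep_def topological_chart_inverse(1)[OF M_chart[OF c(1)]] del: prod_chart_simps)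
  moreover have "\<forall>\<^sub>F \<zeta> in at unit_coord. local_rep c f (action_rep c (\<zeta>, chart_map c x)) = f (act (chart_inv eK \<zeta>) x)"
    using ev unfolding eventually_at_filter by (rule eventually_mono) simp
  ultimately show ?thesis
    using has_derivative_transform_eventually[of "\<lambda>\<zeta>. local_rep c f (action_rep c (\<zeta>, chart_map c x))" _ unit_coord UNIV
        "\<lambda>\<zeta>. f (act (chart_inv eK \<zeta>) x)"] eventually_nhds_x_imp_x[OF ev] by simp
qed

lemma image_near_unit: "\<forall>\<^sub>F u in nhds (chart_map e \<one>\<^bsub>G\<^esub>). u \<in> chart_image e"
  using e_chart by (intro eventually_nhds_in_open) (auto simp: topological_chart_def)

lemma invariant_derivative_G:
  assumes c: "c \<in> atlas M" "x \<in> chart_dom c" and f: "(local_rep c f has_derivative f') (at (chart_map c x))"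
    and inv: "\<And>g. g \<in> carrier G \<Longrightarrow> f (act (g, 1) x) = f x"
  shows "f' (gen c x (\<xi>, 0)) = 0"
proof -
  have pair: "((\<lambda>u. (u, 0::real)) has_derivative (\<lambda>\<xi>. (\<xi>, 0))) (at (chart_map e \<one>\<^bsub>G\<^esub>))"
    by (intro derivative_eq_intros) auto
  have D: "((\<lambda>u. f (act (chart_inv eK (u, 0)) x)) has_derivative (\<lambda>\<xi>. f' (gen c x (\<xi>, 0)))) (at (chart_map e \<one>\<^bsub>G\<^esub>))"
    using has_derivative_compose[OF pair orbit_derivative[OF c f]] .
  have ev: "\<forall>\<^sub>F u in nhds (chart_map e \<one>\<^bsub>G\<^esub>). f (act (chart_inv eK (u, 0)) x) = f x"
    using image_near_unit
  proof eventually_elim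
    case (elim u)
    have "chart_inv e u \<in> carrier G"
      using topological_chart_inverse(3)[OF e_chart(3) elim] e_chart(3) openin_subset points_N
      by (fastforce simp: topological_chart_def)
    then show ?case using eK_inv(2)[OF elim, of 0] inv by simp
  qed
  then have "\<forall>\<^sub>F u in at (chart_map e \<one>\<^bsub>G\<^esub>). f (act (chart_inv eK (u, 0)) x) = f x"
    unfolding eventually_at_filter by (rule eventually_mono) simp
  then have "((\<lambda>u. f x) has_derivative (\<lambda>\<xi>. f' (gen c x (\<xi>, 0)))) (at (chart_map e \<one>\<^bsub>G\<^esub>))"
    using has_derivative_transform_eventually[OF D, of "\<lambda>u. f x"] eventually_nhds_x_imp_x[OF ev] by simp
  then have "(\<lambda>\<xi>. f' (gen c x (\<xi>, 0))) = (\<lambda>\<xi>. 0)"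
    using has_derivative_const by (rule has_derivative_unique)
  then show ?thesis by metis
qed

lemma circle_derivative:
  assumes c: "c \<in> atlas M" "x \<in> chart_dom c" and f: "(local_rep c f has_derivative f') (at (chart_map c x))"
  shows "((\<lambda>\<tau>. f (act (\<one>\<^bsub>G\<^esub>, cis \<tau>) x)) has_derivative (\<lambda>\<tau>. f' (gen c x (0, \<tau>)))) (at 0)"
proof -
  have pair: "((\<lambda>\<tau>. (chart_map e \<one>\<^bsub>G\<^esub>, \<tau>)) has_derivative (\<lambda>\<tau>. (0, \<tau>))) (at (0::real))"
    by (intro derivative_eq_intros) auto
  have D: "((\<lambda>\<tau>. f (act (chart_inv eK (chart_map e \<one>\<^bsub>G\<^esub>, \<tau>)) x)) has_derivative (\<lambda>\<tau>. f' (gen c x (0, \<tau>)))) (at 0)"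
    using has_derivative_compose[OF pair orbit_derivative[OF c f]] .
  have "\<forall>\<^sub>F \<tau> in nhds (0::real). \<tau> \<in> {-pi<..<pi}" by (intro eventually_nhds_in_open) auto
  then have ev: "\<forall>\<^sub>F \<tau> in nhds 0. f (act (chart_inv eK (chart_map e \<one>\<^bsub>G\<^esub>, \<tau>)) x) = f (act (\<one>\<^bsub>G\<^esub>, cis \<tau>) x)"
  proof eventually_elim
    case (elim \<tau>)
    then show ?case
      using eK_inv(2)[of "chart_map e \<one>\<^bsub>G\<^esub>" \<tau>] e_chart(2) topological_chart_inverse(1)[OF e_chart(3,2)] by simp
  qed
  then have "\<forall>\<^sub>F \<tau> in at 0. f (act (chart_inv eK (chart_map e \<one>\<^bsub>G\<^esub>, \<tau>)) x) = f (act (\<one>\<^bsub>G\<^esub>, cis \<tau>) x)"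
    unfolding eventually_at_filter by (rule eventually_mono) simp
  then show ?thesis
    using has_derivative_transform_eventually[OF D, of "\<lambda>\<tau>. f (act (\<one>\<^bsub>G\<^esub>, cis \<tau>) x)"] eventually_nhds_x_imp_x[OF ev] by simp
qed

end

context hamiltonian_setup
begin

interpretation G: group G by (rule group_G)
interpretation S: comm_group circle_group by (rule comm_group_circle_group)

subsection \<open>Moment maps\<close>

lemma moment: "smooth_function M (pair_moment \<mu>\<^sub>G \<mu>\<^sub>S)"
  "\<And>c x \<zeta> u. c \<in> atlas M \<Longrightarrow> x \<in> chart_dom c \<Longrightarrow>
     differential c (\<lambda>y. blinfun_apply (pair_moment \<mu>\<^sub>G \<mu>\<^sub>S y) \<zeta>) x u = \<omega> c x u (gen c x \<zeta>)"
  "\<And>k x \<zeta>. k \<in> carrier K \<Longrightarrow> x \<in> points M \<Longrightarrow>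
     blinfun_apply (pair_moment \<mu>\<^sub>G \<mu>\<^sub>S (act k x)) (Ad K eK k \<zeta>) = blinfun_apply (pair_moment \<mu>\<^sub>G \<mu>\<^sub>S x) \<zeta>"
  using hamiltonian by (auto simp: hamiltonian_action_def moment_map_def)

lemma pair_moment_apply: "blinfun_apply (pair_moment \<mu>\<^sub>G \<mu>\<^sub>S x) (\<xi>, \<tau>) = blinfun_apply (\<mu>\<^sub>G x) \<xi> + \<tau> * \<mu>\<^sub>S x"
  by (simp add: pair_moment_def blinfun.bilinear_simps)

lemma local_rep_comp: "local_rep c (\<lambda>x. L (f x)) = (\<lambda>y. L (local_rep c f y))"
  by (simp add: local_rep_def o_def)

lemma differential_eqI:
  assumes "has_strict_derivative (local_rep c f) f' (chart_map c x)"
  shows "differential c f x = f'"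
  unfolding differential_def
  using frechet_derivative_at[OF strict_derivative_imp_derivative[OF assms]] by simp

lemma pair_moment_strict:
  assumes c: "c \<in> atlas M" "x \<in> chart_dom c"
  shows "has_strict_derivative (local_rep c (pair_moment \<mu>\<^sub>G \<mu>\<^sub>S)) (differential c (pair_moment \<mu>\<^sub>G \<mu>\<^sub>S) x) (chart_map c x)"
  using M_manifold moment(1) c by (rule smooth_function_has_strict_derivative)

lemma \<mu>\<^sub>G_strict:
  assumes c: "c \<in> atlas M" "x \<in> chart_dom c"
  shows "has_strict_derivative (local_rep c \<mu>\<^sub>G) (differential c \<mu>\<^sub>G x) (chart_map c x)"
proof -
  let ?E = "Blinfun (\<lambda>\<xi>::'h. (\<xi>, 0::real))"
  have E: "blinfun_apply ?E \<xi> = (\<xi>, 0)" for \<xi>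
    by (intro bounded_linear_Blinfun_apply[THEN fun_cong] bounded_linear_Pair bounded_linear_ident bounded_linear_zero)
  have "\<mu>\<^sub>G = (\<lambda>x. pair_moment \<mu>\<^sub>G \<mu>\<^sub>S x o\<^sub>L ?E)"
    by (intro ext blinfun_eqI) (simp add: E pair_moment_apply)
  then have "local_rep c \<mu>\<^sub>G = (\<lambda>y. local_rep c (pair_moment \<mu>\<^sub>G \<mu>\<^sub>S) y o\<^sub>L ?E)"
    using local_rep_comp[of c "\<lambda>B. B o\<^sub>L ?E" "pair_moment \<mu>\<^sub>G \<mu>\<^sub>S"] by simp
  then have "has_strict_derivative (local_rep c \<mu>\<^sub>G) (\<lambda>v. differential c (pair_moment \<mu>\<^sub>G \<mu>\<^sub>S) x v o\<^sub>L ?E) (chart_map c x)"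
    using has_strict_derivative_bounded_linear[OF pair_moment_strict[OF c]
        bounded_bilinear.bounded_linear_left[OF bounded_bilinear_blinfun_compose, of ?E]] by simp
  with differential_eqI[OF this] show ?thesis by simp
qed

lemma \<mu>\<^sub>S_strict:
  assumes c: "c \<in> atlas M" "x \<in> chart_dom c"
  shows "has_strict_derivative (local_rep c \<mu>\<^sub>S) (differential c \<mu>\<^sub>S x) (chart_map c x)"
proof -
  have "\<mu>\<^sub>S = (\<lambda>x. blinfun_apply (pair_moment \<mu>\<^sub>G \<mu>\<^sub>S x) (0, 1))" by (simp add: pair_moment_apply)
  then have "local_rep c \<mu>\<^sub>S = (\<lambda>y. blinfun_apply (local_rep c (pair_moment \<mu>\<^sub>G \<mu>\<^sub>S) y) (0, 1))"
    using local_rep_comp[of c "\<lambda>B. blinfun_apply B (0, 1)" "pair_moment \<mu>\<^sub>G \<mu>\<^sub>S"] by simp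
  then have "has_strict_derivative (local_rep c \<mu>\<^sub>S) (\<lambda>v. blinfun_apply (differential c (pair_moment \<mu>\<^sub>G \<mu>\<^sub>S) x v) (0, 1)) (chart_map c x)"
    using has_strict_derivative_bounded_linear[OF pair_moment_strict[OF c]
        bounded_bilinear.bounded_linear_left[OF bounded_bilinear_blinfun_apply, of "(0, 1)"]] by simp
  with differential_eqI[OF this] show ?thesis by simp
qed

lemma d\<mu>\<^sub>G:
  assumes c: "c \<in> atlas M" "x \<in> chart_dom c"
  shows "blinfun_apply (differential c \<mu>\<^sub>G x u) \<xi> = \<omega> c x u (gen c x (\<xi>, 0))"
proof -
  have "local_rep c (\<lambda>y. blinfun_apply (pair_moment \<mu>\<^sub>G \<mu>\<^sub>S y) (\<xi>, 0)) = (\<lambda>y. blinfun_apply (local_rep c \<mu>\<^sub>G y) \<xi>)"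
    using local_rep_comp[of c "\<lambda>B. blinfun_apply B \<xi>" "\<mu>\<^sub>G"] by (simp add: pair_moment_apply)
  then have "has_strict_derivative (local_rep c (\<lambda>y. blinfun_apply (pair_moment \<mu>\<^sub>G \<mu>\<^sub>S y) (\<xi>, 0)))
      (\<lambda>v. blinfun_apply (differential c \<mu>\<^sub>G x v) \<xi>) (chart_map c x)"
    using has_strict_derivative_bounded_linear[OF \<mu>\<^sub>G_strict[OF c]
        bounded_bilinear.bounded_linear_left[OF bounded_bilinear_blinfun_apply, of \<xi>]] by simp
  from differential_eqI[OF this] show ?thesis using moment(2)[OF c, of "(\<xi>, 0)" u] by simp
qed

lemma d\<mu>\<^sub>S:
  assumes c: "c \<in> atlas M" "x \<in> chart_dom c"
  shows "differential c \<mu>\<^sub>S x u = \<omega> c x u (gen c x (0, 1))"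
  using moment(2)[OF c, of "(0, 1)" u] by (simp add: pair_moment_apply)

subsection \<open>The adjoint action\<close>

abbreviation conj_rep :: "'g \<Rightarrow> 'h \<Rightarrow> 'h" where
  "conj_rep g u \<equiv> chart_map e (g \<otimes>\<^bsub>G\<^esub> chart_inv e u \<otimes>\<^bsub>G\<^esub> inv\<^bsub>G\<^esub> g)"

abbreviation "e1 \<equiv> chart_map e \<one>\<^bsub>G\<^esub>"

lemma e1_inv: "chart_inv e e1 = \<one>\<^bsub>G\<^esub>"
  using topological_chart_inverse(1)[OF e_chart(3,2)] .

lemma chart_dom_e: "chart_dom e \<subseteq> carrier G"
  using e_chart(3) openin_subset[of "mtop N" "chart_dom e"] points_N by (simp add: topological_chart_def)

text \<open>
  Conjugation by \<open>g\<close> is the product of left translation by \<open>g\<close>, read from \<open>e\<close> to a chart around \<open>g\<close>, and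
  right translation by \<open>inv g\<close>, read from that chart back to \<open>e\<close>; the chain rule gives its derivative.
\<close>

lemma conj_rep_derivative:
  assumes g: "g \<in> carrier G"
  obtains A where "(conj_rep g has_derivative A) (at e1)"
    "\<forall>\<^sub>F u in nhds e1. u \<in> chart_image e \<and> g \<otimes>\<^bsub>G\<^esub> chart_inv e u \<otimes>\<^bsub>G\<^esub> inv\<^bsub>G\<^esub> g \<in> chart_dom e"
proof -
  obtain c1 where c1: "c1 \<in> atlas N" "g \<in> chart_dom c1" "topological_chart (mtop N) c1"
    using chart_covers[OF N_manifold] g points_N by metis
  obtain c2 where c2: "c2 \<in> atlas N" "inv\<^bsub>G\<^esub> g \<in> chart_dom c2" "topological_chart (mtop N) c2"
    using chart_covers[OF N_manifold] g points_N G.inv_closed by metis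
  have fin: "finite_dimensional TYPE('h \<times> 'h)" by (intro finite_dimensional_prod fin_h)
  have mt: "mtop (prod_manifold N N) = prod_topology (mtop N) (mtop N)" by (simp add: prod_manifold_def)
  let ?m = "\<lambda>(g, h). g \<otimes>\<^bsub>G\<^esub> h"
  let ?f1 = "local_rep (prod_chart c1 e) (chart_map c1 \<circ> ?m)"
  let ?f2 = "local_rep (prod_chart c1 c2) (chart_map e \<circ> ?m)"
  have d1: "(g, \<one>\<^bsub>G\<^esub>) \<in> chart_dom (prod_chart c1 e)" "?m (g, \<one>\<^bsub>G\<^esub>) \<in> chart_dom c1" using c1 e_chart g by auto
  have d2: "(g, inv\<^bsub>G\<^esub> g) \<in> chart_dom (prod_chart c1 c2)" "?m (g, inv\<^bsub>G\<^esub> g) \<in> chart_dom e" using c1 c2 e_chart g by auto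
  have t1: "topological_chart (mtop (prod_manifold N N)) (prod_chart c1 e)"
    and t2: "topological_chart (mtop (prod_manifold N N)) (prod_chart c1 c2)"
    unfolding mt using topological_chart_prod c1(3) c2(3) e_chart(3) by blast+
  note s1 = smooth_map_has_strict_derivative[OF fin mult_smooth prod_chart_in_atlas[OF c1(1) e_chart(1)] t1 c1(1,3) d1]
  note s2 = smooth_map_has_strict_derivative[OF fin mult_smooth prod_chart_in_atlas[OF c1(1) c2(1)] t2 e_chart(1,3) d2]
  let ?F1 = "\<lambda>u. ?f1 (chart_map c1 g, u)" and ?F2 = "\<lambda>w. ?f2 (w, chart_map c2 (inv\<^bsub>G\<^esub> g))"
  have p1: "chart_map (prod_chart c1 e) (g, \<one>\<^bsub>G\<^esub>) = (chart_map c1 g, e1)"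
    and p2: "chart_map (prod_chart c1 c2) (g, inv\<^bsub>G\<^esub> g) = (chart_map c1 g, chart_map c2 (inv\<^bsub>G\<^esub> g))" by auto
  have l1: "((\<lambda>u. (chart_map c1 g, u)) has_derivative (\<lambda>u. (0, u))) (at e1)"
    and l2: "((\<lambda>w. (w, chart_map c2 (inv\<^bsub>G\<^esub> g))) has_derivative (\<lambda>w. (w, 0))) (at (chart_map c1 g))"
    by (intro derivative_eq_intros; simp)+
  obtain B1 where B1: "(?F1 has_derivative B1) (at e1)"
    using has_derivative_compose[OF l1 strict_derivative_imp_derivative[OF s1(1)[unfolded p1]]] by blast
  obtain B2 where B2: "(?F2 has_derivative B2) (at (chart_map c1 g))"
    using has_derivative_compose[OF l2 strict_derivative_imp_derivative[OF s2(1)[unfolded p2]]] by blast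
  have im: "chart_map c1 g \<in> chart_image c1" "chart_map c2 (inv\<^bsub>G\<^esub> g) \<in> chart_image c2" "e1 \<in> chart_image e"
    using c1 c2 e_chart by auto
  have F1: "?F1 u = chart_map c1 (g \<otimes>\<^bsub>G\<^esub> chart_inv e u)" if "u \<in> chart_image e" for u
    using prod_chart_inverse[OF c1(3) e_chart(3) im(1) that] topological_chart_inverse(1)[OF c1(3,2)]
    by (simp add: local_rep_def del: prod_chart_simps)
  have F2: "?F2 w = chart_map e (chart_inv c1 w \<otimes>\<^bsub>G\<^esub> inv\<^bsub>G\<^esub> g)" if "w \<in> chart_image c1" for w
    using prod_chart_inverse[OF c1(3) c2(3) that im(2)] topological_chart_inverse(1)[OF c2(3,2)]
    by (simp add: local_rep_def del: prod_chart_simps)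
  have F1e: "?F1 e1 = chart_map c1 g" using F1[OF im(3)] e1_inv g by simp
  have B: "((\<lambda>u. ?F2 (?F1 u)) has_derivative (\<lambda>v. B2 (B1 v))) (at e1)"
    using has_derivative_compose[OF B1, of ?F2 B2] B2 F1e by simp
  have lim1: "filterlim (\<lambda>u. (chart_map c1 g, u)) (nhds (chart_map c1 g, e1)) (nhds e1)"
    by (intro tendsto_intros filterlim_ident)
  have ev1: "\<forall>\<^sub>F u in nhds e1. u \<in> chart_image e \<and> g \<otimes>\<^bsub>G\<^esub> chart_inv e u \<in> chart_dom c1"
    using eventually_compose_filterlim[OF s1(2)[unfolded p1] lim1]
  proof eventually_elim
    case (elim u)
    then have u: "u \<in> chart_image e" unfolding chart_image_prod[of c1 e] by auto
    then show ?case using elim prod_chart_inverse[OF c1(3) e_chart(3) im(1) u] topological_chart_inverse(1)[OF c1(3,2)]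
      by (simp del: prod_chart_simps)
  qed
  have "isCont ?F1 e1" using B1 by (rule has_derivative_continuous)
  then have "filterlim ?F1 (nhds (?F1 e1)) (nhds e1)"
    unfolding isCont_def by (rule tendsto_at_iff_tendsto_nhds[THEN iffD1])
  then have "filterlim ?F1 (nhds (chart_map c1 g)) (nhds e1)" unfolding F1e .
  then have lim2: "filterlim (\<lambda>u. (?F1 u, chart_map c2 (inv\<^bsub>G\<^esub> g))) (nhds (chart_map c1 g, chart_map c2 (inv\<^bsub>G\<^esub> g))) (nhds e1)"
    by (intro tendsto_intros)
  have ev2: "\<forall>\<^sub>F u in nhds e1. ?F1 u \<in> chart_image c1 \<and> chart_inv c1 (?F1 u) \<otimes>\<^bsub>G\<^esub> inv\<^bsub>G\<^esub> g \<in> chart_dom e"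
    using eventually_compose_filterlim[OF s2(2)[unfolded p2] lim2]
  proof eventually_elim
    case (elim u)
    then have u: "?F1 u \<in> chart_image c1" unfolding chart_image_prod[of c1 c2] by auto
    then show ?case using elim prod_chart_inverse[OF c1(3) c2(3) u im(2)] topological_chart_inverse(1)[OF c2(3,2)]
      by (simp del: prod_chart_simps)
  qed
  have both: "\<forall>\<^sub>F u in nhds e1. (u \<in> chart_image e \<and> g \<otimes>\<^bsub>G\<^esub> chart_inv e u \<otimes>\<^bsub>G\<^esub> inv\<^bsub>G\<^esub> g \<in> chart_dom e)
      \<and> ?F2 (?F1 u) = conj_rep g u"
    using ev1 ev2
  proof eventually_elim
    case (elim u)
    have "chart_inv c1 (?F1 u) = g \<otimes>\<^bsub>G\<^esub> chart_inv e u"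
      using elim(1) F1 topological_chart_inverse(1)[OF c1(3)] by simp
    then show ?case using elim F2[of "?F1 u"] by simp
  qed
  show thesis
  proof (rule that)
    show "(conj_rep g has_derivative (\<lambda>v. B2 (B1 v))) (at e1)"
      using B by (rule has_derivative_eventually_eq) (use both in \<open>rule eventually_mono\<close>, simp)
    show "\<forall>\<^sub>F u in nhds e1. u \<in> chart_image e \<and> g \<otimes>\<^bsub>G\<^esub> chart_inv e u \<otimes>\<^bsub>G\<^esub> inv\<^bsub>G\<^esub> g \<in> chart_dom e"
      using both by (rule eventually_mono) simp
  qed
qed

lemma conj_rep_inverse:
  assumes g: "g \<in> carrier G" and A: "(conj_rep g has_derivative A) (at e1)"
    and B: "(conj_rep (inv\<^bsub>G\<^esub> g) has_derivative B) (at e1)"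
  shows "B (A v) = v"
proof -
  have e1: "conj_rep g e1 = e1" using g by (simp add: e1_inv)
  have 1: "((\<lambda>u. conj_rep (inv\<^bsub>G\<^esub> g) (conj_rep g u)) has_derivative (\<lambda>v. B (A v))) (at e1)"
    using has_derivative_compose[OF A, of "conj_rep (inv\<^bsub>G\<^esub> g)" B] B e1 by simp
  obtain A' where "\<forall>\<^sub>F u in nhds e1. u \<in> chart_image e \<and> g \<otimes>\<^bsub>G\<^esub> chart_inv e u \<otimes>\<^bsub>G\<^esub> inv\<^bsub>G\<^esub> g \<in> chart_dom e"
    using conj_rep_derivative[OF g] by blast
  then have "\<forall>\<^sub>F u in nhds e1. conj_rep (inv\<^bsub>G\<^esub> g) (conj_rep g u) = u"
  proof eventually_elim
    case (elim u)
    let ?h = "chart_inv e u"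
    have h: "?h \<in> carrier G" using elim topological_chart_inverse(3)[OF e_chart(3)] chart_dom_e by blast
    have "chart_inv e (conj_rep g u) = g \<otimes>\<^bsub>G\<^esub> ?h \<otimes>\<^bsub>G\<^esub> inv\<^bsub>G\<^esub> g"
      using elim topological_chart_inverse(1)[OF e_chart(3)] by blast
    moreover have "inv\<^bsub>G\<^esub> g \<otimes>\<^bsub>G\<^esub> (g \<otimes>\<^bsub>G\<^esub> ?h \<otimes>\<^bsub>G\<^esub> inv\<^bsub>G\<^esub> g) \<otimes>\<^bsub>G\<^esub> inv\<^bsub>G\<^esub> (inv\<^bsub>G\<^esub> g) = ?h"
      using g h by (simp add: G.m_assoc G.inv_solve_left')
    ultimately show ?case using elim topological_chart_inverse(2)[OF e_chart(3)] by simp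
  qed
  with 1 have "((\<lambda>u. u) has_derivative (\<lambda>v. B (A v))) (at e1)" by (rule has_derivative_eventually_eq)
  then have "(\<lambda>v. B (A v)) = (\<lambda>v. v)" using has_derivative_ident by (rule has_derivative_unique)
  then show ?thesis by metis
qed

text \<open>
  The circle is abelian and commutes with \<open>G\<close>, so the adjoint action of \<open>G \<times> S\<^sup>1\<close> fixes the circle direction and
  is the one of \<open>G\<close> on the other factor. Equivariance of the moment map therefore splits into invariance of
  \<open>\<mu>\<^sub>S\<close> and equivariance of \<open>\<mu>\<^sub>G\<close>.
\<close>

lemma Ad_eq:
  assumes g: "g \<in> carrier G" and t: "t \<in> sphere 0 1" and A: "(conj_rep g has_derivative A) (at e1)"
  shows "Ad K eK (g, t) (\<xi>, \<tau>) = (A \<xi>, \<tau>)"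
proof -
  let ?F = "\<lambda>h. chart_map eK ((g, t) \<otimes>\<^bsub>K\<^esub> h \<otimes>\<^bsub>K\<^esub> inv\<^bsub>K\<^esub> (g, t))"
  have inv: "inv\<^bsub>K\<^esub> (g, t) = (inv\<^bsub>G\<^esub> g, inv\<^bsub>circle_group\<^esub> t)"
    using inv_DirProd[OF G.is_group S.is_group g] t by simp
  have tt: "t * z * inv\<^bsub>circle_group\<^esub> t = z" for z
    using S.r_inv[of t] t by (simp add: mult.commute mult.left_commute)
  have "\<forall>\<^sub>F p in nhds unit_coord. p \<in> chart_image e \<times> {-pi<..<pi}"
    using e_chart by (intro eventually_nhds_in_open open_Times) (auto simp: topological_chart_def)
  then have ev: "\<forall>\<^sub>F p in nhds unit_coord. (\<lambda>(u, \<tau>). (conj_rep g u, \<tau>)) p = local_rep eK ?F p"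
  proof eventually_elim
    case (elim p)
    obtain u \<tau> where p: "p = (u, \<tau>)" "u \<in> chart_image e" "\<tau> \<in> {-pi<..<pi}" using elim by auto
    have "?F (chart_inv eK p) = (conj_rep g u, chart_map angle (cis \<tau>))"
      unfolding p(1) eK_inv(2)[OF p(2,3)] inv by (simp add: tt)
    also have "chart_map angle (cis \<tau>) = \<tau>"
      using angle_chart_inverse[OF p(3)] topological_chart_inverse(2)[OF topological_chart_angle, of \<tau>] by simp
    finally show ?case by (simp add: local_rep_def p(1))
  qed
  have "((\<lambda>p. (conj_rep g (fst p), snd p)) has_derivative (\<lambda>p. (A (fst p), snd p))) (at unit_coord)"
  proof (intro has_derivative_Pair has_derivative_snd has_derivative_ident)
    have "((\<lambda>p. fst p) has_derivative fst) (at unit_coord)" by (intro has_derivative_fst has_derivative_ident)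
    from has_derivative_compose[OF this, of "conj_rep g" A] A
    show "((\<lambda>p. conj_rep g (fst p)) has_derivative (\<lambda>p. A (fst p))) (at unit_coord)" by simp
  qed
  then have "(local_rep eK ?F has_derivative (\<lambda>p. (A (fst p), snd p))) (at unit_coord)"
    by (rule has_derivative_eventually_eq) (use ev in \<open>simp add: case_prod_unfold\<close>)
  from frechet_derivative_at[OF this] show ?thesis
    unfolding Ad_def differential_def one_DirProd using eK_one(2) by (simp del: prod_chart_simps) (metis fst_conv snd_conv)
qed

lemma moment_equivariant:
  assumes g: "g \<in> carrier G" and t: "t \<in> sphere 0 1" and x: "x \<in> points M"
    and A: "(conj_rep g has_derivative A) (at e1)"
  shows "blinfun_apply (\<mu>\<^sub>G (act (g, t) x)) (A \<xi>) + \<tau> * \<mu>\<^sub>S (act (g, t) x) = blinfun_apply (\<mu>\<^sub>G x) \<xi> + \<tau> * \<mu>\<^sub>S x"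
  using moment(3)[of "(g, t)" x "(\<xi>, \<tau>)"] assms by (simp add: Ad_eq pair_moment_apply)

lemma \<mu>\<^sub>S_invariant:
  assumes g: "g \<in> carrier G" and t: "t \<in> sphere 0 1" and x: "x \<in> points M"
  shows "\<mu>\<^sub>S (act (g, t) x) = \<mu>\<^sub>S x"
proof -
  obtain A where A: "(conj_rep g has_derivative A) (at e1)" using conj_rep_derivative[OF g] by blast
  have "A 0 = 0" using has_derivative_linear[OF A] by (rule linear_0)
  then show ?thesis using moment_equivariant[OF g t x A, of 0 1] by (simp add: blinfun.bilinear_simps)
qed

lemma \<mu>\<^sub>G_zero_invariant:
  assumes g: "g \<in> carrier G" and t: "t \<in> sphere 0 1" and x: "x \<in> points M" and zero: "\<mu>\<^sub>G x = 0"
  shows "\<mu>\<^sub>G (act (g, t) x) = 0"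
proof (rule blinfun_eqI)
  fix \<xi>
  obtain A where A: "(conj_rep g has_derivative A) (at e1)" using conj_rep_derivative[OF g] by blast
  obtain B where B: "(conj_rep (inv\<^bsub>G\<^esub> g) has_derivative B) (at e1)" using conj_rep_derivative[OF G.inv_closed[OF g]] by blast
  have "A (B \<xi>) = \<xi>" using conj_rep_inverse[OF G.inv_closed[OF g] B] A g by simp
  then show "blinfun_apply (\<mu>\<^sub>G (act (g, t) x)) \<xi> = blinfun_apply 0 \<xi>"
    using moment_equivariant[OF g t x A, of "B \<xi>" 0] zero by simp
qed

end

section \<open>Infinitesimal geometry of the hyper-reduction\<close>

locale hyper_reduction_setup = hamiltonian_setup G N e M \<omega> I act \<mu>\<^sub>G \<mu>\<^sub>S
  for G :: "'g monoid"
    and N :: "('g, 'h::real_normed_vector) manifold"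
    and e :: "('g, 'h) chart"
    and M :: "('m, 'e::real_normed_vector) manifold"
    and \<omega> :: "('m, 'e) bilinear_field"
    and I :: "('m, 'e) endo_field"
    and act :: "'g \<times> complex \<Rightarrow> 'm \<Rightarrow> 'm"
    and \<mu>\<^sub>G :: "'m \<Rightarrow> 'h \<Rightarrow>\<^sub>L real"
    and \<mu>\<^sub>S :: "'m \<Rightarrow> real" +
  fixes cscale :: "complex \<Rightarrow> 'v::real_normed_vector \<Rightarrow> 'v"
    and s :: "'m \<Rightarrow> 'v"
    and d :: nat
  assumes complex_V: "complex_space cscale"
    and hol: "holomorphic_function M I cscale s"
    and s_inv: "\<And>g x. g \<in> carrier G \<Longrightarrow> x \<in> points M \<Longrightarrow> s (act (g, 1) x) = s x"
    and d_pos: "d > 0"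
    and s_hom: "\<And>t x. t \<in> carrier circle_group \<Longrightarrow> x \<in> points M \<Longrightarrow>
           s (act (\<one>\<^bsub>G\<^esub>, t) x) = cscale (t ^ d) (s x)"
    and regular_s: "regular_value M s 0" and regular_\<mu>: "regular_value M \<mu>\<^sub>G 0"
    and transverse: "transverse_in M (zero_set M \<mu>\<^sub>G) (zero_set M s)"
    and free: "\<And>x. x \<in> zero_set M \<mu>\<^sub>G \<Longrightarrow> stabilizer G (\<lambda>g. act (g, 1)) x = {\<one>\<^bsub>G\<^esub>}"
begin

lemma chart_point: "c \<in> atlas M \<Longrightarrow> x \<in> chart_dom c \<Longrightarrow> x \<in> points M"
  using chart_dom_points by blast

lemma cscale_i_i: "cscale \<i> (cscale \<i> v) = - v"
proof -
  interpret V: vector_space cscale using complex_V by (simp add: complex_space_def)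
  have "cscale \<i> (cscale \<i> v) = cscale (- 1) v" by (simp add: V.scale_scale)
  also have "\<dots> = - v" by simp
  finally show ?thesis .
qed

lemma cscale_real: "cscale (complex_of_real r) v = r *\<^sub>R v"
  using complex_V by (simp add: complex_space_def)

lemma cscale_cis: "cscale (cis \<theta>) v = cos \<theta> *\<^sub>R v + sin \<theta> *\<^sub>R cscale \<i> v"
proof -
  interpret V: vector_space cscale using complex_V by (simp add: complex_space_def)
  have "cis \<theta> = complex_of_real (cos \<theta>) + complex_of_real (sin \<theta>) * \<i>"
    by (simp add: complex_eq_iff)
  then have "cscale (cis \<theta>) v = cscale (complex_of_real (cos \<theta>)) v + cscale (complex_of_real (sin \<theta>)) (cscale \<i> v)"
    by (simp add: V.scale_left_distrib)
  then show ?thesis by (simp only: cscale_real)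
qed

lemma s_strict:
  assumes c: "c \<in> atlas M" "x \<in> chart_dom c"
  shows "has_strict_derivative (local_rep c s) (differential c s x) (chart_map c x)"
  using M_manifold _ c by (rule smooth_function_has_strict_derivative) (use hol in \<open>simp add: holomorphic_function_def\<close>)

lemma ds_I:
  assumes "c \<in> atlas M" "x \<in> chart_dom c"
  shows "differential c s x (I c x u) = cscale \<i> (differential c s x u)"
  using hol assms by (simp add: holomorphic_function_def)

lemma ds_gen:
  assumes c: "c \<in> atlas M" "x \<in> chart_dom c"
  shows "differential c s x (gen c x (\<xi>, 0)) = 0"
  using invariant_derivative_G[OF c strict_derivative_imp_derivative[OF s_strict[OF c]]] s_inv c chart_dom_points by blast

text \<open>
  The homogeneity of \<open>s\<close>, differentiated at the unit of the circle.
\<close>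

lemma ds_circle:
  assumes c: "c \<in> atlas M" "x \<in> chart_dom c"
  shows "differential c s x (gen c x (0, 1)) = real d *\<^sub>R cscale \<i> (s x)"
proof -
  have x: "x \<in> points M" using c chart_dom_points by blast
  have 1: "((\<lambda>\<tau>. s (act (\<one>\<^bsub>G\<^esub>, cis \<tau>) x)) has_derivative (\<lambda>\<tau>. differential c s x (gen c x (0, \<tau>)))) (at 0)"
    using circle_derivative[OF c strict_derivative_imp_derivative[OF s_strict[OF c]]] .
  have eq: "s (act (\<one>\<^bsub>G\<^esub>, cis \<tau>) x) = cos (real d * \<tau>) *\<^sub>R s x + sin (real d * \<tau>) *\<^sub>R cscale \<i> (s x)" for \<tau>
  proof -
    have "s (act (\<one>\<^bsub>G\<^esub>, cis \<tau>) x) = cscale (cis \<tau> ^ d) (s x)" using s_hom[OF _ x, of "cis \<tau>"] by simp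
    also have "cis \<tau> ^ d = cis (real d * \<tau>)" by (rule Complex.DeMoivre)
    also have "cscale (cis (real d * \<tau>)) (s x) = cos (real d * \<tau>) *\<^sub>R s x + sin (real d * \<tau>) *\<^sub>R cscale \<i> (s x)"
      by (rule cscale_cis)
    finally show ?thesis .
  qed
  have "((\<lambda>\<tau>. cos (real d * \<tau>) *\<^sub>R s x + sin (real d * \<tau>) *\<^sub>R cscale \<i> (s x)) has_derivative (\<lambda>\<tau>. (real d * \<tau>) *\<^sub>R cscale \<i> (s x))) (at 0)"
    by (rule derivative_eq_intros | rule refl | simp)+
  then have "(\<lambda>\<tau>. differential c s x (gen c x (0, \<tau>))) = (\<lambda>\<tau>. (real d * \<tau>) *\<^sub>R cscale \<i> (s x))"
    using has_derivative_unique 1 unfolding eq by blast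
  from fun_cong[OF this, of 1] show ?thesis by simp
qed

lemma d\<mu>\<^sub>S_gen:
  assumes c: "c \<in> atlas M" "x \<in> chart_dom c"
  shows "differential c \<mu>\<^sub>S x (gen c x (\<xi>, 0)) = 0"
proof (rule invariant_derivative_G[OF c strict_derivative_imp_derivative[OF \<mu>\<^sub>S_strict[OF c]]])
  show "\<mu>\<^sub>S (act (g, 1) x) = \<mu>\<^sub>S x" if "g \<in> carrier G" for g
    using \<mu>\<^sub>S_invariant[OF that, of 1 x] chart_point[OF c] by simp
qed

lemma d\<mu>\<^sub>G_gen:
  assumes c: "c \<in> atlas M" "x \<in> chart_dom c" and x: "\<mu>\<^sub>G x = 0"
  shows "differential c \<mu>\<^sub>G x (gen c x (\<xi>, 0)) = 0"
proof (rule invariant_derivative_G[OF c strict_derivative_imp_derivative[OF \<mu>\<^sub>G_strict[OF c]]])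
  show "\<mu>\<^sub>G (act (g, 1) x) = \<mu>\<^sub>G x" if "g \<in> carrier G" for g
    using \<mu>\<^sub>G_zero_invariant[OF that, of 1 x] chart_point[OF c] x by simp
qed

lemma d\<mu>\<^sub>G_surj:
  assumes c: "c \<in> atlas M" "x \<in> chart_dom c" and x: "\<mu>\<^sub>G x = 0"
  shows "surj (differential c \<mu>\<^sub>G x)"
  using regular_\<mu> c x chart_point[OF c] unfolding regular_value_def charts_at_def by blast

lemma ds_surj:
  assumes c: "c \<in> atlas M" "x \<in> chart_dom c" and x: "s x = 0"
  shows "surj (differential c s x)"
  using regular_s c x chart_point[OF c] unfolding regular_value_def charts_at_def by blast

lemma \<omega>_facts:
  assumes c: "c \<in> atlas M" "x \<in> chart_dom c"
  shows "linear (\<omega> c x u)" "linear (\<lambda>u. \<omega> c x u w)" "\<omega> c x u w = - \<omega> c x w u"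
    "linear (I c x)" "I c x (I c x u) = - u" "\<omega> c x u (I c x w) = \<omega> c x w (I c x u)"
    "u \<noteq> 0 \<Longrightarrow> \<omega> c x u (I c x u) > 0"
proof -
  have bil: "bilinear (\<omega> c x)" and alt: "\<And>u. \<omega> c x u u = 0"
    using kaehler c by (auto simp: almost_kaehler_def symplectic_manifold_def closed_two_form_def two_form_def)
  show l: "linear (\<omega> c x u)" "linear (\<lambda>u. \<omega> c x u w)" for u w using bil by (auto simp: bilinear_def)
  have "\<omega> c x (u + w) (u + w) = \<omega> c x u u + \<omega> c x u w + (\<omega> c x w u + \<omega> c x w w)"
    using linear_add[OF l(1)] linear_add[OF l(2)] by simp
  then show "\<omega> c x u w = - \<omega> c x w u" using alt by simp
  show "linear (I c x)" "I c x (I c x u) = - u"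
    using kaehler c by (auto simp: almost_kaehler_def almost_complex_structure_def)
  show "\<omega> c x u (I c x w) = \<omega> c x w (I c x u)" "u \<noteq> 0 \<Longrightarrow> \<omega> c x u (I c x u) > 0"
    using kaehler c by (auto simp: almost_kaehler_def)
qed

lemma gen_linear:
  assumes c: "c \<in> atlas M" "x \<in> chart_dom c"
  shows "linear (\<lambda>\<xi>. gen c x (\<xi>, 0))"
proof -
  have "linear (\<lambda>\<xi>::'h. (\<xi>, 0::real))" by (auto intro!: linearI)
  from linear_compose[OF this bounded_linear.linear[OF gen_bounded_linear[OF c]]] show ?thesis by (simp add: o_def)
qed

text \<open>
  Regularity of \<open>\<mu>\<^sub>G\<close> at \<open>0\<close> makes the infinitesimal action of \<open>G\<close> injective: if \<open>\<xi>\<close> acts trivially at \<open>x\<close>, then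
  every value \<open>\<langle>d\<mu>\<^sub>G u, \<xi>\<rangle> = \<omega>(u, \<xi> x)\<close> vanishes, and \<open>d\<mu>\<^sub>G\<close> is onto. A left inverse \<open>\<Lambda>\<close> serves as the linear
  equation of a slice: its kernel is a complement of the orbit direction.
\<close>

lemma gen_left_inverse:
  assumes c: "c \<in> atlas M" "x \<in> chart_dom c" and x: "\<mu>\<^sub>G x = 0"
  obtains \<Lambda> where "bounded_linear \<Lambda>" "\<And>\<xi>. \<Lambda> (gen c x (\<xi>, 0)) = \<xi>"
proof -
  have "\<xi> = 0" if "gen c x (\<xi>, 0) = 0" for \<xi>
  proof (rule finite_dimensional_blinfun_separates[OF fin_h])
    fix \<beta> :: "'h \<Rightarrow>\<^sub>L real"
    obtain u where "\<beta> = differential c \<mu>\<^sub>G x u" using d\<mu>\<^sub>G_surj[OF c x] by (metis surjD)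
    then show "blinfun_apply \<beta> \<xi> = 0" using d\<mu>\<^sub>G[OF c, of u \<xi>] that linear_0[OF \<omega>_facts(1)[OF c]] by simp
  qed
  then have "inj (\<lambda>\<xi>. gen c x (\<xi>, 0))" using linear_injective_0[OF gen_linear[OF c]] by blast
  then obtain \<Lambda> where L: "linear \<Lambda>" "\<Lambda> \<circ> (\<lambda>\<xi>. gen c x (\<xi>, 0)) = id"
    using linear_injective_left_inverse[OF gen_linear[OF c]] by blast
  show thesis
  proof (rule that)
    show "bounded_linear \<Lambda>" using fin_e L(1) by (rule finite_dimensional_bounded_linear)
    show "\<Lambda> (gen c x (\<xi>, 0)) = \<xi>" for \<xi> using fun_cong[OF L(2), of \<xi>] by simp
  qed
qed

text \<open>
  The key computation. Let \<open>X\<close> be the circle generator, \<open>Xh\<close> its component orthogonal to the \<open>G\<close>-orbit for the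
  metric \<open>\<omega>(u, I w)\<close>, and \<open>v0 = I Xh\<close>. Orthogonality to the orbit says exactly that \<open>d\<mu>\<^sub>G v0 = 0\<close>. Next,
  \<open>d\<mu>\<^sub>S v0 = -\<bar>Xh\<bar>\<^sup>2\<close>. As \<open>s\<close> is \<open>G\<close>-invariant, holomorphic and homogeneous, \<open>ds v0 = \<i> ds X = \<i> (\<i> d s) = -d s\<close>;
  this also shows that \<open>Xh\<close> is not \<open>0\<close> where \<open>s\<close> is not. Subtracting an orbit direction, along which \<open>\<mu>\<^sub>G\<close>, \<open>\<mu>\<^sub>S\<close> and
  \<open>s\<close> are stationary, moves the vector into the kernel of \<open>\<Lambda>\<close>, that is, makes it tangent to the slice.
\<close>

lemma descent_direction:
  assumes c: "c \<in> atlas M" "x \<in> chart_dom c" and x: "\<mu>\<^sub>G x = 0" "s x \<noteq> 0"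
    and \<Lambda>: "bounded_linear \<Lambda>" "\<And>\<xi>. \<Lambda> (gen c x (\<xi>, 0)) = \<xi>"
  obtains v where "differential c \<mu>\<^sub>G x v = 0" "\<Lambda> v = 0" "differential c \<mu>\<^sub>S x v < 0"
    "differential c s x v = - (real d *\<^sub>R s x)"
proof -
  note W = \<omega>_facts[OF c]
  let ?g = "\<lambda>u w. \<omega> c x u (I c x w)" and ?gen = "\<lambda>\<xi>. gen c x (\<xi>, 0)"
  let ?X = "gen c x (0, 1)"
  obtain B :: "'h set" where B: "finite B" "span B = UNIV" using fin_h by (auto simp: finite_dimensional_def)
  have span: "span (?gen ` B) = range ?gen" using linear_span_image[OF gen_linear[OF c], of B] B(2) by simp
  have "linear (?g u)" for u using linear_compose[OF W(4) W(1)[of u]] by (simp add: o_def)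
  then have "\<exists>w\<in>span (?gen ` B). \<forall>w'\<in>span (?gen ` B). ?g (?X - w) w' = 0"
    using W(2,6,7) B(1) by (intro orthogonal_projection_exists) auto
  then obtain \<xi>0 where \<xi>0: "\<And>\<xi>. ?g (?X - ?gen \<xi>0) (?gen \<xi>) = 0" unfolding span by blast
  define Xh where "Xh = ?X - ?gen \<xi>0"
  define v0 where "v0 = I c x Xh"
  have lin_s: "linear (differential c s x)" and lin_S: "linear (differential c \<mu>\<^sub>S x)" and lin_G: "linear (differential c \<mu>\<^sub>G x)"
    using s_strict[OF c] \<mu>\<^sub>S_strict[OF c] \<mu>\<^sub>G_strict[OF c]
    by (auto simp: has_strict_derivative_def bounded_linear.linear)
  interpret V: vector_space cscale using complex_V by (simp add: complex_space_def)
  have ds_Xh: "differential c s x Xh = real d *\<^sub>R cscale \<i> (s x)"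
    unfolding Xh_def using lin_s by (simp add: linear_diff ds_circle[OF c] ds_gen[OF c])
  have "cscale \<i> (s x) \<noteq> 0" using cscale_i_i[of "s x"] x(2) by auto
  then have "differential c s x Xh \<noteq> 0" using d_pos by (simp add: ds_Xh)
  then have Xh: "Xh \<noteq> 0" using linear_0[OF lin_s] by metis
  have G0: "differential c \<mu>\<^sub>G x v0 = 0"
  proof (rule blinfun_eqI)
    fix \<xi>
    have "blinfun_apply (differential c \<mu>\<^sub>G x v0) \<xi> = \<omega> c x v0 (?gen \<xi>)" by (rule d\<mu>\<^sub>G[OF c])
    also have "\<dots> = - ?g (?gen \<xi>) Xh" unfolding v0_def by (rule W(3))
    also have "\<dots> = - ?g Xh (?gen \<xi>)" using W(6)[of "?gen \<xi>" Xh] by simp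
    finally show "blinfun_apply (differential c \<mu>\<^sub>G x v0) \<xi> = blinfun_apply 0 \<xi>" using \<xi>0[of \<xi>] by (simp add: Xh_def)
  qed
  have S0: "differential c \<mu>\<^sub>S x v0 < 0"
  proof -
    have "differential c \<mu>\<^sub>S x v0 = \<omega> c x v0 ?X" by (rule d\<mu>\<^sub>S[OF c])
    also have "\<dots> = - ?g ?X Xh" unfolding v0_def by (rule W(3))
    also have "?X = Xh + ?gen \<xi>0" by (simp add: Xh_def)
    also have "?g (Xh + ?gen \<xi>0) Xh = ?g Xh Xh + ?g (?gen \<xi>0) Xh" using linear_add[OF W(2)] .
    also have "?g (?gen \<xi>0) Xh = 0" using W(6)[of "?gen \<xi>0" Xh] \<xi>0[of \<xi>0] by (simp add: Xh_def)
    finally show ?thesis using W(7)[OF Xh] by simp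
  qed
  have s0: "differential c s x v0 = - (real d *\<^sub>R s x)"
  proof -
    have "differential c s x v0 = cscale \<i> (real d *\<^sub>R cscale \<i> (s x))" unfolding v0_def ds_I[OF c] ds_Xh ..
    also have "\<dots> = real d *\<^sub>R cscale \<i> (cscale \<i> (s x))"
      unfolding cscale_real[symmetric] by (simp add: V.scale_scale mult.commute)
    finally show ?thesis by (simp add: cscale_i_i)
  qed
  show thesis
  proof (rule that[of "v0 - ?gen (\<Lambda> v0)"])
    show "differential c \<mu>\<^sub>G x (v0 - ?gen (\<Lambda> v0)) = 0" using lin_G G0 d\<mu>\<^sub>G_gen[OF c x(1)] by (simp add: linear_diff)
    show "\<Lambda> (v0 - ?gen (\<Lambda> v0)) = 0" using bounded_linear.linear[OF \<Lambda>(1)] \<Lambda>(2) by (simp add: linear_diff)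
    show "differential c \<mu>\<^sub>S x (v0 - ?gen (\<Lambda> v0)) < 0" using lin_S S0 d\<mu>\<^sub>S_gen[OF c] by (simp add: linear_diff)
    show "differential c s x (v0 - ?gen (\<Lambda> v0)) = - (real d *\<^sub>R s x)" using lin_s s0 ds_gen[OF c] by (simp add: linear_diff)
  qed
qed

lemma tangent_vector_kernel:
  assumes c: "c \<in> atlas M" "x \<in> chart_dom c" and f: "has_strict_derivative (local_rep c f) (differential c f x) (chart_map c x)"
    and u: "u \<in> tangent_space_of c (zero_set M f) x"
  shows "differential c f x u = 0"
proof -
  obtain \<gamma> \<epsilon> where \<gamma>: "\<epsilon> > 0" "\<gamma> 0 = x" "\<gamma> ` {-\<epsilon><..<\<epsilon>} \<subseteq> zero_set M f \<inter> chart_dom c"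
    "((chart_map c \<circ> \<gamma>) has_vector_derivative u) (at (0::real))"
    using u by (auto simp: tangent_space_of_def)
  have 1: "(chart_map c \<circ> \<gamma> has_derivative (\<lambda>t. t *\<^sub>R u)) (at 0)" using \<gamma>(4) by (simp add: has_vector_derivative_def)
  have "(local_rep c f has_derivative differential c f x) (at ((chart_map c \<circ> \<gamma>) 0))"
    using strict_derivative_imp_derivative[OF f] \<gamma>(2) by simp
  from has_derivative_compose[OF 1 this]
  have D: "((\<lambda>t. local_rep c f ((chart_map c \<circ> \<gamma>) t)) has_derivative (\<lambda>t. differential c f x (t *\<^sub>R u))) (at 0)" .
  have "\<forall>\<^sub>F t in nhds (0::real). t \<in> {-\<epsilon><..<\<epsilon>}" using \<gamma>(1) by (intro eventually_nhds_in_open) auto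
  then have "\<forall>\<^sub>F t in nhds (0::real). local_rep c f ((chart_map c \<circ> \<gamma>) t) = 0"
  proof eventually_elim
    case (elim t)
    then have "\<gamma> t \<in> zero_set M f" "\<gamma> t \<in> chart_dom c" using \<gamma>(3) by auto
    then show ?case using topological_chart_inverse(1)[OF M_chart[OF c(1)]] by (simp add: local_rep_def zero_set_def)
  qed
  with D have "((\<lambda>t. 0) has_derivative (\<lambda>t. differential c f x (t *\<^sub>R u))) (at (0::real))" by (rule has_derivative_eventually_eq)
  then have "(\<lambda>t::real. differential c f x (t *\<^sub>R u)) = (\<lambda>t. 0)" using has_derivative_const by (rule has_derivative_unique)
  from fun_cong[OF this, of 1] show ?thesis by simp
qed

text \<open>
  At a common zero the tangent spaces of the two zero sets lie in the kernels of \<open>d\<mu>\<^sub>G\<close> and \<open>ds\<close>. By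
  transversality these kernels span, so the two surjections \<open>d\<mu>\<^sub>G\<close> and \<open>ds\<close> are jointly onto. A component along the
  orbit, invisible to both, then adjusts the value of \<open>\<Lambda>\<close>.
\<close>

lemma joint_surj:
  assumes c: "c \<in> atlas M" "x \<in> chart_dom c" and x: "\<mu>\<^sub>G x = 0" "s x = 0"
    and \<Lambda>: "bounded_linear \<Lambda>" "\<And>\<xi>. \<Lambda> (gen c x (\<xi>, 0)) = \<xi>"
  shows "surj (\<lambda>v. ((differential c \<mu>\<^sub>G x v, \<Lambda> v), differential c s x v))"
proof -
  let ?P = "zero_set M \<mu>\<^sub>G" and ?Z = "zero_set M s"
  have xM: "x \<in> ?P \<inter> ?Z" using chart_point[OF c] x by (simp add: zero_set_def)
  have cx: "c \<in> charts_at M x" using c by (simp add: charts_at_def)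
  have lin_s: "linear (differential c s x)" and lin_G: "linear (differential c \<mu>\<^sub>G x)" and lin_L: "linear \<Lambda>"
    using s_strict[OF c] \<mu>\<^sub>G_strict[OF c] \<Lambda>(1) by (auto simp: has_strict_derivative_def bounded_linear.linear)
  have split: "\<exists>p q. w = p + q \<and> differential c \<mu>\<^sub>G x p = 0 \<and> differential c s x q = 0" for w
  proof -
    have "w \<in> {u + v | u v. u \<in> tangent_space_of c ?P x \<and> v \<in> tangent_space_of c ?Z x}"
      using transverse xM cx unfolding transverse_in_def by blast
    then show ?thesis
      using tangent_vector_kernel[OF c \<mu>\<^sub>G_strict[OF c]] tangent_vector_kernel[OF c s_strict[OF c]] by blast
  qed
  have "\<exists>v. ((differential c \<mu>\<^sub>G x v, \<Lambda> v), differential c s x v) = ((\<beta>, \<eta>), z)" for \<beta> \<eta> z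
  proof -
    obtain w1 where w1: "differential c \<mu>\<^sub>G x w1 = \<beta>" using d\<mu>\<^sub>G_surj[OF c x(1)] by (metis surjD)
    obtain w2 where w2: "differential c s x w2 = z" using ds_surj[OF c x(2)] by (metis surjD)
    obtain p1 q1 where 1: "w1 = p1 + q1" "differential c \<mu>\<^sub>G x p1 = 0" "differential c s x q1 = 0" using split by blast
    obtain p2 q2 where 2: "w2 = p2 + q2" "differential c \<mu>\<^sub>G x p2 = 0" "differential c s x q2 = 0" using split by blast
    let ?v = "q1 + p2"
    have v: "differential c \<mu>\<^sub>G x ?v = \<beta>" "differential c s x ?v = z"
      using w1 w2 1 2 lin_G lin_s by (simp_all add: linear_add)
    let ?u = "?v + gen c x (\<eta> - \<Lambda> ?v, 0)"
    have "differential c \<mu>\<^sub>G x ?u = \<beta>" using lin_G v(1) d\<mu>\<^sub>G_gen[OF c x(1)] by (simp add: linear_add)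
    moreover have "differential c s x ?u = z" using lin_s v(2) ds_gen[OF c] by (simp add: linear_add)
    moreover have "\<Lambda> ?u = \<eta>" using linear_add[OF lin_L, of ?v] \<Lambda>(2) by simp
    ultimately show ?thesis by blast
  qed
  then show ?thesis unfolding surj_def by (metis prod.exhaust)
qed

lemma slice_surj:
  assumes c: "c \<in> atlas M" "x \<in> chart_dom c" and x: "\<mu>\<^sub>G x = 0"
    and \<Lambda>: "bounded_linear \<Lambda>" "\<And>\<xi>. \<Lambda> (gen c x (\<xi>, 0)) = \<xi>"
  shows "surj (\<lambda>v. (differential c \<mu>\<^sub>G x v, \<Lambda> v))"
proof -
  have lin_G: "linear (differential c \<mu>\<^sub>G x)" and lin_L: "linear \<Lambda>"
    using \<mu>\<^sub>G_strict[OF c] \<Lambda>(1) by (auto simp: has_strict_derivative_def bounded_linear.linear)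
  have "\<exists>v. (differential c \<mu>\<^sub>G x v, \<Lambda> v) = (\<beta>, \<eta>)" for \<beta> \<eta>
  proof -
    obtain v where v: "differential c \<mu>\<^sub>G x v = \<beta>" using d\<mu>\<^sub>G_surj[OF c x] by (metis surjD)
    let ?u = "v + gen c x (\<eta> - \<Lambda> v, 0)"
    have "differential c \<mu>\<^sub>G x ?u = \<beta>" using lin_G v d\<mu>\<^sub>G_gen[OF c x] by (simp add: linear_add)
    moreover have "\<Lambda> ?u = \<eta>" using linear_add[OF lin_L, of v] \<Lambda>(2) by simp
    ultimately show ?thesis by blast
  qed
  then show ?thesis unfolding surj_def by (metis prod.exhaust)
qed

end

section \<open>Slices\<close>

context hyper_reduction_setup
begin

interpretation G: group G by (rule group_G)

abbreviation "P \<equiv> zero_set M \<mu>\<^sub>G"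
abbreviation "act_G \<equiv> \<lambda>g. act (g, 1)"

lemma chart_function_continuous:
  assumes f: "\<And>c x. c \<in> atlas M \<Longrightarrow> x \<in> chart_dom c \<Longrightarrow> isCont (local_rep c f) (chart_map c x)"
  shows "continuous_map T euclidean f"
proof -
  have "\<exists>V. openin T V \<and> x \<in> V \<and> V \<subseteq> {x \<in> points M. f x \<in> U}" if U: "open U" and x: "x \<in> points M" "f x \<in> U" for U x
  proof -
    obtain c where c: "c \<in> atlas M" "x \<in> chart_dom c" using chart_exists[OF x(1)] .
    note inv = topological_chart_inverse[OF M_chart[OF c(1)]]
    have "local_rep c f (chart_map c x) = f x" using inv(1)[OF c(2)] by (simp add: local_rep_def)
    then have "\<forall>\<^sub>F y in nhds (chart_map c x). local_rep c f y \<in> U"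
      using f[OF c] U x(2) tendsto_at_iff_tendsto_nhds[of "local_rep c f" "chart_map c x", THEN iffD1]
      by (auto simp: isCont_def tendsto_def)
    then obtain W where W: "open W" "chart_map c x \<in> W" "\<And>y. y \<in> W \<Longrightarrow> local_rep c f y \<in> U"
      unfolding eventually_nhds by blast
    let ?V = "{z \<in> chart_dom c. chart_map c z \<in> W}"
    have "openin T ?V" using M_chart[OF c(1)] W(1) by (rule chart_preimage_open)
    moreover have "?V \<subseteq> {x \<in> points M. f x \<in> U}"
    proof
      fix z assume z: "z \<in> ?V"
      then have "local_rep c f (chart_map c z) = f z" using inv(1) by (simp add: local_rep_def)
      then show "z \<in> {x \<in> points M. f x \<in> U}" using z W(3)[of "chart_map c z"] chart_point[OF c(1)] by auto
    qed
    ultimately show ?thesis using c(2) W(2) by blast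
  qed
  then have "openin T {x \<in> points M. f x \<in> U}" if "open U" for U
    using that by (subst openin_subopen) blast
  then show ?thesis by (auto simp: continuous_map_def)
qed

lemma s_cont: "continuous_map T euclidean s"
  using chart_function_continuous has_strict_derivative_isCont s_strict by blast

lemma \<mu>\<^sub>S_cont: "continuous_map T euclidean \<mu>\<^sub>S"
  using chart_function_continuous has_strict_derivative_isCont \<mu>\<^sub>S_strict by blast

lemma \<mu>\<^sub>G_cont: "continuous_map T euclidean \<mu>\<^sub>G"
  using chart_function_continuous has_strict_derivative_isCont \<mu>\<^sub>G_strict by blast

lemma zero_set_closed:
  fixes f :: "'m \<Rightarrow> 'a::real_normed_vector"
  shows "continuous_map T euclidean f \<Longrightarrow> closedin T (zero_set M f)"
  unfolding zero_set_def using closedin_continuous_map_preimage[of T euclidean f "{0}"] by simp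

lemma compact_action_G: "compact_action G (mtop N) T act_G P"
proof (rule compact_action.intro)
  show "group G" by (rule group_G)
  show "topspace (mtop N) = carrier G" by (rule points_N)
  show "compact_space (mtop N)" by (rule compact)
  show "Hausdorff_space T" using M_manifold by (simp add: smooth_manifold_def)
  have "continuous_map (prod_topology (mtop N) T) (prod_topology TK T) (\<lambda>p. ((fst p, 1), snd p))"
    by (intro continuous_map_pairedI continuous_map_fst continuous_map_snd) simp
  from continuous_map_compose[OF this act_cont]
  show "continuous_map (prod_topology (mtop N) T) T (\<lambda>(g, x). act (g, 1) x)" by (simp add: o_def case_prod_unfold)
  show "act (\<one>\<^bsub>G\<^esub>, 1) x = x" if "x \<in> points M" for x using that by (rule act_one)
  show "act (g \<otimes>\<^bsub>G\<^esub> h, 1) x = act (g, 1) (act (h, 1) x)" if "g \<in> carrier G" "h \<in> carrier G" "x \<in> points M" for g h x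
    using act_mult[OF that(1,2), of 1 1 x] that(3) by simp
  show "closedin T P" using \<mu>\<^sub>G_cont by (rule zero_set_closed)
  show "act (g, 1) x \<in> P" if "g \<in> carrier G" "x \<in> P" for g x
    using \<mu>\<^sub>G_zero_invariant[OF that(1), of 1 x] act_closed[OF that(1), of 1 x] that(2) by (simp add: zero_set_def)
qed

sublocale CA: compact_action G "mtop N" T act_G P by (rule compact_action_G)

lemma Q_reduction: "CA.Q = reduction G M act \<mu>\<^sub>G"
  by (simp add: reduction_def)

definition slice :: "('m, 'e) chart \<Rightarrow> 'm \<Rightarrow> ('e \<Rightarrow> 'h) \<Rightarrow> real \<Rightarrow> 'e set" where
  "slice c x \<Lambda> r = {y \<in> cball (chart_map c x) r. \<mu>\<^sub>G (chart_inv c y) = 0 \<and> \<Lambda> (y - chart_map c x) = 0}"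

abbreviation slice_map :: "('m, 'e) chart \<Rightarrow> 'e \<Rightarrow> 'm set" where
  "slice_map c y \<equiv> CA.q (chart_inv c y)"

text \<open>A radius up to which the slice is a chart of the orbit space.\<close>

definition slice_chart :: "('m, 'e) chart \<Rightarrow> 'm \<Rightarrow> ('e \<Rightarrow> 'h) \<Rightarrow> real \<Rightarrow> bool" where
  "slice_chart c x \<Lambda> r1 \<longleftrightarrow>
     0 < r1 \<and> cball (chart_map c x) r1 \<subseteq> chart_image c \<and> inj_on (slice_map c) (slice c x \<Lambda> r1) \<and>
     (\<forall>r. 0 < r \<longrightarrow> r \<le> r1 \<longrightarrow> openin CA.Q (slice_map c ` {y \<in> slice c x \<Lambda> r. dist (chart_map c x) y < r}))"

text \<open>
  The group action near the unit and near \<open>x\<close>, in coordinates: as \<open>\<Lambda>\<close> inverts the infinitesimal action, \<open>\<Lambda> (a u y)\<close>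
  depends on \<open>u\<close> like \<open>u\<close> itself, up to a small Lipschitz perturbation. The bound \<open>B\<close> says that small group elements
  move points little.
\<close>

lemma local_action:
  assumes c: "c \<in> atlas M" "x \<in> chart_dom c"
    and \<Lambda>: "bounded_linear \<Lambda>" "\<And>\<xi>. \<Lambda> (gen c x (\<xi>, 0)) = \<xi>"
  obtains \<delta> B a where "\<delta> > 0" "B > 0"
    "\<And>u y. u \<in> ball e1 \<delta> \<Longrightarrow> y \<in> ball (chart_map c x) \<delta> \<Longrightarrow> u \<in> chart_image e \<and> y \<in> chart_image c \<and>
       act (chart_inv e u, 1) (chart_inv c y) \<in> chart_dom c \<and>
       chart_map c (act (chart_inv e u, 1) (chart_inv c y)) = a u y"
    "\<And>u u' y. u \<in> ball e1 \<delta> \<Longrightarrow> u' \<in> ball e1 \<delta> \<Longrightarrow> y \<in> ball (chart_map c x) \<delta> \<Longrightarrow>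
       norm (\<Lambda> (a u y) - \<Lambda> (a u' y) - (u - u')) \<le> norm (u - u') / 2"
    "\<And>u y. u \<in> ball e1 \<delta> \<Longrightarrow> y \<in> ball (chart_map c x) \<delta> \<Longrightarrow> norm (a u y - y) \<le> B * norm (u - e1)"
    "\<And>y. y \<in> ball (chart_map c x) \<delta> \<Longrightarrow> a e1 y = y"
proof -
  let ?y0 = "chart_map c x"
  let ?D = "action_deriv c x"
  obtain K where K: "K > 0" "\<And>z. norm (\<Lambda> z) \<le> norm z * K" using bounded_linear.pos_bounded[OF \<Lambda>(1)] by blast
  note strict = action_rep_strict(1)[OF c]
  have K2: "1 / (2 * K) > 0" using K(1) by simp
  obtain \<delta>1 where \<delta>1: "\<delta>1 > 0" "\<And>p p'. p \<in> ball (unit_coord, ?y0) \<delta>1 \<Longrightarrow> p' \<in> ball (unit_coord, ?y0) \<delta>1 \<Longrightarrow>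
      norm (action_rep c p - action_rep c p' - ?D (p - p')) \<le> 1 / (2 * K) * norm (p - p')"
    by (rule has_strict_derivativeD[OF strict K2]) (rule that; assumption)
  obtain \<delta>2 B where \<delta>2: "\<delta>2 > 0" and B: "B > 0" "\<And>p p'. p \<in> ball (unit_coord, ?y0) \<delta>2 \<Longrightarrow> p' \<in> ball (unit_coord, ?y0) \<delta>2 \<Longrightarrow>
      norm (action_rep c p - action_rep c p') \<le> B * norm (p - p')"
    by (rule has_strict_derivative_Lipschitz[OF strict]) (rule that; assumption)
  obtain \<delta>3 where \<delta>3: "\<delta>3 > 0" "\<And>p. dist p (unit_coord, ?y0) < \<delta>3 \<Longrightarrow>
      (case p of (\<zeta>, y) \<Rightarrow> \<zeta> \<in> chart_image eK \<and> y \<in> chart_image c \<and> act (chart_inv eK \<zeta>) (chart_inv c y) \<in> chart_dom c)"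
    using action_rep_strict(2)[OF c] unfolding eventually_nhds_metric by blast
  define \<delta> where "\<delta> = Min {\<delta>1, \<delta>2, \<delta>3} / 2"
  have \<delta>: "\<delta> > 0" "2 * \<delta> \<le> \<delta>1" "2 * \<delta> \<le> \<delta>2" "2 * \<delta> \<le> \<delta>3" using \<delta>1 \<delta>2 \<delta>3 by (auto simp: \<delta>_def)
  define a where "a u y = action_rep c ((u, 0), y)" for u y
  have near: "dist (unit_coord, ?y0) ((u, 0), y) < 2 * \<delta>" if "u \<in> ball e1 \<delta>" "y \<in> ball ?y0 \<delta>" for u y
  proof -
    have "dist (unit_coord, ?y0) ((u, 0), y) \<le> dist unit_coord (u, 0) + dist ?y0 y"
      unfolding dist_Pair_Pair by (rule sqrt_sum_squares_le_sum) auto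
    also have "dist unit_coord (u, 0) = dist e1 u" by (simp add: dist_Pair_Pair)
    finally show ?thesis using that by simp
  qed
  have norm_u: "norm (((u, 0::real), y) - ((u', 0), y)) = norm (u - u')" for u u' and y :: 'e by (simp add: norm_Pair)
  have e1_ball: "e1 \<in> ball e1 \<delta>" using \<delta>(1) by simp
  have unit: "a e1 y = y" if y: "y \<in> ball ?y0 \<delta>" for y
  proof -
    have "y \<in> chart_image c" using \<delta>3(2)[of "(unit_coord, y)"] near[OF e1_ball y] \<delta>(4) by (simp add: dist_commute)
    then show ?thesis unfolding a_def by (rule action_rep_at_unit[OF c(1)])
  qed
  show thesis
  proof (rule that[OF \<delta>(1) B(1), of a])
    fix u y assume u: "u \<in> ball e1 \<delta>" and y: "y \<in> ball ?y0 \<delta>"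
    have d3: "(u, 0) \<in> chart_image eK" "y \<in> chart_image c" "act (chart_inv eK (u, 0)) (chart_inv c y) \<in> chart_dom c"
      using \<delta>3(2)[of "((u, 0), y)"] near[OF u y] \<delta>(4) by (simp_all add: dist_commute del: prod_chart_simps)
    have im: "u \<in> chart_image e" using d3(1) unfolding chart_image_prod by blast
    have inv: "chart_inv eK (u, 0) = (chart_inv e u, 1)" using eK_inv(2)[OF im, of 0] by simp
    show "u \<in> chart_image e \<and> y \<in> chart_image c \<and>
       act (chart_inv e u, 1) (chart_inv c y) \<in> chart_dom c \<and>
       chart_map c (act (chart_inv e u, 1) (chart_inv c y)) = a u y"
      using im d3(2,3) action_rep_eq[OF c(1) d3(1,2)] unfolding inv a_def by simp
    have "norm (action_rep c ((u, 0), y) - action_rep c ((e1, 0), y)) \<le> B * norm (((u, 0), y) - ((e1, 0::real), y))"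
      using near[OF u y] near[OF e1_ball y] \<delta>(3) by (intro B(2)) auto
    then show "norm (a u y - y) \<le> B * norm (u - e1)"
      using unit[OF y] unfolding norm_u by (simp add: a_def)
    fix u' assume u': "u' \<in> ball e1 \<delta>"
    have "norm (a u y - a u' y - ?D (((u, 0), y) - ((u', 0), y))) \<le> 1 / (2 * K) * norm (u - u')"
      using \<delta>1(2)[of "((u, 0), y)" "((u', 0), y)"] near[OF u y] near[OF u' y] \<delta>(2) unfolding norm_u a_def by auto
    also have "((u, 0::real), y) - ((u', 0), y) = ((u - u', 0), 0)" by simp
    also have "?D ((u - u', 0), 0) = gen c x (u - u', 0)" by (rule gen_eq[OF c, symmetric])
    finally have "norm (a u y - a u' y - gen c x (u - u', 0)) * K \<le> 1 / (2 * K) * norm (u - u') * K"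
      using K(1) by (intro mult_right_mono) auto
    then have "norm (\<Lambda> (a u y - a u' y - gen c x (u - u', 0))) \<le> norm (u - u') / 2"
      using K(1) K(2)[of "a u y - a u' y - gen c x (u - u', 0)"] by simp
    then show "norm (\<Lambda> (a u y) - \<Lambda> (a u' y) - (u - u')) \<le> norm (u - u') / 2"
      using bounded_linear.linear[OF \<Lambda>(1)] \<Lambda>(2) by (simp add: linear_diff)
  qed (rule unit)
qed

text \<open>
  The slice is cut out of the level set \<open>P\<close> by \<open>\<Lambda> = const\<close>, which is transverse to the orbits. Two points of a small
  slice on one orbit differ by a group element near the unit, because the action is free and \<open>G\<close> is compact, and
  there \<open>\<Lambda>\<close> recognizes the group element: so the slice meets an orbit once. Conversely \<open>\<Lambda> (a u y') = \<Lambda> y0\<close> is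
  solvable for \<open>u\<close> when \<open>y'\<close> is near the slice, which moves \<open>y'\<close> into it: so the orbits that meet the slice fill a
  neighbourhood.
\<close>

lemma slice_theorem:
  assumes c: "c \<in> atlas M" "x \<in> chart_dom c" and x: "\<mu>\<^sub>G x = 0"
    and \<Lambda>: "bounded_linear \<Lambda>" "\<And>\<xi>. \<Lambda> (gen c x (\<xi>, 0)) = \<xi>"
  obtains r1 where "slice_chart c x \<Lambda> r1"
proof -
  let ?y0 = "chart_map c x"
  note chart = M_chart[OF c(1)] and inv = topological_chart_inverse[OF M_chart[OF c(1)]]
  note e_inv = topological_chart_inverse[OF e_chart(3)]
  have lin: "linear \<Lambda>" using \<Lambda>(1) by (rule bounded_linear.linear)
  obtain K where K: "K > 0" "\<And>z. norm (\<Lambda> z) \<le> norm z * K" using bounded_linear.pos_bounded[OF \<Lambda>(1)] by blast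
  obtain \<delta> B a where \<delta>: "\<delta> > 0" and B: "B > 0"
    and loc: "\<And>u y. u \<in> ball e1 \<delta> \<Longrightarrow> y \<in> ball ?y0 \<delta> \<Longrightarrow> u \<in> chart_image e \<and> y \<in> chart_image c \<and>
       act (chart_inv e u, 1) (chart_inv c y) \<in> chart_dom c \<and>
       chart_map c (act (chart_inv e u, 1) (chart_inv c y)) = a u y"
    and newton: "\<And>u u' y. u \<in> ball e1 \<delta> \<Longrightarrow> u' \<in> ball e1 \<delta> \<Longrightarrow> y \<in> ball ?y0 \<delta> \<Longrightarrow>
       norm (\<Lambda> (a u y) - \<Lambda> (a u' y) - (u - u')) \<le> norm (u - u') / 2"
    and lip: "\<And>u y. u \<in> ball e1 \<delta> \<Longrightarrow> y \<in> ball ?y0 \<delta> \<Longrightarrow> norm (a u y - y) \<le> B * norm (u - e1)"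
    and unit: "\<And>y. y \<in> ball ?y0 \<delta> \<Longrightarrow> a e1 y = y"
    by (rule local_action[OF c \<Lambda>]) (rule that; assumption)
  have xM: "x \<in> points M" using chart_point[OF c] .
  have xP: "x \<in> P" using xM x by (simp add: zero_set_def)
  let ?N = "{g \<in> chart_dom e. chart_map e g \<in> ball e1 \<delta>}"
  have N: "openin (mtop N) ?N" by (rule chart_preimage_open[OF e_chart(3)]) simp
  have one_N: "\<one>\<^bsub>G\<^esub> \<in> ?N" using e_chart(2) \<delta> by simp
  have free_x: "g = \<one>\<^bsub>G\<^esub>" if "g \<in> carrier G" "act (g, 1) x = x" for g
    using free[OF xP] that by (auto simp: stabilizer_def)
  obtain V where V: "openin T V" "x \<in> V" "\<And>g z. g \<in> carrier G \<Longrightarrow> z \<in> V \<Longrightarrow> act (g, 1) z \<in> V \<Longrightarrow> g \<in> ?N"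
    using CA.small_displacement[OF xM free_x N one_N] by blast
  have "open (chart_map c ` (V \<inter> chart_dom c))"
    using chart V(1) by (intro open_chart_image) (auto simp: topological_chart_def)
  then obtain \<rho> where \<rho>: "\<rho> > 0" "ball ?y0 \<rho> \<subseteq> chart_map c ` (V \<inter> chart_dom c)"
    using V(2) c(2) by (meson IntI imageI openE)
  define r1 where "r1 = min \<rho> \<delta> / 2"
  have r1: "r1 > 0" "r1 < \<rho>" "r1 < \<delta>" using \<rho> \<delta> by (auto simp: r1_def min_def)
  have in_\<delta>: "y \<in> ball ?y0 \<delta>" if "y \<in> cball ?y0 r1" for y using that r1 by simp
  have in_V: "chart_inv c y \<in> V" if "y \<in> cball ?y0 r1" for y
  proof -
    have "y \<in> ball ?y0 \<rho>" using that r1 by simp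
    then obtain z where "z \<in> V" "z \<in> chart_dom c" "y = chart_map c z" using \<rho>(2) by blast
    then show ?thesis using inv(1) by simp
  qed
  have e1_ball: "e1 \<in> ball e1 \<delta>" using \<delta> by simp
  have im: "y \<in> chart_image c" if "y \<in> ball ?y0 \<delta>" for y using loc[OF e1_ball that] by blast
  have inM: "chart_inv c y \<in> points M" if "y \<in> ball ?y0 \<delta>" for y using chart_point[OF c(1) inv(3)[OF im[OF that]]] .
  have "slice_chart c x \<Lambda> r1"
    unfolding slice_chart_def
  proof (intro conjI allI impI)
    show "0 < r1" by (rule r1(1))
    show "cball ?y0 r1 \<subseteq> chart_image c" using in_\<delta> im by blast
    show "inj_on (slice_map c) (slice c x \<Lambda> r1)"
    proof (rule inj_onI)
      fix y y' assume y: "y \<in> slice c x \<Lambda> r1" and y': "y' \<in> slice c x \<Lambda> r1" and eq: "slice_map c y = slice_map c y'"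
      have yb: "y \<in> cball ?y0 r1" "y' \<in> cball ?y0 r1" and L: "\<Lambda> (y - ?y0) = 0" "\<Lambda> (y' - ?y0) = 0"
        using y y' by (auto simp: slice_def)
      obtain g where g: "g \<in> carrier G" "chart_inv c y' = act (g, 1) (chart_inv c y)"
        using eq CA.q_eq_iff[OF inM[OF in_\<delta>[OF yb(1)]] inM[OF in_\<delta>[OF yb(2)]]] by blast
      have gN: "g \<in> ?N" using V(3)[OF g(1) in_V[OF yb(1)]] in_V[OF yb(2)] g(2) by simp
      define u where "u = chart_map e g"
      have u: "u \<in> ball e1 \<delta>" "chart_inv e u = g" using gN e_inv(1) by (auto simp: u_def)
      have "a u y = y'" using loc[OF u(1) in_\<delta>[OF yb(1)]] u(2) g(2) inv(2)[OF im[OF in_\<delta>[OF yb(2)]]] by simp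
      then have "norm (\<Lambda> y' - \<Lambda> y - (u - e1)) \<le> norm (u - e1) / 2"
        using newton[OF u(1) e1_ball in_\<delta>[OF yb(1)]] unit[OF in_\<delta>[OF yb(1)]] by simp
      moreover have "\<Lambda> y' - \<Lambda> y = 0" using L lin by (simp add: linear_diff)
      ultimately have "norm (u - e1) = 0" using norm_minus_commute[of e1 u] by simp
      then have "g = \<one>\<^bsub>G\<^esub>" using u(2) e1_inv by simp
      then have "chart_inv c y' = chart_inv c y" using g(2) act_one[OF inM[OF in_\<delta>[OF yb(1)]]] by simp
      then show "y = y'" using inv(2) im in_\<delta> yb by metis
    qed
  next
    fix r :: real assume r: "0 < r" "r \<le> r1"
    let ?S = "{y \<in> slice c x \<Lambda> r. dist ?y0 y < r}"
    have Sb: "y \<in> ball ?y0 \<delta>" if "y \<in> ?S" for y using that r r1 by auto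
    have "openin CA.Q (CA.q ` (chart_inv c ` ?S))"
    proof (rule CA.open_orbit_image)
      show "chart_inv c ` ?S \<subseteq> P"
      proof
        fix z assume "z \<in> chart_inv c ` ?S"
        then obtain y where y: "y \<in> ?S" "z = chart_inv c y" by blast
        then show "z \<in> P" using inM[OF Sb[OF y(1)]] by (simp add: zero_set_def slice_def)
      qed
      fix w assume "w \<in> chart_inv c ` ?S"
      then obtain y where y: "y \<in> ?S" "w = chart_inv c y" by blast
      have Ly: "\<Lambda> y = \<Lambda> ?y0" using y(1) lin by (simp add: slice_def linear_diff)
      have yr: "dist ?y0 y < r" using y(1) by simp
      \<comment> \<open>\<open>\<eta>\<close> bounds the group elements used, so that they move points by at most a quarter of the distance left
        to the rim of the slice. The equation for the group element is solvable in the ball of radius \<open>\<eta>\<close> once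
        \<open>y'\<close> is within \<open>\<eta> / (2 K)\<close> of \<open>y\<close>.\<close>
      define \<eta> where "\<eta> = min (\<delta> / 2) ((r - dist ?y0 y) / (4 * B))"
      define \<sigma> where "\<sigma> = Min {\<delta> - dist ?y0 y, \<eta> / (2 * K), (r - dist ?y0 y) / 2}"
      have \<eta>: "\<eta> > 0" "\<eta> < \<delta>" "B * \<eta> \<le> (r - dist ?y0 y) / 4"
      proof -
        show "\<eta> > 0" using \<delta> yr B by (simp add: \<eta>_def)
        have "\<eta> \<le> \<delta> / 2" by (simp add: \<eta>_def)
        then show "\<eta> < \<delta>" using \<delta> by simp
        have "\<eta> \<le> (r - dist ?y0 y) / (4 * B)" by (simp add: \<eta>_def)
        then show "B * \<eta> \<le> (r - dist ?y0 y) / 4" using B by (simp add: field_simps)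
      qed
      have \<sigma>: "\<sigma> > 0" "\<sigma> \<le> \<delta> - dist ?y0 y" "\<sigma> \<le> \<eta> / (2 * K)" "\<sigma> \<le> (r - dist ?y0 y) / 2"
      proof -
        show "\<sigma> > 0" using Sb[OF y(1)] \<eta>(1) K(1) yr by (simp add: \<sigma>_def)
        show "\<sigma> \<le> \<delta> - dist ?y0 y" "\<sigma> \<le> \<eta> / (2 * K)" "\<sigma> \<le> (r - dist ?y0 y) / 2"
          unfolding \<sigma>_def by (rule Min_le; simp)+
      qed
      let ?V = "{z \<in> chart_dom c. chart_map c z \<in> ball y \<sigma>}"
      have "openin T ?V" by (rule chart_preimage_open[OF chart]) simp
      moreover have "w \<in> ?V" using y(2) inv(2,3)[OF im[OF Sb[OF y(1)]]] \<sigma>(1) by simp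
      moreover have "\<exists>g\<in>carrier G. act (g, 1) z \<in> chart_inv c ` ?S" if z: "z \<in> ?V \<inter> P" for z
      proof -
        define y' where "y' = chart_map c z"
        have zc: "z \<in> chart_dom c" "chart_inv c y' = z" using z inv(1) by (auto simp: y'_def)
        have y'y: "dist y y' < \<sigma>" using z by (simp add: y'_def)
        have y'b: "y' \<in> ball ?y0 \<delta>" using y'y \<sigma>(2) dist_triangle[of ?y0 y' y] by simp
        have sub: "u \<in> ball e1 \<delta>" if "u \<in> cball e1 \<eta>" for u using that \<eta>(2) by simp
        have "norm (\<Lambda> (a u y') - \<Lambda> (a v y') - (u - v)) \<le> norm (u - v) / 2" if "u \<in> cball e1 \<eta>" "v \<in> cball e1 \<eta>" for u v
          using newton[OF sub[OF that(1)] sub[OF that(2)] y'b] .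
        moreover have "2 * norm (\<Lambda> ?y0 - \<Lambda> (a e1 y')) \<le> \<eta>"
        proof -
          have "norm (\<Lambda> ?y0 - \<Lambda> (a e1 y')) = norm (\<Lambda> (y - y'))" using lin unit[OF y'b] Ly by (simp add: linear_diff)
          also have "\<dots> \<le> norm (y - y') * K" by (rule K(2))
          also have "\<dots> \<le> \<eta> / (2 * K) * K" using y'y \<sigma>(3) K(1) by (intro mult_right_mono) (auto simp: dist_norm)
          finally show ?thesis using K(1) by simp
        qed
        ultimately obtain u where u: "u \<in> cball e1 \<eta>" "\<Lambda> (a u y') = \<Lambda> ?y0"
          using near_identity_solvable[OF fin_h, of e1 \<eta> "\<lambda>u. \<Lambda> (a u y')" "\<Lambda> ?y0"] by blast
        note l = loc[OF sub[OF u(1)] y'b]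
        define g where "g = chart_inv e u"
        have g: "g \<in> carrier G" using l e_inv(3)[of u] chart_dom_e by (auto simp: g_def)
        have zg: "act (g, 1) z \<in> chart_dom c" "chart_map c (act (g, 1) z) = a u y'" using l zc(2) by (auto simp: g_def)
        have "norm (a u y' - y') \<le> B * norm (u - e1)" by (rule lip[OF sub[OF u(1)] y'b])
        also have "\<dots> \<le> B * \<eta>" using u(1) B by (intro mult_left_mono) (auto simp: dist_norm norm_minus_commute)
        finally have d1: "dist y' (a u y') \<le> (r - dist ?y0 y) / 4" using \<eta>(3) by (simp add: dist_norm norm_minus_commute)
        have "dist ?y0 (a u y') \<le> dist ?y0 y + dist y y' + dist y' (a u y')"
          using dist_triangle[of ?y0 "a u y'" y'] dist_triangle[of ?y0 y' y] by linarith
        also have "\<dots> < dist ?y0 y + (r - dist ?y0 y) / 2 + (r - dist ?y0 y) / 2"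
          using d1 y'y \<sigma>(4) yr by (intro add_less_le_mono add_strict_left_mono) auto
        finally have d2: "dist ?y0 (a u y') < r" by simp
        have "act (g, 1) z \<in> P" using z CA.P_inv[OF g] by blast
        then have "\<mu>\<^sub>G (chart_inv c (a u y')) = 0" using inv(1)[OF zg(1)] zg(2) by (simp add: zero_set_def)
        then have "a u y' \<in> ?S" using d2 u(2) lin by (simp add: slice_def linear_diff)
        moreover have "act (g, 1) z = chart_inv c (a u y')" using inv(1)[OF zg(1)] zg(2) by simp
        ultimately show ?thesis using g by blast
      qed
      ultimately show "\<exists>V. openin T V \<and> w \<in> V \<and> (\<forall>x\<in>V \<inter> P. \<exists>g\<in>carrier G. act (g, 1) x \<in> chart_inv c ` ?S)" by blast
    qed
    then show "openin CA.Q (slice_map c ` ?S)" by (simp add: image_image)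
  qed
  then show thesis by (rule that)
qed

end

section \<open>Pushing towards the hyper-reduction\<close>

context hyper_reduction_setup
begin

interpretation G: group G by (rule group_G)

lemma reduced_moment_orbit:
  assumes inv: "\<And>g x. g \<in> carrier G \<Longrightarrow> x \<in> points M \<Longrightarrow> f (act (g, 1) x) = f x" and x: "x \<in> points M"
  shows "reduced_moment f (CA.q x) = f x"
proof -
  have "f ` CA.q x = {f x}"
  proof (intro subset_antisym subsetI)
    fix z assume "z \<in> f ` CA.q x"
    then show "z \<in> {f x}" using inv x by (auto simp: orbit_def)
  next
    fix z assume "z \<in> {f x}"
    then show "z \<in> f ` CA.q x" using CA.a_one[OF x] by (force simp: orbit_def)
  qed
  then show ?thesis by (simp add: reduced_moment_def)
qed

text \<open>
  On the orbit space, \<open>height\<close> is the moment map of the circle and has compact sublevel sets; \<open>size_s\<close> serves as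
  a distance from the hyper-reduction, which is its zero locus.
\<close>

abbreviation "height \<equiv> reduced_moment \<mu>\<^sub>S"
abbreviation "size_s \<equiv> reduced_moment (\<lambda>x. norm (s x))"
abbreviation "zero_locus \<equiv> {X \<in> topspace CA.Q. size_s X = 0}"

lemma height_q: "x \<in> points M \<Longrightarrow> height (CA.q x) = \<mu>\<^sub>S x"
  by (rule reduced_moment_orbit) (use \<mu>\<^sub>S_invariant in auto)

lemma size_s_q: "x \<in> points M \<Longrightarrow> size_s (CA.q x) = norm (s x)"
  by (rule reduced_moment_orbit) (use s_inv in auto)

lemma P_points: "x \<in> P \<Longrightarrow> x \<in> points M"
  by (simp add: zero_set_def)

lemma reduced_moment_continuous:
  assumes f: "continuous_map T euclideanreal f"
    and inv: "\<And>g x. g \<in> carrier G \<Longrightarrow> x \<in> points M \<Longrightarrow> f (act (g, 1) x) = f x"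
  shows "continuous_map CA.Q euclideanreal (reduced_moment f)"
proof (rule continuous_compose_quotient_map[OF CA.q_quotient])
  show "continuous_map (subtopology T P) euclideanreal (reduced_moment f \<circ> CA.q)"
  proof (rule continuous_map_eq)
    show "continuous_map (subtopology T P) euclideanreal f" using f by (rule continuous_map_from_subtopology)
    show "f x = (reduced_moment f \<circ> CA.q) x" if "x \<in> topspace (subtopology T P)" for x
      using reduced_moment_orbit[OF inv] that by simp
  qed
qed

lemma height_cont: "continuous_map CA.Q euclideanreal height"
  using \<mu>\<^sub>S_cont by (rule reduced_moment_continuous) (use \<mu>\<^sub>S_invariant in auto)

lemma size_s_cont: "continuous_map CA.Q euclideanreal size_s"
proof (rule reduced_moment_continuous)
  show "continuous_map T euclideanreal (\<lambda>x. norm (s x))"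
    using s_cont by (rule continuous_map_norm)
qed (use s_inv in auto)

text \<open>The slice is a fibre of the map \<open>F\<close>, which brings local pushes along \<open>F\<close> to bear on it.\<close>

lemma slice_constraint:
  assumes c: "c \<in> atlas M" "x \<in> chart_dom c" and x: "\<mu>\<^sub>G x = 0" and \<Lambda>: "bounded_linear \<Lambda>"
    and F_def: "F = (\<lambda>y. (local_rep c \<mu>\<^sub>G y, \<Lambda> (y - chart_map c x)))"
  shows "has_strict_derivative F (\<lambda>v. (differential c \<mu>\<^sub>G x v, \<Lambda> v)) (chart_map c x)"
    and "y \<in> slice c x \<Lambda> r \<longleftrightarrow> y \<in> cball (chart_map c x) r \<and> F y = F (chart_map c x)"
proof -
  show "has_strict_derivative F (\<lambda>v. (differential c \<mu>\<^sub>G x v, \<Lambda> v)) (chart_map c x)"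
    unfolding F_def using \<mu>\<^sub>G_strict[OF c] has_strict_derivative_affine[OF \<Lambda>] by (rule has_strict_derivative_Pair)
  have "F (chart_map c x) = (0, 0)"
    using topological_chart_inverse(1)[OF M_chart[OF c(1)] c(2)] x linear_0[OF bounded_linear.linear[OF \<Lambda>]]
    by (simp add: F_def local_rep_def)
  then show "y \<in> slice c x \<Lambda> r \<longleftrightarrow> y \<in> cball (chart_map c x) r \<and> F y = F (chart_map c x)"
    by (simp add: slice_def F_def local_rep_def)
qed

lemma slice_push:
  assumes c: "c \<in> atlas M" "x \<in> chart_dom c" and x: "\<mu>\<^sub>G x = 0" and \<Lambda>: "bounded_linear \<Lambda>"
    and push: "local_push (\<lambda>y. (local_rep c \<mu>\<^sub>G y, \<Lambda> (y - chart_map c x))) (chart_map c x) r r' h"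
    and y: "y \<in> slice c x \<Lambda> r"
  shows "h 0 y = y"
    and "t \<in> {0..1} \<Longrightarrow> h t y \<in> slice c x \<Lambda> r"
    and "t \<in> {0..1} \<Longrightarrow> r' \<le> dist (chart_map c x) y \<Longrightarrow> h t y = y"
  using push y unfolding slice_constraint(2)[OF c x \<Lambda> refl] local_push_def by blast+

lemma slice_point:
  assumes c: "c \<in> atlas M" and r1: "slice_chart c x \<Lambda> r1" and r: "r \<le> r1" and y: "y \<in> slice c x \<Lambda> r"
  shows "chart_inv c y \<in> P"
proof -
  have "y \<in> chart_image c" using r1 r y by (auto simp: slice_chart_def slice_def)
  then have "chart_inv c y \<in> points M" using topological_chart_inverse(3)[OF M_chart[OF c]] chart_point[OF c] by blast
  then show ?thesis using y by (simp add: slice_def zero_set_def)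
qed

lemma slice_neighbourhood:
  assumes c: "c \<in> atlas M" "x \<in> chart_dom c" and x: "\<mu>\<^sub>G x = 0" and \<Lambda>: "bounded_linear \<Lambda>"
    and r1: "slice_chart c x \<Lambda> r1" and r: "0 < r'" "r' \<le> r" "r \<le> r1"
  shows "openin CA.Q (slice_map c ` {y \<in> slice c x \<Lambda> r. dist (chart_map c x) y < r'})"
    and "CA.q x \<in> slice_map c ` {y \<in> slice c x \<Lambda> r. dist (chart_map c x) y < r'}"
proof -
  let ?D = "{y \<in> slice c x \<Lambda> r. dist (chart_map c x) y < r'}"
  have "?D = {y \<in> slice c x \<Lambda> r'. dist (chart_map c x) y < r'}" using r by (auto simp: slice_def)
  moreover have "openin CA.Q (slice_map c ` {y \<in> slice c x \<Lambda> r'. dist (chart_map c x) y < r'})"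
    using r1 r unfolding slice_chart_def by auto
  ultimately show "openin CA.Q (slice_map c ` ?D)" by simp
  note inv = topological_chart_inverse(1)[OF M_chart[OF c(1)] c(2)]
  have "chart_map c x \<in> ?D" using r inv x linear_0[OF bounded_linear.linear[OF \<Lambda>]] by (simp add: slice_def)
  from imageI[OF this, of "slice_map c"] show "CA.q x \<in> slice_map c ` ?D" unfolding inv .
qed

text \<open>
  A local push on a slice that rests near the rim descends to a deformation of the whole orbit space, resting outside
  the slice: the slice is a compact neighbourhood embedded in the Hausdorff orbit space.
\<close>

lemma slice_deformation:
  assumes c: "c \<in> atlas M" "x \<in> chart_dom c"
    and x: "\<mu>\<^sub>G x = 0" and \<Lambda>: "bounded_linear \<Lambda>"
    and r1: "slice_chart c x \<Lambda> r1" and r: "0 < r'" "r' \<le> r" "r \<le> r1"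
    and push: "local_push (\<lambda>y. (local_rep c \<mu>\<^sub>G y, \<Lambda> (y - chart_map c x))) (chart_map c x) r r' h"
    and Z: "\<And>t y. t \<in> {0..1} \<Longrightarrow> y \<in> slice c x \<Lambda> r \<Longrightarrow> slice_map c y \<in> Z \<Longrightarrow> h t y = y"
  obtains H where "deformation CA.Q Z H"
    "\<And>t y. t \<in> {0..1} \<Longrightarrow> y \<in> slice c x \<Lambda> r \<Longrightarrow> H t (slice_map c y) = slice_map c (h t y)"
    "\<And>t X. t \<in> {0..1} \<Longrightarrow> X \<in> topspace CA.Q - slice_map c ` {y \<in> slice c x \<Lambda> r. dist (chart_map c x) y < r'} \<Longrightarrow> H t X = X"
proof -
  let ?y0 = "chart_map c x" and ?S = "slice c x \<Lambda> r"
  let ?D = "{y \<in> ?S. dist ?y0 y < r'}"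
  note inv = topological_chart_inverse[OF M_chart[OF c(1)]]
  have sub: "cball ?y0 r \<subseteq> chart_image c" using r1 r(3) by (auto simp: slice_chart_def)
  have S_cball: "?S \<subseteq> cball ?y0 r" by (auto simp: slice_def)
  have S_sub: "?S \<subseteq> slice c x \<Lambda> r1" using r(3) by (auto simp: slice_def)
  have pt: "chart_inv c y \<in> P" if "y \<in> ?S" for y using c(1) r1 r(3) that by (rule slice_point)
  have cont_G: "continuous_on (cball ?y0 r) (\<lambda>y. \<mu>\<^sub>G (chart_inv c y))"
  proof -
    have "isCont (local_rep c \<mu>\<^sub>G) y" if y: "y \<in> cball ?y0 r" for y
    proof -
      have "chart_inv c y \<in> chart_dom c" "chart_map c (chart_inv c y) = y" using y sub inv by auto
      then show ?thesis using has_strict_derivative_isCont[OF \<mu>\<^sub>G_strict[OF c(1), of "chart_inv c y"]] by simp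
    qed
    then have "continuous_on (cball ?y0 r) (local_rep c \<mu>\<^sub>G)" by (simp add: continuous_at_imp_continuous_on)
    then show ?thesis by (simp add: local_rep_def o_def)
  qed
  have compact_S: "compact ?S"
  proof -
    have "continuous_on (cball ?y0 r) (\<lambda>y. \<Lambda> (y - ?y0))"
      by (intro bounded_linear.continuous_on[OF \<Lambda>] continuous_intros)
    with cont_G have "closed ({y \<in> cball ?y0 r. \<mu>\<^sub>G (chart_inv c y) = 0} \<inter> {y \<in> cball ?y0 r. \<Lambda> (y - ?y0) = 0})"
      by (intro closed_Int continuous_closed_preimage_constant closed_cball)
    then have "compact (cball ?y0 r \<inter> ({y \<in> cball ?y0 r. \<mu>\<^sub>G (chart_inv c y) = 0} \<inter> {y \<in> cball ?y0 r. \<Lambda> (y - ?y0) = 0}))"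
      by (rule compact_Int_closed[OF finite_dimensional_compact_cball[OF fin_e]])
    moreover have "cball ?y0 r \<inter> ({y \<in> cball ?y0 r. \<mu>\<^sub>G (chart_inv c y) = 0} \<inter> {y \<in> cball ?y0 r. \<Lambda> (y - ?y0) = 0}) = ?S"
      by (auto simp: slice_def)
    ultimately show ?thesis by simp
  qed
  have "continuous_map (top_of_set (chart_image c)) T (chart_inv c)"
    using M_chart[OF c(1)] by (simp add: topological_chart_def)
  then have "continuous_map (top_of_set ?S) T (chart_inv c)"
    by (rule continuous_map_from_subtopology_mono) (use S_cball sub in blast)
  then have "continuous_map (top_of_set ?S) (subtopology T P) (chart_inv c)"
    using pt by (auto simp: continuous_map_in_subtopology)
  from continuous_map_compose[OF this CA.q_cont]
  have k_cont: "continuous_map (top_of_set ?S) CA.Q (slice_map c)" by (simp add: o_def)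
  have k_inj: "inj_on (slice_map c) ?S" using r1 S_sub unfolding slice_chart_def by (meson inj_on_subset)
  note D_open = slice_neighbourhood(1)[OF c x \<Lambda> r1 r] and h = slice_push[OF c x \<Lambda> push]
  have h_S: "continuous_on ({0..1} \<times> ?S) (\<lambda>(t, y). h t y)"
    by (rule continuous_on_subset[of "{0..1} \<times> cball ?y0 r"]) (use push S_cball in \<open>auto simp: local_push_def\<close>)
  show thesis
  proof (rule deformation_glue[OF CA.Q_Hausdorff compact_S k_cont k_inj _ D_open h_S h(2) h(1), of Z])
    show "?D \<subseteq> ?S" by blast
    show "h t y = y" if "t \<in> {0..1}" "y \<in> ?S - ?D" for t y using h(3)[OF _ that(1), of y] that(2) by auto
    show "h t y = y" if "t \<in> {0..1}" "y \<in> ?S" "slice_map c y \<in> Z" for t y using Z[OF that] .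
  qed (auto intro: that)
qed

text \<open>Off the zero locus: push the slice along the direction of descent.\<close>

lemma lowering_off_zero_locus:
  assumes X: "X \<in> topspace CA.Q - zero_locus"
  shows "\<exists>U H. X \<in> U \<and> lowering CA.Q zero_locus size_s height U H"
proof -
  obtain x where x: "x \<in> P" "X = CA.q x" using X CA.topspace_Q by blast
  have xM: "x \<in> points M" and x0: "\<mu>\<^sub>G x = 0" using x(1) by (auto simp: zero_set_def)
  have sx: "s x \<noteq> 0" using X x(2) size_s_q[OF xM] by auto
  obtain c where c: "c \<in> atlas M" "x \<in> chart_dom c" using chart_exists[OF xM] .
  note inv = topological_chart_inverse[OF M_chart[OF c(1)]]
  let ?y0 = "chart_map c x"
  obtain \<Lambda> where \<Lambda>: "bounded_linear \<Lambda>" "\<And>\<xi>. \<Lambda> (gen c x (\<xi>, 0)) = \<xi>"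
    by (rule gen_left_inverse[OF c x0]) (rule that; assumption)
  obtain v where v: "differential c \<mu>\<^sub>G x v = 0" "\<Lambda> v = 0" "differential c \<mu>\<^sub>S x v < 0"
    "differential c s x v = - (real d *\<^sub>R s x)"
    by (rule descent_direction[OF c x0 sx \<Lambda>]) (rule that; assumption)
  obtain r1 where r1: "slice_chart c x \<Lambda> r1"
    by (rule slice_theorem[OF c x0 \<Lambda>]) (rule that; assumption)
  have r1_pos: "r1 > 0" using r1 by (simp add: slice_chart_def)
  define F where "F = (\<lambda>y. (local_rep c \<mu>\<^sub>G y, \<Lambda> (y - ?y0)))"
  note F = slice_constraint[OF c x0 \<Lambda>(1) F_def]
  have F'v: "(differential c \<mu>\<^sub>G x v, \<Lambda> v) = 0" using v(1,2) by (simp add: zero_prod_def)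
  have s_y0: "local_rep c s ?y0 = s x" using inv(1)[OF c(2)] by (simp add: local_rep_def)
  have s'v: "differential c s x v = - (real d *\<^sub>R local_rep c s ?y0)" using v(4) s_y0 by simp
  have sy0: "local_rep c s ?y0 \<noteq> 0" using s_y0 sx by simp
  have d0: "real d > 0" using d_pos by simp
  obtain r0 where r0: "r0 > 0"
    "\<And>r. 0 < r \<Longrightarrow> r \<le> r0 \<Longrightarrow> \<exists>h. local_push F ?y0 r (r / 2) h \<and>
       (\<forall>y\<in>ball ?y0 (r / 2). F y = F ?y0 \<longrightarrow>
          local_rep c \<mu>\<^sub>S (h 1 y) < local_rep c \<mu>\<^sub>S y \<and> norm (local_rep c s (h 1 y)) < norm (local_rep c s y))"
    by (rule push_down[OF fin_e F(1) slice_surj[OF c x0 \<Lambda>] \<mu>\<^sub>S_strict[OF c] s_strict[OF c] F'v v(3) s'v d0 sy0])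
      (rule that; assumption)
  have "isCont (local_rep c s) ?y0" by (rule has_strict_derivative_isCont[OF s_strict[OF c]])
  then have "\<forall>\<^sub>F y in nhds ?y0. local_rep c s y \<noteq> 0"
    using sy0 tendsto_at_iff_tendsto_nhds[of "local_rep c s" ?y0, THEN iffD1] by (auto simp: isCont_def intro: tendsto_imp_eventually_ne)
  then obtain r2 where r2: "r2 > 0" "\<And>y. dist y ?y0 < r2 \<Longrightarrow> local_rep c s y \<noteq> 0"
    unfolding eventually_nhds_metric by blast
  define r where "r = Min {r0, r1, r2 / 2}"
  have r: "0 < r" "r \<le> r0" "r \<le> r1" "r < r2" using r0(1) r1_pos r2(1) by (auto simp: r_def min_def)
  let ?S = "slice c x \<Lambda> r"
  obtain h where push: "local_push F ?y0 r (r / 2) h"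
    and low: "\<forall>y\<in>ball ?y0 (r / 2). F y = F ?y0 \<longrightarrow>
          local_rep c \<mu>\<^sub>S (h 1 y) < local_rep c \<mu>\<^sub>S y \<and> norm (local_rep c s (h 1 y)) < norm (local_rep c s y)"
    using r0(2)[OF r(1,2)] by (elim exE conjE) (rule that; assumption)
  have pt: "chart_inv c y \<in> points M" if "y \<in> ?S" for y using slice_point[OF c(1) r1 r(3) that] by (rule P_points)
  note h_S = slice_push(2)[OF c x0 \<Lambda>(1) push[unfolded F_def]]
  have h1: "\<mu>\<^sub>S (chart_inv c (h 1 y)) < \<mu>\<^sub>S (chart_inv c y) \<and> norm (s (chart_inv c (h 1 y))) < norm (s (chart_inv c y))"
    if "y \<in> ?S" "dist ?y0 y < r / 2" for y
    using low that unfolding F(2) by (simp add: local_rep_def)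
  have nonzero: "slice_map c y \<notin> zero_locus" if y: "y \<in> ?S" for y
  proof -
    have "y \<in> cball ?y0 r" using y by (simp add: slice_def)
    then have "dist y ?y0 < r2" using r(4) by (simp add: dist_commute)
    then show ?thesis using r2(2) size_s_q[OF pt[OF y]] by (auto simp: local_rep_def)
  qed
  have r_half: "0 < r / 2" "r / 2 \<le> r" using r(1) by auto
  obtain H where H: "deformation CA.Q zero_locus H"
    "\<And>t y. t \<in> {0..1} \<Longrightarrow> y \<in> ?S \<Longrightarrow> H t (slice_map c y) = slice_map c (h t y)"
    "\<And>t X. t \<in> {0..1} \<Longrightarrow> X \<in> topspace CA.Q - slice_map c ` {y \<in> ?S. dist ?y0 y < r / 2} \<Longrightarrow> H t X = X"
    by (rule slice_deformation[OF c x0 \<Lambda>(1) r1 r_half r(3) push[unfolded F_def], of zero_locus])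
      ((use nonzero in blast), (rule that; assumption))
  let ?D = "{y \<in> ?S. dist ?y0 y < r / 2}"
  note nbhd = slice_neighbourhood[OF c x0 \<Lambda>(1) r1 r_half r(3)]
  have "size_s (H 1 W) < size_s W \<and> height (H 1 W) \<le> height W" if W: "W \<in> slice_map c ` ?D" for W
  proof -
    obtain y where y: "y \<in> ?S" "dist ?y0 y < r / 2" "W = slice_map c y" using W by blast
    have hy: "h 1 y \<in> ?S" using h_S[OF y(1), of 1] by simp
    show ?thesis
      using h1[OF y(1,2)] H(2)[OF _ y(1), of 1] size_s_q[OF pt[OF y(1)]] size_s_q[OF pt[OF hy]]
        height_q[OF pt[OF y(1)]] height_q[OF pt[OF hy]] unfolding y(3) by simp
  qed
  then have "lowering CA.Q zero_locus size_s height (slice_map c ` ?D) H"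
    using H(1,3) nbhd(1) by (auto simp: lowering_def)
  then show ?thesis using nbhd(2) unfolding x(2) by (intro exI conjI)
qed

text \<open>At the zero locus: \<open>s\<close> is regular on the slice, so nearby points can be pushed into its zeros.\<close>

lemma absorb_into_zero_locus:
  assumes X: "X \<in> zero_locus"
  shows "\<exists>U H. X \<in> U \<and> openin CA.Q U \<and> deformation CA.Q zero_locus H \<and> H 1 ` U \<subseteq> zero_locus"
proof -
  obtain x where x: "x \<in> P" "X = CA.q x" using X CA.topspace_Q by blast
  have xM: "x \<in> points M" and x0: "\<mu>\<^sub>G x = 0" using x(1) by (auto simp: zero_set_def)
  have sx: "s x = 0" using X x(2) size_s_q[OF xM] by auto
  obtain c where c: "c \<in> atlas M" "x \<in> chart_dom c" using chart_exists[OF xM] .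
  note inv = topological_chart_inverse[OF M_chart[OF c(1)]]
  let ?y0 = "chart_map c x"
  obtain \<Lambda> where \<Lambda>: "bounded_linear \<Lambda>" "\<And>\<xi>. \<Lambda> (gen c x (\<xi>, 0)) = \<xi>"
    by (rule gen_left_inverse[OF c x0]) (rule that; assumption)
  obtain r1 where r1: "slice_chart c x \<Lambda> r1"
    by (rule slice_theorem[OF c x0 \<Lambda>]) (rule that; assumption)
  have r1_pos: "r1 > 0" using r1 by (simp add: slice_chart_def)
  define F where "F = (\<lambda>y. (local_rep c \<mu>\<^sub>G y, \<Lambda> (y - ?y0)))"
  note F = slice_constraint[OF c x0 \<Lambda>(1) F_def]
  have s_y0: "local_rep c s ?y0 = 0" using inv(1)[OF c(2)] sx by (simp add: local_rep_def)
  obtain r0 where r0: "r0 > 0"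
    "\<And>r. 0 < r \<Longrightarrow> r \<le> r0 \<Longrightarrow> \<exists>h r'. 0 < r' \<and> r' \<le> r / 2 \<and> local_push F ?y0 r r' h \<and>
       (\<forall>t\<in>{0..1}. \<forall>y\<in>cball ?y0 r. F y = F ?y0 \<and> local_rep c s y = 0 \<longrightarrow> h t y = y) \<and>
       (\<forall>y\<in>ball ?y0 (r' / 2). F y = F ?y0 \<longrightarrow> local_rep c s (h 1 y) = 0)"
    by (rule push_in[OF fin_e has_strict_derivative_Pair[OF F(1) s_strict[OF c]] joint_surj[OF c x0 sx \<Lambda>] s_y0])
      (rule that; assumption)
  define r where "r = min r0 r1"
  have r: "0 < r" "r \<le> r0" "r \<le> r1" using r0(1) r1_pos by (auto simp: r_def)
  let ?S = "slice c x \<Lambda> r"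
  obtain h r' where r': "0 < r'" "r' \<le> r / 2" and push: "local_push F ?y0 r r' h"
    and rest: "\<forall>t\<in>{0..1}. \<forall>y\<in>cball ?y0 r. F y = F ?y0 \<and> local_rep c s y = 0 \<longrightarrow> h t y = y"
    and zero_at: "\<forall>y\<in>ball ?y0 (r' / 2). F y = F ?y0 \<longrightarrow> local_rep c s (h 1 y) = 0"
    using r0(2)[OF r(1,2)] by (elim exE conjE) (rule that; assumption)
  note pt = slice_point[OF c(1) r1 r(3)]
  note h_S = slice_push(2)[OF c x0 \<Lambda>(1) push[unfolded F_def]]
  have zero: "slice_map c y \<in> zero_locus \<longleftrightarrow> s (chart_inv c y) = 0" if y: "y \<in> ?S" for y
    using size_s_q[OF P_points[OF pt[OF y]]] CA.topspace_Q pt[OF y] by auto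
  have r'_le: "r' \<le> r" and half: "0 < r' / 2" "r' / 2 \<le> r" using r' r(1) by auto
  have rest': "h t y = y" if "t \<in> {0..1}" "y \<in> ?S" "slice_map c y \<in> zero_locus" for t y
    using rest that(1,2) zero[OF that(2)] that(3) unfolding F(2) by (simp add: local_rep_def)
  obtain H where H: "deformation CA.Q zero_locus H"
    "\<And>t y. t \<in> {0..1} \<Longrightarrow> y \<in> ?S \<Longrightarrow> H t (slice_map c y) = slice_map c (h t y)"
    by (rule slice_deformation[OF c x0 \<Lambda>(1) r1 r'(1) r'_le r(3) push[unfolded F_def], of zero_locus])
      ((rule rest'; assumption), (rule that; assumption))
  let ?D = "{y \<in> ?S. dist ?y0 y < r' / 2}"
  note nbhd = slice_neighbourhood[OF c x0 \<Lambda>(1) r1 half r(3)]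
  have "H 1 ` slice_map c ` ?D \<subseteq> zero_locus"
  proof (intro image_subsetI, elim imageE, hypsubst)
    fix y assume y: "y \<in> ?D"
    then have "h 1 y \<in> ?S" using h_S[of y 1] by simp
    moreover have "s (chart_inv c (h 1 y)) = 0" using zero_at y unfolding F(2) by (simp add: local_rep_def)
    ultimately show "H 1 (slice_map c y) \<in> zero_locus" using y H(2)[of 1 y] zero[of "h 1 y"] by simp
  qed
  then show ?thesis using nbhd H(1) unfolding x(2) by (intro exI conjI)
qed

lemma zero_locus_eq: "zero_locus = CA.q ` (P \<inter> zero_set M s)"
proof (intro subset_antisym subsetI)
  fix X assume X: "X \<in> zero_locus"
  then obtain x where x: "x \<in> P" "X = CA.q x" using CA.topspace_Q by blast
  then show "X \<in> CA.q ` (P \<inter> zero_set M s)" using X size_s_q[OF P_points[OF x(1)]] by (auto simp: zero_set_def)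
next
  fix X assume "X \<in> CA.q ` (P \<inter> zero_set M s)"
  then obtain x where x: "x \<in> P" "s x = 0" "X = CA.q x" by (auto simp: zero_set_def)
  then show "X \<in> zero_locus" using size_s_q[OF P_points[OF x(1)]] CA.topspace_Q by auto
qed

lemma hyper_reduction_subspace: "hyper_reduction G M act \<mu>\<^sub>G s = subtopology CA.Q zero_locus"
  unfolding hyper_reduction_def zero_locus_eq
proof (rule CA.orbit_subspace)
  show "closedin T (zero_set M s)" using s_cont by (rule zero_set_closed)
  show "act (g, 1) x \<in> zero_set M s" if "g \<in> carrier G" "x \<in> P \<inter> zero_set M s" for g x
    using that s_inv[OF that(1)] act_closed[OF that(1), of 1 x] by (auto simp: zero_set_def)
qed

lemma sublevel_compact:
  assumes "circle_compact (reduction G M act \<mu>\<^sub>G) (reduced_circle_action G act) height"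
  shows "compactin CA.Q {X \<in> topspace CA.Q. height X \<le> b}"
proof -
  have proper: "proper_map CA.Q euclideanreal height" and bdd: "\<exists>B. \<forall>X\<in>topspace CA.Q. B \<le> height X"
    using assms unfolding circle_compact_def Q_reduction by blast+
  obtain B where B: "\<And>X. X \<in> topspace CA.Q \<Longrightarrow> B \<le> height X" using bdd by blast
  have "compactin CA.Q {X \<in> topspace CA.Q. height X \<in> {B..b}}"
    using proper by (rule compactin_proper_map_preimage) simp
  moreover have "{X \<in> topspace CA.Q. height X \<in> {B..b}} = {X \<in> topspace CA.Q. height X \<le> b}" using B by auto
  ultimately show ?thesis by simp
qed

text \<open>
  Properness and the lower bound of the moment map on \<open>M // G\<close> make its sublevel sets a compact exhaustion, and the two
  kinds of push supply the local data of the topological criterion.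
\<close>

theorem restriction_isomorphism:
  assumes cc: "circle_compact (reduction G M act \<mu>\<^sub>G) (reduced_circle_action G act) height"
  shows "cohomology_isomorphism TYPE('r::{ring,monoid_mult})
           (reduction G M act \<mu>\<^sub>G) (hyper_reduction G M act \<mu>\<^sub>G s) id"
proof -
  interpret exhausted_deformation CA.Q size_s height zero_locus
  proof
    show "continuous_map CA.Q euclideanreal size_s" by (rule size_s_cont)
    show "continuous_map CA.Q euclideanreal height" by (rule height_cont)
    show "0 \<le> size_s X" if "X \<in> topspace CA.Q" for X
      using that CA.topspace_Q size_s_q[OF P_points] by auto
    show "compactin CA.Q {X \<in> topspace CA.Q. height X \<le> b}" for b using cc by (rule sublevel_compact)
  qed (rule refl lowering_off_zero_locus absorb_into_zero_locus; assumption?)+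
  obtain \<rho> where \<rho>: "continuous_map CA.Q (subtopology CA.Q zero_locus) \<rho>" "\<And>X. X \<in> zero_locus \<Longrightarrow> \<rho> X = X"
    "homotopic_with (\<lambda>_. True) CA.Q CA.Q id \<rho>"
    using deformation_retract by blast
  have "cohomology_isomorphism TYPE('r) CA.Q (subtopology CA.Q zero_locus) id"
  proof (rule cohomology_isomorphism_deformation_retract[OF _ \<rho>(1) _ \<rho>(3)])
    show "continuous_map (subtopology CA.Q zero_locus) CA.Q id" by (simp add: continuous_map_from_subtopology)
    show "\<rho> X = X" if "X \<in> topspace (subtopology CA.Q zero_locus)" for X using that \<rho>(2)[of X] by simp
  qed
  then show ?thesis unfolding Q_reduction[symmetric] hyper_reduction_subspace .
qed

end

section \<open>The restriction map\<close>

theorem theorem2: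
  fixes G :: "'g monoid"
    and N :: "('g, 'h::real_normed_vector) manifold"
    and e :: "('g, 'h) chart"
    and M :: "('m, 'e::real_normed_vector) manifold"
    and \<omega> :: "('m, 'e) bilinear_field"
    and I :: "('m, 'e) endo_field"
    and act :: "'g \<times> complex \<Rightarrow> 'm \<Rightarrow> 'm"
    and \<mu>\<^sub>G :: "'m \<Rightarrow> 'h \<Rightarrow>\<^sub>L real"
    and \<mu>\<^sub>S :: "'m \<Rightarrow> real"
    and cscale :: "complex \<Rightarrow> 'v::real_normed_vector \<Rightarrow> 'v"
    and s :: "'m \<Rightarrow> 'v"
    and d :: nat
  assumes "lie_group G N" and "compact_space (mtop N)"
    and "e \<in> charts_at N \<one>\<^bsub>G\<^esub>"
    and "almost_kaehler M \<omega> I"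
    and "hamiltonian_action (G \<times>\<times> circle_group) (prod_manifold N circle_manifold)
           (prod_chart e (angle_chart (- pi))) M \<omega> act (pair_moment \<mu>\<^sub>G \<mu>\<^sub>S)"
    and "preserves_endo (G \<times>\<times> circle_group) M act I"
    and "complex_space cscale"
    and "holomorphic_function M I cscale s"
    and "\<And>g x. g \<in> carrier G \<Longrightarrow> x \<in> points M \<Longrightarrow> s (act (g, 1) x) = s x"
    and "d > 0"
    and "\<And>t x. t \<in> carrier circle_group \<Longrightarrow> x \<in> points M \<Longrightarrow>
           s (act (\<one>\<^bsub>G\<^esub>, t) x) = cscale (t ^ d) (s x)"
    and "regular_value M s 0" and "regular_value M \<mu>\<^sub>G 0"
    and "transverse_in M (zero_set M \<mu>\<^sub>G) (zero_set M s)"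
    and "\<And>x. x \<in> zero_set M \<mu>\<^sub>G \<Longrightarrow> stabilizer G (\<lambda>g. act (g, 1)) x = {\<one>\<^bsub>G\<^esub>}"
    and "circle_compact (mtop M) (\<lambda>t. act (\<one>\<^bsub>G\<^esub>, t)) \<mu>\<^sub>S"
    and "circle_compact (reduction G M act \<mu>\<^sub>G) (reduced_circle_action G act) (reduced_moment \<mu>\<^sub>S)"
  shows "cohomology_isomorphism TYPE('r::{ring,monoid_mult})
           (reduction G M act \<mu>\<^sub>G) (hyper_reduction G M act \<mu>\<^sub>G s) id"
proof -
  interpret hyper_reduction_setup G N e M \<omega> I act \<mu>\<^sub>G \<mu>\<^sub>S cscale s d
    by (intro hyper_reduction_setup.intro hamiltonian_setup.intro hyper_reduction_setup_axioms.intro) (fact assms)+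
  show ?thesis using assms(17) by (rule restriction_isomorphism)
qed

end
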